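(* Let $n\ge 2$ and $p>n$. Assume $u$ is an extremal of Morrey's inequality on $\mathbb{R}^n$ and $x_0,y_0\in\mathbb{R}^n$ are distinct points such that $$\sup_{x\ne y}\left\{\frac{|u(x)-u(y)|}{|x-y|^{1-n/p}}\right\}=\frac{|u(x_0)-u(y_0)|}{|x_0-y_0|^{1-n/p}}.$$ Then there are positive $A$, $\alpha$ and $s$ such that $$\left|u(x)-\frac{1}{2}(u(x_0)+u(y_0))\right|\le \frac{A\max\{|u(x_0)|,|u(y_0)|\}}{|x|^{\alpha}}$$ for each $|x|>s$.
   Context: Morrey's inequality: for $p>n$ there is a constant $C>0$ such that $$\sup_{x\ne y}\frac{|u(x)-u(y)|}{|x-y|^{1-n/p}}\le C\left(\int_{\mathbb{R}^n}|Du|^pdx\right)^{1/p}$$ for all continuously differentiable $u:\mathbb{R}^n\to\mathbb{R}$. It extends to all $u$ in $\mathcal{D}^{1,p}(\mathbb{R}^n)=\{u\in L^1_{\mathrm{loc}}(\mathbb{R}^n): u_{x_i}\in L^p(\mathbb{R}^n),\ i=1,\dots,n\}$ (weak derivatives), each $u$ being identified with its continuous representative. Let $C_*>0$ be the smallest constant $C$ for which it holds. An extremal is a nonconstant function $u\in\mathcal{D}^{1,p}(\mathbb{R}^n)$ for which equality holds in the inequality with $C=C_*$. An extremal with points $x_0,y_0$ as in the claim satisfies $-\Delta_p u=c(\delta_{x_0}-\delta_{y_0})$ weakly in $\mathbb{R}^n$ for some nonzero constant $c$, where $\Delta_p v=\mathrm{div}(|Dv|^{p-2}Dv)$. *)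

theory Defs
  imports "HOL-Analysis.Analysis"
begin

definition partial :: "'n \<Rightarrow> (real^'n \<Rightarrow> real) \<Rightarrow> real^'n \<Rightarrow> real" where
  "partial i f x = frechet_derivative f (at x) (axis i 1)"

primrec continuously_differentiable :: "nat \<Rightarrow> (real^'n \<Rightarrow> real) \<Rightarrow> bool" where
  "continuously_differentiable 0 f \<longleftrightarrow> continuous_on UNIV f"
| "continuously_differentiable (Suc k) f \<longleftrightarrow>
     f differentiable_on UNIV \<and> (\<forall>i. continuously_differentiable k (partial i f))"

definition test_fun :: "(real^'n \<Rightarrow> real) \<Rightarrow> bool" where
  "test_fun \<phi> \<longleftrightarrow> (\<forall>k. continuously_differentiable k \<phi>) \<and> compact (closure {x. \<phi> x \<noteq> 0})"

definition locally_integrable :: "(real^'n \<Rightarrow> real) \<Rightarrow> bool" where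
  "locally_integrable f \<longleftrightarrow> (\<forall>K. compact K \<longrightarrow> set_integrable lebesgue K f)"

definition in_Lp :: "real \<Rightarrow> (real^'n \<Rightarrow> real) \<Rightarrow> bool" where
  "in_Lp p f \<longleftrightarrow> f \<in> borel_measurable lebesgue \<and> integrable lebesgue (\<lambda>x. \<bar>f x\<bar> powr p)"

definition weak_partial :: "'n \<Rightarrow> (real^'n \<Rightarrow> real) \<Rightarrow> (real^'n \<Rightarrow> real) \<Rightarrow> bool" where
  "weak_partial i u g \<longleftrightarrow> locally_integrable u \<and> locally_integrable g \<and>
     (\<forall>\<phi>. test_fun \<phi> \<longrightarrow>
        (LINT x|lebesgue. u x * partial i \<phi> x) = - (LINT x|lebesgue. g x * \<phi> x))"

text \<open>
  The function \<open>Du\<close> is a representative of the weak gradient of \<open>u\<close> and has all its components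
  in \<open>L\<^sup>p\<close>. It is determined by \<open>u\<close> up to a null set.
\<close>

definition weak_grad_Lp :: "real \<Rightarrow> (real^'n \<Rightarrow> real) \<Rightarrow> (real^'n \<Rightarrow> real^'n) \<Rightarrow> bool" where
  "weak_grad_Lp p u Du \<longleftrightarrow>
     (\<forall>i. weak_partial i u (\<lambda>x. Du x $ i) \<and> in_Lp p (\<lambda>x. Du x $ i))"

definition D1p :: "real \<Rightarrow> (real^'n \<Rightarrow> real) set" where
  "D1p p = {u. locally_integrable u \<and> (\<exists>Du. weak_grad_Lp p u Du)}"

definition Lp_norm :: "real \<Rightarrow> (real^'n \<Rightarrow> real^'n) \<Rightarrow> real" where
  "Lp_norm p F = (LINT x|lebesgue. norm (F x) powr p) powr (1 / p)"

definition holder_quotient :: "real \<Rightarrow> (real^'n \<Rightarrow> real) \<Rightarrow> real^'n \<Rightarrow> real^'n \<Rightarrow> real" where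
  "holder_quotient p u x y = \<bar>u x - u y\<bar> / norm (x - y) powr (1 - real CARD('n) / p)"

text \<open>The supremum is taken in \<open>[0, \<infinity>]\<close>, so that an unbounded quotient gives \<open>\<infinity>\<close>.\<close>

definition holder_seminorm :: "real \<Rightarrow> (real^'n \<Rightarrow> real) \<Rightarrow> ennreal" where
  "holder_seminorm p u = (SUP (x, y)\<in>{(x, y). x \<noteq> y}. ennreal (holder_quotient p u x y))"

text \<open>
  For \<open>p > n\<close> every element of \<open>D\<^sup>1\<^sup>,\<^sup>p\<close> is identified with its continuous representative; this is
  the purpose of the continuity conditions below. The type argument carries the dimension.
\<close>

definition morrey_inequality :: "'n::finite itself \<Rightarrow> real \<Rightarrow> real \<Rightarrow> bool" where
  "morrey_inequality _ p C \<longleftrightarrow>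
     (\<forall>(u :: real^'n \<Rightarrow> real) Du.
        u \<in> D1p p \<and> continuous_on UNIV u \<and> weak_grad_Lp p u Du \<longrightarrow>
        holder_seminorm p u \<le> ennreal (C * Lp_norm p Du))"

definition morrey_const :: "'n::finite itself \<Rightarrow> real \<Rightarrow> real" where
  "morrey_const T p = (LEAST C. 0 < C \<and> morrey_inequality T p C)"

definition morrey_extremal :: "real \<Rightarrow> (real^'n \<Rightarrow> real) \<Rightarrow> bool" where
  "morrey_extremal p u \<longleftrightarrow>
     u \<in> D1p p \<and> continuous_on UNIV u \<and> \<not> u constant_on UNIV \<and>
     (\<exists>Du. weak_grad_Lp p u Du \<and>
        holder_seminorm p u = ennreal (morrey_const TYPE('n) p * Lp_norm p Du))"

end

(* An extremal u minimizes the p-energy among all functions with the same increment between x0 and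
   y0, since such functions have the same Hoelder quotient there.  Strict convexity makes the minimizer
   with given values at x0 and y0 unique, so u is odd (up to the additive constant
   m = (u x0 + u y0) / 2) under the point reflection swapping x0 and y0, and u takes values between
   u x0 and u y0, because a truncation does not increase the energy.

   For |u - m| <= M outside a ball of radius R about the midpoint, a convexity argument bounds the
   scale-invariant p-energy of ln (M + eps - (u - m)) on balls at distance of order r >= 10 R, hence,
   by Morrey's inequality on balls, its oscillation between a point and its antipode.  As u - m changes
   sign there, this is a Harnack inequality giving |u - m| <= theta M outside the ball of radius 10 R,
   with theta < 1 independent of R and M.  Iteration gives algebraic decay.

   Statements about weak derivatives are reduced to C^1 functions by mollification. *)

theory Submission
  imports Defs
begin

section \<open>Test functions and convolution\<close>

text \<open>Minimality is exploited only by inserting competitors, and each competitor needs a weak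
  gradient that can be computed. The product and chain rule is proved for C^1 outer functions on the
  whole line, which shapes the constructions: the truncation is a C^1 contraction, the cutoff is a
  power of a positive part, and the argument of the logarithm is continued to a positive C^1
  function beyond its intended range. Dimension at least 2 enters twice. It gives p > 2, so that
  strict convexity follows from the parallelogram law, and it gives a direction orthogonal to the
  line through a point and its antipode, so that two balls can join them while avoiding x0 and y0.
  The logarithm turns an oscillation bound into a ratio bound: M - s and M + s are the values of M -
  (u - m) at a point and its antipode, and if their ratio is bounded, then s \<le> \<theta> M. The
  eps keeps the logarithm finite and tends to 0 within each step. Since \<theta> depends only on n
  and p, so does the decay exponent.\<close>

definition exp_bump :: "nat \<Rightarrow> real \<Rightarrow> real" where
  "exp_bump m t = (if t \<le> 0 then 0 else exp (- (1 / t)) * (1 / t) ^ m)"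

lemma exp_bump_nonneg: "exp_bump m t \<ge> 0"
  by (simp add: exp_bump_def)

text \<open>Keeping only the term of degree m + 2 of the exponential series at 1 / t cancels
  \<open>(1 / t) ^ m\<close> and leaves a quadratic bound, just enough for the derivative at 0 to
  exist and vanish.\<close>

lemma exp_bump_le: "exp_bump m t \<le> fact (m + 2) * t\<^sup>2"
proof (cases "t \<le> 0")
  case False
  then have t: "t > 0" by simp
  have "(1/t) ^ (m+2) / fact (m+2) \<le> exp (1/t)"
  proof -
    have "(\<lambda>n. (1/t) ^ n / fact n) sums exp (1/t)"
      using exp_converges[of "1/t"] by (simp add: divide_inverse mult.commute)
    then have "(\<Sum>n\<in>{m+2}. (1/t) ^ n / fact n) \<le> exp (1/t)"
      using t by (intro sum_le_suminf[of "\<lambda>n. (1/t) ^ n / fact n" "{m+2}", THEN order_trans])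
        (auto simp: sums_iff)
    then show ?thesis by simp
  qed
  then have "exp (- (1/t)) * (1/t) ^ (m+2) / fact (m+2) \<le> exp (- (1/t)) * exp (1/t)"
    by (metis exp_ge_zero mult_left_mono times_divide_eq_right)
  also have "\<dots> = 1" by (simp flip: exp_add)
  finally have "exp (- (1/t)) * (1/t) ^ (m+2) \<le> fact (m+2)"
    by (simp only: divide_le_eq_1_pos fact_gt_zero)
  then have "exp (- (1/t)) * (1/t) ^ (m+2) * t\<^sup>2 \<le> fact (m+2) * t\<^sup>2"
    by (intro mult_right_mono) auto
  moreover have "exp (- (1/t)) * (1/t) ^ (m+2) * t\<^sup>2 = exp_bump m t"
    using t by (simp add: exp_bump_def power_add power2_eq_square)
  ultimately show ?thesis by simp
qed (simp add: exp_bump_def)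

text \<open>The family is indexed by m in order to be closed under differentiation: the exponential
  contributes the index m + 2, the power the index m + 1. Iteration then gives all derivatives of
  \<open>exp (- (1 / t))\<close>, flat continuation included.\<close>

lemma exp_bump_has_real_derivative:
  "(exp_bump m has_real_derivative exp_bump (m + 2) t - m * exp_bump (m + 1) t) (at t)"
proof -
  consider "t < 0" | "t = 0" | "t > 0" by linarith
  then show ?thesis
  proof cases
    case 1
    have "((\<lambda>_. 0) has_real_derivative 0) (at t)" by simp
    then have "(exp_bump m has_real_derivative 0) (at t)"
      by (rule has_field_derivative_transform_within_open[where S="{..<0}"])
        (use 1 in \<open>auto simp: exp_bump_def\<close>)
    then show ?thesis using 1 by (simp add: exp_bump_def)
  next
    case 2
    have "(\<lambda>h. exp_bump m h / h) \<midarrow>0\<rightarrow> 0"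
    proof (rule Lim_null_comparison)
      show "\<forall>\<^sub>F h in at 0. norm (exp_bump m h / h) \<le> fact (m+2) * \<bar>h\<bar>"
      proof (rule eventually_at_filter[THEN iffD2], rule always_eventually, safe)
        fix h :: real assume "h \<noteq> 0"
        then show "norm (exp_bump m h / h) \<le> fact (m+2) * \<bar>h\<bar>"
          using exp_bump_le[of m h] exp_bump_nonneg[of m h]
          by (simp add: pos_divide_le_eq power2_eq_square mult.assoc)
      qed
      have "((\<lambda>h. fact (m+2) * \<bar>h\<bar>) \<longlongrightarrow> fact (m+2) * \<bar>0::real\<bar>) (at 0)"
        by (intro tendsto_intros)
      then show "((\<lambda>h::real. fact (m+2) * \<bar>h\<bar>) \<longlongrightarrow> 0) (at 0)" by simp
    qed
    then show ?thesis using 2 by (simp add: DERIV_def exp_bump_def)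
  next
    case 3
    let ?s = "1 / t"
    have 1: "((\<lambda>t. 1 / t) has_real_derivative - (?s ^ 2)) (at t)"
      using 3 by (auto intro!: derivative_eq_intros simp: power2_eq_square)
    have "((\<lambda>t. exp (- (1 / t)) * (1 / t) ^ m) has_real_derivative
        exp (- ?s) * (real m * (- (?s ^ 2) * ?s ^ (m - Suc 0))) + exp (- ?s) * - (- (?s ^ 2)) * ?s ^ m) (at t)"
      by (intro DERIV_mult' DERIV_power DERIV_fun_exp DERIV_minus 1)
    moreover have "real m * (- (?s ^ 2) * ?s ^ (m - Suc 0)) = - (real m * ?s ^ (m + 1))"
      by (cases m) (simp_all add: power2_eq_square)
    ultimately have "((\<lambda>t. exp (- (1 / t)) * (1 / t) ^ m) has_real_derivative
        exp (- ?s) * - (real m * ?s ^ (m + 1)) + exp (- ?s) * - (- (?s ^ 2)) * ?s ^ m) (at t)"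
      by metis
    moreover have "exp (- ?s) * - (real m * ?s ^ (m + 1)) + exp (- ?s) * - (- (?s ^ 2)) * ?s ^ m =
        exp_bump (m + 2) t - m * exp_bump (m + 1) t"
      using 3 by (simp add: exp_bump_def power_add power2_eq_square)
    ultimately have "((\<lambda>t. exp (- (1 / t)) * (1 / t) ^ m) has_real_derivative
        exp_bump (m + 2) t - m * exp_bump (m + 1) t) (at t)"
      by metis
    then show ?thesis
      by (rule has_field_derivative_transform_within_open[where S="{0<..}"])
        (use 3 in \<open>auto simp: exp_bump_def\<close>)
  qed
qed

section \<open>Gradients of C^1 functions and smoothness of the bump\<close>

definition C1_grad :: "(real^'n \<Rightarrow> real) \<Rightarrow> (real^'n \<Rightarrow> real^'n) \<Rightarrow> bool" where
  "C1_grad f g \<longleftrightarrow> (\<forall>x. (f has_derivative (\<lambda>h. g x \<bullet> h)) (at x)) \<and> continuous_on UNIV g"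

lemma C1_gradD:
  assumes "C1_grad f g"
  shows "(f has_derivative (\<lambda>h. g x \<bullet> h)) (at x within S)" "continuous_on S g" "continuous_on S f"
    "isCont f x" "isCont g x"
proof -
  show 1: "(f has_derivative (\<lambda>h. g x \<bullet> h)) (at x within S)" for x S
    using assms by (simp add: C1_grad_def has_derivative_at_withinI)
  show "continuous_on S g" using assms by (auto simp: C1_grad_def intro: continuous_on_subset)
  show "continuous_on S f" by (rule has_derivative_continuous_on) (rule 1)
  show "isCont f x" by (rule has_derivative_continuous) (rule 1)
  show "isCont g x" using assms by (simp add: C1_grad_def continuous_on_eq_continuous_at)
qed

lemma partial_eqI:
  assumes "(f has_derivative (\<lambda>h. g \<bullet> h)) (at x)"
  shows "partial i f x = g $ i"
  using frechet_derivative_at[OF assms, symmetric] by (simp add: partial_def inner_axis)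

lemma has_derivative_partials:
  assumes "f differentiable (at x)"
  shows "(f has_derivative (\<lambda>h. (\<chi> i. partial i f x) \<bullet> h)) (at x)"
proof -
  let ?d = "frechet_derivative f (at x)"
  have d: "(f has_derivative ?d) (at x)" using assms by (simp add: frechet_derivative_works)
  then interpret bounded_linear ?d by (rule has_derivative_bounded_linear)
  have "?d h = (\<chi> i. partial i f x) \<bullet> h" for h
  proof -
    have "?d h = ?d (\<Sum>i\<in>UNIV. h $ i *\<^sub>R axis i 1)"
      by (simp only: basis_expansion flip: scalar_mult_eq_scaleR)
    also have "\<dots> = (\<Sum>i\<in>UNIV. h $ i * partial i f x)"
      by (simp add: sum scaleR partial_def)
    finally show ?thesis by (simp add: inner_vec_def mult.commute)
  qed
  then have "?d = (\<lambda>h. (\<chi> i. partial i f x) \<bullet> h)" by (rule ext)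
  then show ?thesis using d by simp
qed

lemma test_fun_C1:
  assumes "test_fun \<phi>"
  shows "C1_grad \<phi> (\<lambda>x. \<chi> i. partial i \<phi> x)"
proof -
  have "continuously_differentiable (Suc 0) \<phi>" using assms by (auto simp: test_fun_def)
  then have "\<phi> differentiable_on UNIV" "\<And>i. continuous_on UNIV (partial i \<phi>)" by auto
  then show ?thesis
    unfolding C1_grad_def
    by (auto intro!: has_derivative_partials continuous_on_vec_lambda simp: differentiable_on_def)
qed

lemma test_fun_continuous:
  assumes "test_fun \<phi>"
  shows "continuous_on UNIV \<phi>" "continuous_on UNIV (partial i \<phi>)"
proof -
  have "continuously_differentiable (Suc 0) \<phi>" using assms by (auto simp: test_fun_def)
  then show "continuous_on UNIV \<phi>" "continuous_on UNIV (partial i \<phi>)"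
    by (auto intro: differentiable_imp_continuous_on)
qed

lemma test_fun_support:
  assumes "test_fun \<phi>"
  obtains R where "R > 0" "\<And>x. norm x > R \<Longrightarrow> \<phi> x = 0"
proof -
  have "bounded (closure {x. \<phi> x \<noteq> 0})" using assms compact_imp_bounded by (auto simp: test_fun_def)
  then obtain R where "\<And>x. x \<in> closure {x. \<phi> x \<noteq> 0} \<Longrightarrow> norm x \<le> R" by (auto simp: bounded_iff)
  then have "norm x > max R 1 \<Longrightarrow> \<phi> x = 0" for x
    using closure_subset[of "{x. \<phi> x \<noteq> 0}"] by force
  then show ?thesis by (rule that[of "max R 1", rotated]) auto
qed

lemma continuously_differentiable_Suc_imp:
  "continuously_differentiable (Suc k) f \<Longrightarrow> continuously_differentiable k f"
  by (induction k arbitrary: f) (auto intro: differentiable_imp_continuous_on)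

lemma continuously_differentiable_const:
  "continuously_differentiable k (\<lambda>x::real^'n. c)"
proof (induction k arbitrary: c)
  case (Suc k)
  have "partial i (\<lambda>x::real^'n. c) = (\<lambda>x. 0)" for i
    by (rule ext) (simp add: partial_def)
  then show ?case using Suc[of 0] by (simp del: split_paired_All)
qed simp

lemma continuously_differentiable_coord:
  "continuously_differentiable k (\<lambda>x::real^'n. x $ j)"
proof (cases k)
  case (Suc k)
  have 1: "((\<lambda>x. x $ j) has_derivative (\<lambda>h. axis j 1 \<bullet> h)) (at x)" for x :: "real^'n"
    using bounded_linear_imp_has_derivative[OF bounded_linear_vec_nth] by (simp add: inner_axis')
  have "partial i (\<lambda>x::real^'n. x $ j) = (\<lambda>x. axis j 1 $ i)" for i
    by (rule ext) (rule partial_eqI[OF 1])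
  moreover have "(\<lambda>x::real^'n. x $ j) differentiable_on UNIV"
    unfolding differentiable_on_def differentiable_def using 1 by blast
  ultimately show ?thesis using Suc by (simp add: continuously_differentiable_const)
qed (auto intro!: continuous_intros)

lemma continuously_differentiable_add:
  "continuously_differentiable k f \<Longrightarrow> continuously_differentiable k g \<Longrightarrow>
   continuously_differentiable k (\<lambda>x. f x + g x)"
proof (induction k arbitrary: f g)
  case (Suc k)
  then have d: "f differentiable (at x)" "g differentiable (at x)" for x
    by (auto simp: differentiable_on_def)
  have "partial i (\<lambda>x. f x + g x) x = partial i f x + partial i g x" for i x
  proof -
    have "((\<lambda>x. f x + g x) has_derivative
      (\<lambda>h. ((\<chi> i. partial i f x) + (\<chi> i. partial i g x)) \<bullet> h)) (at x)"
      using d[of x, THEN has_derivative_partials]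
      by (auto intro!: derivative_eq_intros simp: inner_add_left)
    from partial_eqI[OF this] show ?thesis by simp
  qed
  then have "partial i (\<lambda>x. f x + g x) = (\<lambda>x. partial i f x + partial i g x)" for i by auto
  then show ?case using Suc by (auto simp: differentiable_on_def)
qed (auto intro: continuous_intros)

lemma continuously_differentiable_mult:
  "continuously_differentiable k f \<Longrightarrow> continuously_differentiable k g \<Longrightarrow>
   continuously_differentiable k (\<lambda>x. f x * g x)"
proof (induction k arbitrary: f g)
  case (Suc k)
  then have d: "f differentiable (at x)" "g differentiable (at x)" for x
    by (auto simp: differentiable_on_def)
  have "partial i (\<lambda>x. f x * g x) x = f x * partial i g x + partial i f x * g x" for i x
  proof -
    have "((\<lambda>x. f x * g x) has_derivative
      (\<lambda>h. (f x *\<^sub>R (\<chi> i. partial i g x) + g x *\<^sub>R (\<chi> i. partial i f x)) \<bullet> h)) (at x)"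
      using d[of x, THEN has_derivative_partials]
      by (auto intro!: derivative_eq_intros simp: inner_add_left)
    from partial_eqI[OF this] show ?thesis by simp
  qed
  then have "partial i (\<lambda>x. f x * g x) = (\<lambda>x. f x * partial i g x + partial i f x * g x)" for i by auto
  moreover have "continuously_differentiable k f" "continuously_differentiable k g"
    using Suc.prems continuously_differentiable_Suc_imp by blast+
  moreover have "\<forall>i. continuously_differentiable k (partial i f)" "\<forall>i. continuously_differentiable k (partial i g)"
    using Suc.prems by auto
  ultimately show ?case using Suc
    by (auto simp: differentiable_on_def intro!: continuously_differentiable_add)
qed (auto intro: continuous_intros)

lemma continuously_differentiable_diff:
  assumes "continuously_differentiable k f" "continuously_differentiable k g"
  shows "continuously_differentiable k (\<lambda>x. f x - g x)"
proof -
  have "continuously_differentiable k (\<lambda>x. f x + (-1) * g x)"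
    using assms by (intro continuously_differentiable_add continuously_differentiable_mult
      continuously_differentiable_const)
  then show ?thesis by simp
qed

lemma continuously_differentiable_sum:
  "(\<And>j. j \<in> J \<Longrightarrow> continuously_differentiable k (f j)) \<Longrightarrow>
   continuously_differentiable k (\<lambda>x. \<Sum>j\<in>J. f j x)"
  by (induction J rule: infinite_finite_induct)
    (auto intro: continuously_differentiable_const continuously_differentiable_add)

text \<open>The induction on k has to keep m arbitrary, because each derivative raises the index of
  the bump.\<close>

lemma continuously_differentiable_exp_bump:
  assumes "\<And>k. continuously_differentiable k q"
  shows "continuously_differentiable k (\<lambda>x. exp_bump m (q x))"
proof (induction k arbitrary: m)
  case 0
  have "continuous_on UNIV (exp_bump m)"
    using exp_bump_has_real_derivative DERIV_isCont by (force simp: continuous_on_eq_continuous_at)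
  moreover have "continuous_on UNIV q" using assms[of 0] by simp
  ultimately show ?case by (auto intro: continuous_on_compose2)
next
  case (Suc k)
  have d: "q differentiable (at x)" for x
    using assms[of "Suc 0"] by (auto simp: differentiable_on_def)
  have D: "((\<lambda>x. exp_bump m (q x)) has_derivative
     (\<lambda>h. ((exp_bump (m+2) (q x) - m * exp_bump (m+1) (q x)) *\<^sub>R (\<chi> i. partial i q x)) \<bullet> h)) (at x)" for x
    using has_derivative_compose[OF d[of x, THEN has_derivative_partials]
        exp_bump_has_real_derivative[of m "q x", unfolded has_field_derivative_def]]
    by simp
  have P: "partial i (\<lambda>x. exp_bump m (q x)) =
    (\<lambda>x. (exp_bump (m+2) (q x) - real m * exp_bump (m+1) (q x)) * partial i q x)" for i
    by (rule ext, subst partial_eqI[OF D]) simp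
  have "continuously_differentiable k (partial i q)" for i
    using assms[of "Suc k"] by simp
  then have "continuously_differentiable k (partial i (\<lambda>x. exp_bump m (q x)))" for i
    unfolding P by (intro continuously_differentiable_diff continuously_differentiable_mult
        continuously_differentiable_const Suc)
  moreover have "(\<lambda>x. exp_bump m (q x)) differentiable_on UNIV"
    unfolding differentiable_on_def differentiable_def using D by blast
  ultimately show ?case by simp
qed

text \<open>The squared norm makes the inner function a polynomial in the coordinates, hence smooth
  at the origin as well.\<close>

definition bump :: "real \<Rightarrow> real^'n \<Rightarrow> real" where
  "bump e z = exp_bump 0 (e\<^sup>2 - (norm z)\<^sup>2)"

lemma bump_eq_0: "e > 0 \<Longrightarrow> norm z \<ge> e \<Longrightarrow> bump e z = 0"
  by (simp add: bump_def exp_bump_def power_mono)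

lemma bump_pos: "norm z < e \<Longrightarrow> bump e z > 0"
proof -
  assume "norm z < e"
  then have "(norm z)\<^sup>2 < e\<^sup>2" by (intro power_strict_mono) auto
  then show ?thesis by (simp add: bump_def exp_bump_def)
qed

lemma test_fun_bump:
  assumes "e > 0"
  shows "test_fun (\<lambda>y. c * bump e (x - y))"
  unfolding test_fun_def
proof
  have "e\<^sup>2 - (norm (x - y))\<^sup>2 = e\<^sup>2 - (\<Sum>i\<in>UNIV. (x $ i - y $ i) * (x $ i - y $ i))" for y
    by (simp add: power2_norm_eq_inner inner_vec_def)
  then show "\<forall>k. continuously_differentiable k (\<lambda>y. c * bump e (x - y))"
    unfolding bump_def
    by (auto intro!: continuously_differentiable_exp_bump continuously_differentiable_diff
      continuously_differentiable_mult continuously_differentiable_const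
      continuously_differentiable_sum continuously_differentiable_coord)
  have "{y. c * bump e (x - y) \<noteq> 0} \<subseteq> cball x e"
  proof clarsimp
    fix y assume "bump e (x - y) \<noteq> 0"
    then show "dist x y \<le> e" using bump_eq_0[OF assms, of "x - y"] by (force simp: dist_norm)
  qed
  then have "closure {y. c * bump e (x - y) \<noteq> 0} \<subseteq> cball x e"
    by (rule closure_minimal) simp
  then show "compact (closure {y. c * bump e (x - y) \<noteq> 0})"
    by (metis bounded_cball bounded_subset compact_eq_bounded_closed closed_closure)
qed

section \<open>Compactly supported functions and their integrals\<close>

lemma compact_support_uniformly_continuous:
  fixes k :: "'a::euclidean_space \<Rightarrow> 'b::real_normed_vector"
  assumes "continuous_on UNIV k" "\<And>x. norm x > R \<Longrightarrow> k x = 0"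
  shows "uniformly_continuous_on UNIV k"
  unfolding uniformly_continuous_on_def
proof (intro allI impI)
  fix e :: real assume "e > 0"
  \<comment> \<open>With the margin 1, two points at distance below 1 either both lie in this ball
    or both lie where k vanishes.\<close>
  have "uniformly_continuous_on (cball 0 (R+1)) k"
    by (intro compact_uniformly_continuous continuous_on_subset[OF assms(1)]) auto
  then obtain d where d: "d > 0" "\<And>x y. x \<in> cball 0 (R+1) \<Longrightarrow> y \<in> cball 0 (R+1) \<Longrightarrow> dist y x < d \<Longrightarrow> dist (k y) (k x) < e"
    using \<open>e > 0\<close> unfolding uniformly_continuous_on_def by metis
  show "\<exists>d>0. \<forall>x\<in>UNIV. \<forall>y\<in>UNIV. dist y x < d \<longrightarrow> dist (k y) (k x) < e"
  proof (intro exI[of _ "min d 1"] conjI ballI impI)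
    fix x y :: 'a assume xy: "dist y x < min d 1"
    have n: "norm x \<le> norm y + dist y x" "norm y \<le> norm x + dist y x"
      by (metis dist_commute dist_norm norm_triangle_sub add.commute)+
    show "dist (k y) (k x) < e"
    proof (cases "norm x \<le> R \<or> norm y \<le> R")
      case True
      then have "norm x \<le> R + 1" "norm y \<le> R + 1" using xy n by auto
      then show ?thesis using d xy by auto
    next
      case False
      then show ?thesis using assms(2) \<open>e > 0\<close> by auto
    qed
  qed (use d in auto)
qed

lemma compact_support_bounded:
  fixes k :: "'a::euclidean_space \<Rightarrow> 'b::real_normed_vector"
  assumes "continuous_on UNIV k" "\<And>x. norm x > R \<Longrightarrow> k x = 0"
  obtains B where "B > 0" "\<And>x. norm (k x) \<le> B"
proof -
  have "compact (k ` cball 0 R)"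
    by (intro compact_continuous_image continuous_on_subset[OF assms(1)]) auto
  then obtain B where "B > 0" "\<And>x. x \<in> cball 0 R \<Longrightarrow> norm (k x) \<le> B"
    using compact_imp_bounded bounded_pos by (metis imageI)
  then have "norm (k x) \<le> B" for x using assms(2)[of x] by (cases "norm x \<le> R") auto
  then show ?thesis using that \<open>B > 0\<close> by blast
qed

lemma C1_grad_eq_0:
  assumes "C1_grad f g" "\<And>x. norm x > R \<Longrightarrow> f x = 0" "norm x > R"
  shows "g x = 0"
proof -
  have o: "open {x::real^'a. norm x > R}" by (intro open_Collect_less continuous_intros)
  have "((\<lambda>x. 0) has_derivative (\<lambda>h. g x \<bullet> h)) (at x)"
    by (rule has_derivative_transform_within_open[OF C1_gradD(1)[OF assms(1)] o]) (use assms in auto)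
  then have "(\<lambda>h. g x \<bullet> h) = (\<lambda>h. 0)" by (rule has_derivative_unique) simp
  then have "g x \<bullet> g x = 0" by metis
  then show ?thesis by simp
qed

text \<open>The mean value estimate with the uniformly continuous gradient gives one d for all base
  points z, as is needed when the linearization is integrated over z.\<close>

lemma C1_uniformly_differentiable:
  fixes f :: "real^'n \<Rightarrow> real"
  assumes f: "C1_grad f g" "\<And>x. norm x > R \<Longrightarrow> f x = 0" and "e > 0"
  obtains d where "d > 0" "\<And>z h. norm h < d \<Longrightarrow> \<bar>f (z + h) - f z - g z \<bullet> h\<bar> \<le> e * norm h"
proof -
  have "uniformly_continuous_on UNIV g"
    using C1_gradD(2)[OF f(1)] C1_grad_eq_0[OF f] by (rule compact_support_uniformly_continuous)
  then obtain d where d: "d > 0" "\<And>x y. dist y x < d \<Longrightarrow> dist (g y) (g x) < e"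
    using \<open>e > 0\<close> unfolding uniformly_continuous_on_def by (metis UNIV_I)
  have "\<bar>f (z + h) - f z - g z \<bullet> h\<bar> \<le> e * norm h" if "norm h < d" for z h
  proof -
    have "norm (f (z + h) - f z - (\<lambda>h. g z \<bullet> h) ((z + h) - z)) \<le> norm ((z + h) - z) * e"
    proof (rule differentiable_bound_linearization[where S="ball z d" and f'="\<lambda>x h. g x \<bullet> h"])
      fix t :: real assume t: "t \<in> {0..1}"
      then have "norm (t *\<^sub>R h) \<le> norm h" by (simp add: mult_left_le_one_le)
      then show "z + t *\<^sub>R (z + h - z) \<in> ball z d" using that by (simp add: dist_norm)
    next
      fix x assume "x \<in> ball z d"
      then have "norm (g x - g z) \<le> e" using d(2)[of x z] by (simp add: dist_norm norm_minus_commute)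
      then have "norm ((g x - g z) \<bullet> h) \<le> e * norm h" for h
        by (metis mult_right_mono Cauchy_Schwarz_ineq2 norm_ge_zero order_trans real_norm_def)
      then show "onorm ((\<lambda>h. g x \<bullet> h) - (\<lambda>h. g z \<bullet> h)) \<le> e"
        by (intro onorm_le) (auto simp: inner_diff_left)
    qed (use d C1_gradD(1)[OF f(1)] in auto)
    then show ?thesis by (simp add: mult.commute)
  qed
  then show ?thesis using that d by blast
qed

lemma integral_lborel_shift:
  fixes f :: "'a::euclidean_space \<Rightarrow> 'b::{banach, second_countable_topology}"
  assumes "f \<in> borel_measurable borel"
  shows "(LBINT x. f (c + x)) = (LBINT x. f x)"
    "integrable lborel (\<lambda>x. f (c + x)) \<longleftrightarrow> integrable lborel f"
  using assms integral_distr[of "(+) c" lborel borel f] integrable_distr_eq[of "(+) c" lborel borel f]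
  by (simp_all add: lborel_distr_plus)

lemma lborel_distr_reflect:
  "distr lborel borel (\<lambda>x. c - x) = (lborel :: 'a::euclidean_space measure)"
  using lborel_affine[of "-1::real" c] by (simp add: density_1)

lemma integral_lborel_reflect:
  fixes f :: "'a::euclidean_space \<Rightarrow> 'b::{banach, second_countable_topology}"
  assumes "f \<in> borel_measurable borel"
  shows "(LBINT x. f (c - x)) = (LBINT x. f x)"
    "integrable lborel (\<lambda>x. f (c - x)) \<longleftrightarrow> integrable lborel f"
  using assms integral_distr[of "\<lambda>x. c - x" lborel borel f]
    integrable_distr_eq[of "\<lambda>x. c - x" lborel borel f]
  by (simp_all add: lborel_distr_reflect)

lemma integrable_compact_support:
  fixes k :: "'a::euclidean_space \<Rightarrow> 'b::{banach, second_countable_topology}"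
  assumes "continuous_on UNIV k" "\<And>x. norm x > R \<Longrightarrow> k x = 0"
  shows "integrable lborel k"
proof -
  have "integrable lborel (\<lambda>x. indicator (cball 0 R) x *\<^sub>R k x)"
    by (intro borel_integrable_compact continuous_on_subset[OF assms(1)]) auto
  moreover have "(\<lambda>x. indicator (cball 0 R) x *\<^sub>R k x) = k"
    using assms(2) by (auto simp: indicator_def fun_eq_iff)
  ultimately show ?thesis by simp
qed

lemma integrable_indicator_cball: "integrable lborel (indicator (cball c R) :: 'a::euclidean_space \<Rightarrow> real)"
  using borel_integrable_compact[of "cball c R" "\<lambda>_. 1::real"] by simp

text \<open>By translation invariance the integral of f (x + h) - f x is 0. For h of length s along
  the i-th axis it also differs from s times the integral of the i-th partial derivative by at most
  e' s V, so that derivative has integral at most e for every e. This is the source of all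
  integration by parts below.\<close>

lemma integral_gradient_0:
  fixes f :: "real^'n \<Rightarrow> real"
  assumes f: "C1_grad f g" "\<And>x. norm x > R \<Longrightarrow> f x = 0"
  shows "(LBINT x. g x $ i) = 0"
proof -
  have c: "continuous_on UNIV f" "continuous_on UNIV g" using C1_gradD[OF f(1)] by auto
  have m[measurable]: "f \<in> borel_measurable borel" "g \<in> borel_measurable borel"
    using c by (auto intro: borel_measurable_continuous_onI)
  have fi: "integrable lborel f" by (rule integrable_compact_support[OF c(1) f(2)])
  have gi: "integrable lborel (\<lambda>x. g x $ i)"
    by (rule integrable_compact_support[where R=R]) (use c C1_grad_eq_0[OF f] in \<open>auto intro!: continuous_intros\<close>)
  define V where "V = measure lborel (cball (0::real^'n) (R+1))"
  have "\<bar>\<integral>x. g x $ i \<partial>lborel\<bar> \<le> e" if "e > 0" for e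
  proof -
    have V: "V \<ge> 0" by (simp add: V_def)
    define e' where "e' = e / (V + 1)"
    have "e' > 0" using V \<open>e > 0\<close> by (simp add: e'_def)
    then obtain d where d: "d > 0" "\<And>z h. norm h < d \<Longrightarrow> \<bar>f (z + h) - f z - g z \<bullet> h\<bar> \<le> e' * norm h"
      using C1_uniformly_differentiable[OF f] by blast
    define s where "s = min d 1 / 2"
    have s: "s > 0" "s < d" "s < 1" using d by (auto simp: s_def)
    let ?h = "axis i s :: real^'n"
    have nh: "norm ?h = s" using s by (simp add: norm_eq_sqrt_inner inner_axis_axis)
    have gh: "g z \<bullet> ?h = s * g z $ i" for z by (simp add: inner_axis)
    have "norm (LBINT x. f (?h + x) - f x - s * g x $ i)
      \<le> (LBINT x. norm (f (?h + x) - f x - s * g x $ i))"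
      by (rule integral_norm_bound)
    also have "\<dots> \<le> (LBINT x. e' * s * indicator (cball (0::real^'n) (R+1)) x)"
    proof (rule Bochner_Integration.integral_mono)
      show "integrable lborel (\<lambda>x. norm (f (?h + x) - f x - s * g x $ i))"
        using fi gi integral_lborel_shift(2)[OF m(1)] by simp
      show "integrable lborel (\<lambda>x. e' * s * indicator (cball (0::real^'n) (R+1)) x)"
        by (intro integrable_mult_right integrable_indicator_cball)
      fix x :: "real^'n"
      have 1: "norm (f (?h + x) - f x - s * g x $ i) \<le> e' * s"
      proof -
        have "\<bar>f (x + ?h) - f x - g x \<bullet> ?h\<bar> \<le> e' * norm ?h" using nh s by (intro d(2)) simp
        then show ?thesis using nh gh by (simp add: add.commute)
      qed
      show "norm (f (?h + x) - f x - s * g x $ i) \<le> e' * s * indicator (cball 0 (R+1)) x"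
      proof (cases "norm x \<le> R + 1")
        case True then show ?thesis using 1 by simp
      next
        case False
        have "norm x \<le> norm (?h + x) + norm ?h"
          by (metis add_diff_cancel_left' norm_triangle_sub norm_minus_commute add.commute)
        then have "norm (?h + x) > R" "norm x > R" using False nh s by auto
        then show ?thesis using False f(2) C1_grad_eq_0[OF f] by simp
      qed
    qed
    also have "\<dots> = e' * s * V" by (simp add: V_def)
    finally have "norm (LBINT x. f (?h + x) - f x - s * g x $ i) \<le> e' * s * V" .
    moreover have "(LBINT x. f (?h + x) - f x - s * g x $ i) = - (s * (LBINT x. g x $ i))"
      using fi gi integral_lborel_shift[OF m(1)] by simp
    ultimately have "s * \<bar>\<integral>x. g x $ i \<partial>lborel\<bar> \<le> s * (e' * V)" using s by (simp add: abs_mult mult_ac)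
    then have "\<bar>\<integral>x. g x $ i \<partial>lborel\<bar> \<le> e' * V" using s by simp
    also have "\<dots> \<le> e" using V \<open>e > 0\<close> by (simp add: e'_def field_simps)
    finally show ?thesis .
  qed
  then show ?thesis by (metis abs_le_zero_iff field_le_epsilon add_0)
qed

section \<open>Local integrability and convolution\<close>

definition loc_int :: "(real^'n \<Rightarrow> 'b::{banach, second_countable_topology}) \<Rightarrow> bool" where
  "loc_int f \<longleftrightarrow> f \<in> borel_measurable borel \<and> (\<forall>R. integrable lborel (\<lambda>x. indicator (cball 0 R) x *\<^sub>R f x))"

lemma loc_int_norm: "loc_int f \<Longrightarrow> integrable lborel (\<lambda>x. indicator (cball 0 R) x * norm (f x))"
  using integrable_norm[of lborel "\<lambda>x. indicator (cball 0 R) x *\<^sub>R f x"] by (simp add: loc_int_def)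

lemma loc_int_continuous: "continuous_on UNIV f \<Longrightarrow> loc_int f"
  unfolding loc_int_def
  by (auto intro!: borel_measurable_continuous_onI borel_integrable_compact intro: continuous_on_subset)

text \<open>The form in which dominated integrands are handled throughout: B is a bound for a kernel
  or an error factor, and the ball contains its support.\<close>

lemma loc_int_bound:
  fixes h :: "real^'n \<Rightarrow> 'c::{banach, second_countable_topology}"
  assumes "loc_int f" "h \<in> borel_measurable borel"
    "\<And>x. norm (h x) \<le> B * (indicator (cball 0 R) x * norm (f x))"
  shows "integrable lborel h" "norm (LBINT x. h x) \<le> B * (LBINT x. indicator (cball 0 R) x * norm (f x))"
proof -
  have i: "integrable lborel (\<lambda>x. B * (indicator (cball 0 R) x * norm (f x)))"
    using loc_int_norm[OF assms(1)] by simp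
  show hi: "integrable lborel h"
    by (rule Bochner_Integration.integrable_bound[OF i])
      (use assms in \<open>auto intro: order_trans[OF _ abs_ge_self]\<close>)
  have "norm (LBINT x. h x) \<le> (LBINT x. norm (h x))" by (rule integral_norm_bound)
  also have "\<dots> \<le> (LBINT x. B * (indicator (cball 0 R) x * norm (f x)))"
    by (intro Bochner_Integration.integral_mono integrable_norm hi i assms)
  finally show "norm (LBINT x. h x) \<le> B * (LBINT x. indicator (cball 0 R) x * norm (f x))" by simp
qed

definition convolve :: "(real^'n \<Rightarrow> real) \<Rightarrow> (real^'n \<Rightarrow> 'b::{banach, second_countable_topology}) \<Rightarrow> real^'n \<Rightarrow> 'b" where
  "convolve k f x = (LBINT y. k (x - y) *\<^sub>R f y)"

lemma norm_diff_gt: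
  fixes x y :: "'a::real_normed_vector"
  assumes "\<not> norm y \<le> S" "norm x + R \<le> S" shows "norm (x - y) > R"
  using assms norm_triangle_sub[of y x] by (simp add: norm_minus_commute)

lemma convolve_integrable:
  assumes k: "continuous_on UNIV k" "\<And>x. norm x > R \<Longrightarrow> k x = 0" and f: "loc_int f"
  shows "integrable lborel (\<lambda>y. k (x - y) *\<^sub>R f y)"
proof -
  obtain B where B: "B > 0" "\<And>x. norm (k x) \<le> B" using compact_support_bounded[OF k] by blast
  have [measurable]: "k \<in> borel_measurable borel" "f \<in> borel_measurable borel"
    using k f by (auto intro: borel_measurable_continuous_onI simp: loc_int_def)
  show ?thesis
  proof (rule loc_int_bound[OF f, where B=B and R="norm x + R"])
    fix y show "norm (k (x - y) *\<^sub>R f y) \<le> B * (indicator (cball 0 (norm x + R)) y * norm (f y))"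
      using B norm_diff_gt[of y "norm x + R" x R] k(2)[of "x - y"]
      by (cases "norm y \<le> norm x + R") (auto intro: mult_right_mono)
  qed measurable
qed

lemma convolve_continuous:
  fixes k :: "real^'n \<Rightarrow> real"
  assumes k: "continuous_on UNIV k" "\<And>x. norm x > R \<Longrightarrow> k x = 0" and f: "loc_int f"
  shows "continuous_on UNIV (convolve k f)"
proof (rule continuous_on_iff[THEN iffD2], intro ballI allI impI)
  fix x :: "real^'n" and e assume e: "(0::real) < e"
  have [measurable]: "k \<in> borel_measurable borel" "f \<in> borel_measurable borel"
    using k f by (auto intro: borel_measurable_continuous_onI simp: loc_int_def)
  define S where "S = norm x + 1 + R"
  define V where "V = (LBINT y. indicator (cball 0 S) y * norm (f y))"
  have V: "V \<ge> 0" unfolding V_def by (rule Bochner_Integration.integral_nonneg) simp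
  have "uniformly_continuous_on UNIV k" by (rule compact_support_uniformly_continuous[OF k])
  moreover have "e / (V + 1) > 0" using V e by simp
  ultimately obtain d where d: "d > 0" "\<And>x y. dist y x < d \<Longrightarrow> dist (k y) (k x) < e / (V + 1)"
    unfolding uniformly_continuous_on_def by (metis UNIV_I)
  show "\<exists>d>0. \<forall>x'\<in>UNIV. dist x' x < d \<longrightarrow> dist (convolve k f x') (convolve k f x) < e"
  proof (intro exI[of _ "min d 1"] conjI ballI impI)
    fix x' :: "real^'n" assume x': "dist x' x < min d 1"
    then have nx': "norm x' \<le> norm x + 1" using norm_triangle_sub[of x' x] by (simp add: dist_norm)
    have "convolve k f x' - convolve k f x = (LBINT y. (k (x' - y) - k (x - y)) *\<^sub>R f y)"
      unfolding convolve_def scaleR_diff_left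
      by (intro Bochner_Integration.integral_diff[symmetric] convolve_integrable[OF k f])
    also have "norm \<dots> \<le> e / (V + 1) * V"
      unfolding V_def
    proof (rule loc_int_bound[OF f])
      fix y
      have "norm (k (x' - y) - k (x - y)) \<le> e / (V + 1)"
        using d(2)[of "x' - y" "x - y"] x' by (simp add: dist_norm)
      moreover have "k (x' - y) = 0 \<and> k (x - y) = 0" if "\<not> norm y \<le> S"
        using norm_diff_gt[OF that, of _ R] k(2) nx' by (simp add: S_def)
      ultimately show "norm ((k (x' - y) - k (x - y)) *\<^sub>R f y) \<le>
         e / ((LBINT y. indicator (cball 0 S) y * norm (f y)) + 1) * (indicator (cball 0 S) y * norm (f y))"
        unfolding V_def norm_scaleR by (cases "norm y \<le> S") (auto intro!: mult_right_mono simp del: times_divide_eq_left)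
    qed measurable
    also have "\<dots> < e" using e V by (simp add: field_simps)
    finally show "dist (convolve k f x') (convolve k f x) < e" by (simp add: dist_norm)
  qed (use d in auto)
qed

text \<open>The derivative falls on the kernel. The linearization error of k is uniformly small and
  is integrated against u over a fixed ball that contains all supports for x' within distance 1 of
  x.\<close>

lemma convolve_has_derivative:
  fixes u :: "real^'n \<Rightarrow> real"
  assumes k: "C1_grad k g" "\<And>x. norm x > R \<Longrightarrow> k x = 0" and u: "loc_int u"
  shows "(convolve k u has_derivative (\<lambda>h. (LBINT y. u y *\<^sub>R g (x - y)) \<bullet> h)) (at x)"
    and "integrable lborel (\<lambda>y. u y *\<^sub>R g (x - y))"
proof -
  note kc = C1_gradD(3)[OF k(1), where S=UNIV] and gc = C1_gradD(2)[OF k(1), where S=UNIV]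
  have g0: "g z = 0" if "norm z > R" for z using C1_grad_eq_0[of k g R z] k that by simp
  have [measurable]: "k \<in> borel_measurable borel" "u \<in> borel_measurable borel" "g \<in> borel_measurable borel"
    using kc gc u by (auto intro: borel_measurable_continuous_onI simp: loc_int_def)
  obtain B where B: "B > 0" "\<And>x. norm (g x) \<le> B"
    using compact_support_bounded[of g R, OF gc g0] by metis
  show gi: "integrable lborel (\<lambda>y. u y *\<^sub>R g (x - y))"
  proof (rule loc_int_bound[OF u, where B=B and R="norm x + R"])
    fix y show "norm (u y *\<^sub>R g (x - y)) \<le> B * (indicator (cball 0 (norm x + R)) y * norm (u y))"
    proof (cases "norm y \<le> norm x + R")
      case True
      then show ?thesis using mult_right_mono[OF B(2)[of "x - y"], of "\<bar>u y\<bar>"] by (simp add: mult.commute)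
    next
      case False
      then show ?thesis using norm_diff_gt[OF False, of x R] g0 by simp
    qed
  qed measurable
  have i1: "integrable lborel (\<lambda>y. k (z - y) *\<^sub>R u y)" for z by (rule convolve_integrable[OF kc k(2) u])
  have i2: "integrable lborel (\<lambda>y. (u y *\<^sub>R g (x - y)) \<bullet> v)" for v using gi by (rule integrable_inner_left)
  define S where "S = norm x + 1 + R"
  define V where "V = (LBINT y. indicator (cball 0 S) y * norm (u y))"
  have V: "V \<ge> 0" unfolding V_def by (rule Bochner_Integration.integral_nonneg) simp
  show "(convolve k u has_derivative (\<lambda>h. (LBINT y. u y *\<^sub>R g (x - y)) \<bullet> h)) (at x)"
    unfolding has_derivative_at_alt
  proof (intro conjI allI impI)
    fix e :: real assume e: "e > 0"
    then have "e / (V + 1) > 0" using V by simp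
    then obtain d where d: "d > 0" "\<And>z h. norm h < d \<Longrightarrow> \<bar>k (z + h) - k z - g z \<bullet> h\<bar> \<le> e / (V + 1) * norm h"
      using C1_uniformly_differentiable[OF k] by blast
    show "\<exists>d>0. \<forall>x'. norm (x' - x) < d \<longrightarrow> norm (convolve k u x' - convolve k u x - (LBINT y. u y *\<^sub>R g (x - y)) \<bullet> (x' - x)) \<le> e * norm (x' - x)"
    proof (intro exI[of _ "min d 1"] conjI allI impI)
      fix x' assume x': "norm (x' - x) < min d 1"
      then have nx': "norm x' \<le> norm x + 1" using norm_triangle_sub[of x' x] by simp
      have "convolve k u x' - convolve k u x - (LBINT y. u y *\<^sub>R g (x - y)) \<bullet> (x' - x)
        = (LBINT y. k (x' - y) *\<^sub>R u y - k (x - y) *\<^sub>R u y - (u y *\<^sub>R g (x - y)) \<bullet> (x' - x))"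
        unfolding convolve_def
        by (subst Bochner_Integration.integral_diff[OF Bochner_Integration.integrable_diff[OF i1 i1] i2],
          subst Bochner_Integration.integral_diff[OF i1 i1], subst integral_inner_left[OF gi]) simp
      also have "norm \<dots> \<le> (e / (V + 1) * norm (x' - x)) * V"
        unfolding V_def
      proof (rule loc_int_bound[OF u])
        fix y
        have eq: "norm (k (x' - y) *\<^sub>R u y - k (x - y) *\<^sub>R u y - (u y *\<^sub>R g (x - y)) \<bullet> (x' - x))
          = \<bar>k ((x - y) + (x' - x)) - k (x - y) - g (x - y) \<bullet> (x' - x)\<bar> * norm (u y)"
          unfolding real_norm_def abs_mult[symmetric] by (simp add: algebra_simps)
        have le: "\<bar>k ((x - y) + (x' - x)) - k (x - y) - g (x - y) \<bullet> (x' - x)\<bar> \<le> e / (V + 1) * norm (x' - x)"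
          using x' by (intro d) simp
        show "norm (k (x' - y) *\<^sub>R u y - k (x - y) *\<^sub>R u y - (u y *\<^sub>R g (x - y)) \<bullet> (x' - x)) \<le>
           e / ((LBINT y. indicator (cball 0 S) y * norm (u y)) + 1) * norm (x' - x) * (indicator (cball 0 S) y * norm (u y))"
        proof (cases "norm y \<le> S")
          case True
          then show ?thesis
            unfolding eq V_def[symmetric] using mult_right_mono[OF le, of "norm (u y)"] by simp
        next
          case False
          then have "k (x' - y) = 0 \<and> k (x - y) = 0 \<and> g (x - y) = 0"
            using norm_diff_gt[OF False, of _ R] k(2) g0 nx' by (simp add: S_def)
          with False show ?thesis by simp
        qed
      qed measurable
      also have "\<dots> \<le> e * norm (x' - x)"
        using e V by (simp add: field_simps)
      finally show "norm (convolve k u x' - convolve k u x - (LBINT y. u y *\<^sub>R g (x - y)) \<bullet> (x' - x)) \<le> e * norm (x' - x)" .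
    qed (use d in auto)
  qed (rule bounded_linear_inner_right)
qed

section \<open>Mollifiers\<close>

lemma test_fun_bump_self: "e > 0 \<Longrightarrow> test_fun (bump e)"
  using test_fun_bump[of e 1 0] by (simp add: bump_def[abs_def])

lemma bump_integral_pos:
  assumes "e > 0"
  shows "(LBINT x. bump e (x::real^'n)) > 0" "integrable lborel (bump e :: real^'n \<Rightarrow> real)"
proof -
  have c: "continuous_on UNIV (bump e :: real^'n \<Rightarrow> real)"
    using test_fun_C1[OF test_fun_bump_self[OF assms]] by (rule C1_gradD)
  show i: "integrable lborel (bump e :: real^'n \<Rightarrow> real)"
    by (rule integrable_compact_support[OF c, where R=e]) (simp add: bump_eq_0[OF assms])
  have nn: "bump e x \<ge> 0" for x :: "real^'n" by (simp add: bump_def exp_bump_nonneg)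
  have "(LBINT x. bump e (x::real^'n)) \<noteq> 0"
  proof
    assume "(LBINT x. bump e (x::real^'n)) = 0"
    then have "AE x::real^'n in lborel. bump e x = 0"
      using integral_nonneg_eq_0_iff_AE[OF i] nn by simp
    then have "AE x::real^'n in lborel. x \<notin> ball 0 e"
      by eventually_elim (use bump_pos in force)
    then have "emeasure lborel (ball (0::real^'n) e) = 0"
      by (subst (asm) AE_iff_measurable[OF _ refl]) (auto simp: ball_def)
    moreover have "emeasure lborel (ball (0::real^'n) e) > 0" using assms by (simp add: emeasure_ball)
    ultimately show False by simp
  qed
  moreover have "(LBINT x. bump e (x::real^'n)) \<ge> 0" using nn by (intro Bochner_Integration.integral_nonneg)
  ultimately show "(LBINT x. bump e (x::real^'n)) > 0" by linarith
qed

definition moll :: "real \<Rightarrow> real^'n \<Rightarrow> real" where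
  "moll e z = (1 / (LBINT x. bump e (x::real^'n))) * bump e z"

context
  fixes e :: real
  assumes e: "e > 0"
begin

lemma moll_nonneg: "moll e z \<ge> 0"
  using bump_integral_pos[OF e] by (simp add: moll_def bump_def exp_bump_nonneg)

lemma moll_eq_0: "norm z > e \<Longrightarrow> moll e z = 0"
  using bump_eq_0[OF e, of z] by (simp add: moll_def)

lemma moll_diff_commute: "moll e (x - y) = moll e (y - x)"
  by (simp add: moll_def bump_def norm_minus_commute)

lemma test_fun_moll_diff: "test_fun (\<lambda>y. moll e (x - y))"
  unfolding moll_def by (rule test_fun_bump[OF e])

lemma moll_C1: "C1_grad (moll e) (\<lambda>x. \<chi> i. partial i (moll e) x)"
  using test_fun_moll_diff[of 0, THEN test_fun_C1] unfolding moll_diff_commute[of 0] by simp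

lemma moll_continuous: "continuous_on S (moll e)"
  using moll_C1 by (rule C1_gradD)

lemma moll_measurable: "moll e \<in> borel_measurable borel"
  by (rule borel_measurable_continuous_onI[OF moll_continuous])

lemma moll_integral: "(LBINT y. moll e (x - y)) = 1" "integrable lborel (\<lambda>y. moll e (x - y))"
proof -
  have "integrable lborel (moll e :: real^'n \<Rightarrow> real)" "(LBINT y. moll e (y::real^'n)) = 1"
    unfolding moll_def using bump_integral_pos[OF e, where 'n='n] by auto
  then show "(LBINT y. moll e (x - y)) = 1" "integrable lborel (\<lambda>y. moll e (x - y))"
    using integral_lborel_reflect[OF moll_measurable, of x] by auto
qed

lemma moll_nn_integral: "(\<integral>\<^sup>+y. ennreal (moll e (x - y)) \<partial>lborel) = 1"
  by (subst nn_integral_eq_integral[OF moll_integral(2)]) (simp_all add: moll_integral(1) moll_nonneg)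

lemma mollify_integrable: "loc_int f \<Longrightarrow> integrable lborel (\<lambda>y. moll e (x - y) *\<^sub>R f y)"
  by (rule convolve_integrable[OF moll_continuous moll_eq_0])

lemma mollify_continuous: "loc_int f \<Longrightarrow> continuous_on UNIV (convolve (moll e) f)"
  by (rule convolve_continuous[OF moll_continuous moll_eq_0])

end

section \<open>Weak gradients\<close>

text \<open>Borel representatives are used throughout, so that Tonelli's theorem for \<open>lborel\<close> applies.\<close>

definition wgrad :: "(real^'n \<Rightarrow> real) \<Rightarrow> (real^'n \<Rightarrow> real^'n) \<Rightarrow> bool" where
  "wgrad u D \<longleftrightarrow> continuous_on UNIV u \<and> loc_int D \<and>
     (\<forall>\<phi> i. test_fun \<phi> \<longrightarrow>
       (LBINT x. u x * partial i \<phi> x) = - (LBINT x. D x $ i * \<phi> x))"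

lemma wgradD:
  assumes "wgrad u D"
  shows "continuous_on S u" "loc_int D" "u \<in> borel_measurable borel" "D \<in> borel_measurable borel" "loc_int u"
    and "test_fun \<phi> \<Longrightarrow> (LBINT x. u x * partial i \<phi> x) = - (LBINT x. D x $ i * \<phi> x)"
  using assms unfolding wgrad_def
  by (auto simp: loc_int_def[of D] intro: borel_measurable_continuous_onI loc_int_continuous continuous_on_subset)

text \<open>The derivative first lands on the mollifier. As a function of y,
  \<open>moll e (x - y)\<close> is a test function, so the defining identity of the weak gradient
  moves the derivative over to D; the sign from the inner x - y cancels the sign in that
  identity.\<close>

lemma mollify_C1:
  fixes u :: "real^'n \<Rightarrow> real"
  assumes u: "wgrad u D" and e: "e > 0"
  shows "C1_grad (convolve (moll e) u) (convolve (moll e) D)"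
proof -
  define g :: "real^'n \<Rightarrow> real^'n" where "g x = (\<chi> i. partial i (moll e) x)" for x
  have g: "C1_grad (moll e) g" using moll_C1[OF e] by (simp add: g_def[abs_def])
  note * = convolve_has_derivative[OF g moll_eq_0[OF e] wgradD(5)[OF u]]
  have "(LBINT y. u y *\<^sub>R g (x - y)) = convolve (moll e) D x" for x
  proof (subst vec_eq_iff, intro allI)
    fix i
    have P: "partial i (\<lambda>y. moll e (x - y)) y = - g (x - y) $ i" for y
    proof -
      have "((\<lambda>y. moll e (x - y)) has_derivative (\<lambda>h. (- g (x - y)) \<bullet> h)) (at y)"
      proof -
        have "((\<lambda>y. x - y) has_derivative (\<lambda>h. - h)) (at y)" by (auto intro!: derivative_eq_intros)
        from has_derivative_compose[OF this C1_gradD(1)[OF g]] show ?thesis by simp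
      qed
      from partial_eqI[OF this] show ?thesis by simp
    qed
    have "(LBINT y. u y *\<^sub>R g (x - y)) $ i = (LBINT y. (u y *\<^sub>R g (x - y)) $ i)"
      by (rule integral_bounded_linear[OF bounded_linear_vec_nth *(2), symmetric])
    also have "\<dots> = - (LBINT y. u y * partial i (\<lambda>y. moll e (x - y)) y)"
      unfolding P by simp
    also have "\<dots> = (LBINT y. D y $ i * moll e (x - y))"
      using wgradD(6)[OF u test_fun_moll_diff[OF e]] by simp
    also have "\<dots> = (LBINT y. (moll e (x - y) *\<^sub>R D y) $ i)"
      by (simp add: mult.commute)
    also have "\<dots> = convolve (moll e) D x $ i"
      unfolding convolve_def
      by (rule integral_bounded_linear[OF bounded_linear_vec_nth mollify_integrable[OF e wgradD(2)[OF u]]])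
    finally show "(LBINT y. u y *\<^sub>R g (x - y)) $ i = convolve (moll e) D x $ i" .
  qed
  then show ?thesis
    unfolding C1_grad_def using *(1) mollify_continuous[OF e wgradD(2)[OF u]] by simp
qed

section \<open>Limits and L^p bounds of mollifications\<close>

lemma mollify_uniform:
  fixes u :: "real^'n \<Rightarrow> real"
  assumes u: "continuous_on UNIV u" and "\<epsilon> > 0"
  shows "\<forall>\<^sub>F e in at_right 0. \<forall>x. norm x \<le> R \<longrightarrow> \<bar>convolve (moll e) u x - u x\<bar> \<le> \<epsilon>"
proof -
  have "uniformly_continuous_on (cball 0 (R+1)) u"
    by (intro compact_uniformly_continuous continuous_on_subset[OF u]) auto
  then obtain d where d: "d > 0" "\<And>x y. x \<in> cball 0 (R+1) \<Longrightarrow> y \<in> cball 0 (R+1) \<Longrightarrow> dist y x < d \<Longrightarrow> dist (u y) (u x) < \<epsilon>"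
    using \<open>\<epsilon> > 0\<close> unfolding uniformly_continuous_on_def by metis
  have *: "\<bar>convolve (moll e) u x - u x\<bar> \<le> \<epsilon>" if e: "e > 0" "e < min d 1" and x: "norm x \<le> R" for e x
  proof -
    note i = mollify_integrable[OF e(1) loc_int_continuous[OF u], of x]
    note i' = moll_integral(2)[OF e(1), of x]
    have eq: "convolve (moll e) u x - u x = (LBINT y. moll e (x - y) *\<^sub>R u y - moll e (x - y) * u x)"
      using Bochner_Integration.integral_diff[OF i integrable_mult_left[OF i', of "u x"]] moll_integral[OF e(1), of x]
      by (simp add: convolve_def)
    have "norm (LBINT y. moll e (x - y) *\<^sub>R u y - moll e (x - y) * u x) \<le> (LBINT y. moll e (x - y) * \<epsilon>)"
    proof (rule Bochner_Integration.integral_norm_bound_integral)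
      show "integrable lborel (\<lambda>y. moll e (x - y) *\<^sub>R u y - moll e (x - y) * u x)"
        by (intro Bochner_Integration.integrable_diff i integrable_mult_left i')
      show "integrable lborel (\<lambda>y. moll e (x - y) * \<epsilon>)" by (intro integrable_mult_left i')
      fix y
      have eq: "norm (moll e (x - y) *\<^sub>R u y - moll e (x - y) * u x) = moll e (x - y) * \<bar>u y - u x\<bar>"
        using moll_nonneg[OF e(1), of "x - y"] by (simp add: abs_mult flip: right_diff_distrib)
      show "norm (moll e (x - y) *\<^sub>R u y - moll e (x - y) * u x) \<le> moll e (x - y) * \<epsilon>"
      proof (cases "norm (x - y) > e")
        case True then show ?thesis using moll_eq_0[OF e(1) True] by simp
      next
        case False
        then have "norm y \<le> R + 1" "dist y x < d"
          using e x norm_triangle_sub[of y x] by (auto simp: dist_norm norm_minus_commute)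
        then have "\<bar>u y - u x\<bar> \<le> \<epsilon>" using d(2)[of x y] x by (simp add: dist_norm)
        then show ?thesis unfolding eq by (intro mult_left_mono moll_nonneg[OF e(1)])
      qed
    qed
    then show ?thesis using moll_integral[OF e(1), of x] unfolding eq by simp
  qed
  have "\<forall>\<^sub>F e in at_right 0. e < min d 1" "\<forall>\<^sub>F e in at_right (0::real). e > 0"
    using d eventually_at_right_less by (auto intro!: eventually_at_right_real[THEN eventually_mono] simp: eventually_at_right_field intro: exI[of _ "min d 1"])
  then show ?thesis by eventually_elim (use * in blast)
qed

lemma mollify_support:
  assumes "e > 0" "\<And>x. norm x > R \<Longrightarrow> k x = 0" "norm x > R + e"
  shows "convolve (moll e) k x = 0"
proof -
  have "moll e (x - y) *\<^sub>R k y = 0" for y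
  proof (cases "norm y \<le> R")
    case True
    then have "norm (x - y) > e" using assms(3) norm_triangle_sub[of x y] by simp
    then show ?thesis by (simp add: moll_eq_0[OF assms(1)])
  qed (use assms(2) in auto)
  then show ?thesis unfolding convolve_def by (simp del: scaleR_eq_0_iff)
qed

text \<open>Tangent line of the convex function t^p at a, obtained from Young's inequality for N and
  a^(p - 1) with exponents p and p / (p - 1). It is the common source of the Jensen, Hoelder and
  convexity estimates below.\<close>

lemma powr_tangent:
  assumes "p \<ge> 1" "a \<ge> 0" "N \<ge> (0::real)"
  shows "a powr p + p * a powr (p - 1) * (N - a) \<le> N powr p"
\<comment> \<open>For p = 1 there is no conjugate exponent; for a = 0 the left side is 0, also when
  p = 1, since \<open>0 powr 0 = 0\<close>.\<close>
proof (cases "a = 0 \<or> p = 1")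
  case True then show ?thesis using assms by (cases "a = 0") auto
next
  case False
  then have p: "p > 1" "a > 0" using assms by auto
  have "N * a powr (p - 1) \<le> N powr p / p + (a powr (p - 1)) powr (p / (p - 1)) / (p / (p - 1))"
    by (rule Youngs_inequality) (use p assms in \<open>auto simp: field_simps\<close>)
  also have "(a powr (p - 1)) powr (p / (p - 1)) = a powr p" using p by (simp add: powr_powr)
  finally have 1: "N * a powr (p - 1) \<le> N powr p / p + a powr p * (p - 1) / p" by simp
  have "p * (N * a powr (p - 1)) \<le> p * (N powr p / p + a powr p * (p - 1) / p)"
    by (intro mult_left_mono 1) (use p in auto)
  also have "\<dots> = N powr p + a powr p * (p - 1)" using p by (simp add: field_simps)
  finally have "p * (N * a powr (p - 1)) \<le> N powr p + a powr p * (p - 1)" .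
  moreover have "a powr (p - 1) * a = a powr p" using p by (simp add: powr_diff)
  ultimately show ?thesis by (simp add: algebra_simps)
qed

text \<open>Jensen's inequality for the probability density \<open>moll e (x - y)\<close>: integrate
  the tangent inequality taken at the mean a of the norm of D, whose linear term then integrates to
  0.\<close>

lemma mollify_powr:
  fixes D :: "real^'n \<Rightarrow> 'b::{banach, second_countable_topology}"
  assumes e: "e > 0" and p: "p \<ge> 1" and D: "loc_int D" "loc_int (\<lambda>y. norm (D y) powr p)"
  shows "norm (convolve (moll e) D x) powr p \<le> (LBINT y. moll e (x - y) * norm (D y) powr p)"
proof -
  define a where "a = (LBINT y. moll e (x - y) * norm (D y))"
  have i: "integrable lborel (\<lambda>y. moll e (x - y) * norm (D y))"
    using integrable_norm[OF mollify_integrable[OF e D(1), of x]] by (simp add: moll_nonneg[OF e])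
  have i2: "integrable lborel (\<lambda>y. moll e (x - y) * norm (D y) powr p)"
    using mollify_integrable[OF e D(2), of x] by simp
  note i' = moll_integral(2)[OF e, of x]
  have a: "a \<ge> 0" unfolding a_def by (intro Bochner_Integration.integral_nonneg mult_nonneg_nonneg moll_nonneg[OF e]) auto
  have "norm (convolve (moll e) D x) \<le> (LBINT y. norm (moll e (x - y) *\<^sub>R D y))"
    unfolding convolve_def by (rule integral_norm_bound)
  also have "\<dots> = a" unfolding a_def by (simp add: moll_nonneg[OF e])
  finally have "norm (convolve (moll e) D x) powr p \<le> a powr p" using p by (intro powr_mono2) auto
  also have "\<dots> = a powr p * (LBINT y. moll e (x - y))
      + p * a powr (p - 1) * ((LBINT y. moll e (x - y) * norm (D y)) - (LBINT y. moll e (x - y)) * a)"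
    by (simp add: moll_integral(1)[OF e] flip: a_def)
  also have "\<dots> = (LBINT y. moll e (x - y) * a powr p + p * a powr (p - 1) * (moll e (x - y) * norm (D y) - moll e (x - y) * a))"
    using i i' by simp
  also have "\<dots> \<le> (LBINT y. moll e (x - y) * norm (D y) powr p)"
  proof (rule Bochner_Integration.integral_mono)
    fix y
    show "moll e (x - y) * a powr p + p * a powr (p - 1) * (moll e (x - y) * norm (D y) - moll e (x - y) * a)
      \<le> moll e (x - y) * norm (D y) powr p"
      using mult_left_mono[OF powr_tangent[OF p a, of "norm (D y)"] moll_nonneg[OF e, of "x - y"]]
      by (simp add: algebra_simps)
  qed (use i i' i2 in auto)
  finally show ?thesis .
qed

text \<open>Jensen pointwise, then Tonelli and total mass 1 of the mollifier. The ball grows by e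
  because the mollifier reaches that far.\<close>

lemma mollify_Lp_ball:
  fixes D :: "real^'n \<Rightarrow> 'b::{banach, second_countable_topology}"
  assumes e: "e > 0" and p: "p \<ge> 1" and D: "loc_int D" "loc_int (\<lambda>y. norm (D y) powr p)"
  shows "(\<integral>\<^sup>+x. ennreal (norm (convolve (moll e) D x) powr p) * indicator (cball z r) x \<partial>lborel)
    \<le> (\<integral>\<^sup>+x. ennreal (norm (D x) powr p) * indicator (cball z (r + e)) x \<partial>lborel)"
proof -
  have [measurable]: "D \<in> borel_measurable borel" using D by (simp add: loc_int_def)
  have [measurable]: "(moll e :: real^'n \<Rightarrow> real) \<in> borel_measurable borel" by (rule moll_measurable[OF e])
  have [measurable]: "Measurable.pred borel (\<lambda>y. y \<in> cball z (r + e))" by (simp add: pred_def)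
  have "(\<integral>\<^sup>+x. ennreal (norm (convolve (moll e) D x) powr p) * indicator (cball z r) x \<partial>lborel)
    \<le> (\<integral>\<^sup>+x. (\<integral>\<^sup>+y. ennreal (moll e (x - y)) * ennreal (norm (D y) powr p) * indicator (cball z (r + e)) y \<partial>lborel) \<partial>lborel)"
  proof (rule nn_integral_mono)
    fix x
    show "ennreal (norm (convolve (moll e) D x) powr p) * indicator (cball z r) x
      \<le> (\<integral>\<^sup>+y. ennreal (moll e (x - y)) * ennreal (norm (D y) powr p) * indicator (cball z (r + e)) y \<partial>lborel)"
    proof (cases "x \<in> cball z r")
      case True
      have i: "integrable lborel (\<lambda>y. moll e (x - y) * norm (D y) powr p)"
        using mollify_integrable[OF e D(2), of x] by simp
      have "ennreal (norm (convolve (moll e) D x) powr p) \<le> ennreal (LBINT y. moll e (x - y) * norm (D y) powr p)"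
        by (intro ennreal_leI mollify_powr[OF e p D])
      also have "\<dots> = (\<integral>\<^sup>+y. ennreal (moll e (x - y) * norm (D y) powr p) \<partial>lborel)"
        by (rule nn_integral_eq_integral[OF i, symmetric]) (simp add: moll_nonneg[OF e])
      also have "\<dots> = (\<integral>\<^sup>+y. ennreal (moll e (x - y)) * ennreal (norm (D y) powr p) * indicator (cball z (r + e)) y \<partial>lborel)"
      proof (rule nn_integral_cong)
        fix y
        have "moll e (x - y) = 0" if "y \<notin> cball z (r + e)"
        proof (rule moll_eq_0[OF e])
          have "dist z y \<le> dist z x + dist x y" by (rule dist_triangle)
          then show "norm (x - y) > e" using that True by (simp add: dist_norm)
        qed
        then show "ennreal (moll e (x - y) * norm (D y) powr p) = ennreal (moll e (x - y)) * ennreal (norm (D y) powr p) * indicator (cball z (r + e)) y"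
          by (auto simp: indicator_def ennreal_mult moll_nonneg[OF e])
      qed
      finally show ?thesis using True by simp
    qed simp
  qed
  also have "\<dots> = (\<integral>\<^sup>+y. (\<integral>\<^sup>+x. ennreal (moll e (x - y)) * ennreal (norm (D y) powr p) * indicator (cball z (r + e)) y \<partial>lborel) \<partial>lborel)"
  proof (rule lborel_pair.Fubini'[symmetric])
    have "(\<lambda>x. ennreal (moll e (fst x - snd x)) * ennreal (norm (D (snd x)) powr p) * indicator (cball z (r + e)) (snd x))
      \<in> borel_measurable (borel \<Otimes>\<^sub>M borel)"
      by measurable
    then show "(\<lambda>(x, y). ennreal (moll e (x - y)) * ennreal (norm (D y) powr p) * indicator (cball z (r + e)) y)
      \<in> borel_measurable (lborel \<Otimes>\<^sub>M lborel)"
      by (simp add: case_prod_beta cong: measurable_cong_sets)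
  qed
  also have "\<dots> = (\<integral>\<^sup>+y. ennreal (norm (D y) powr p) * indicator (cball z (r + e)) y \<partial>lborel)"
  proof (rule nn_integral_cong)
    fix y
    have "(\<integral>\<^sup>+x. ennreal (moll e (x - y)) * (ennreal (norm (D y) powr p) * indicator (cball z (r + e)) y) \<partial>lborel)
      = (\<integral>\<^sup>+x. ennreal (moll e (x - y)) \<partial>lborel) * (ennreal (norm (D y) powr p) * indicator (cball z (r + e)) y)"
      by (rule nn_integral_multc) measurable
    also have "(\<integral>\<^sup>+x. ennreal (moll e (x - y)) \<partial>lborel) = 1"
      using moll_nn_integral[OF e, of y] by (simp add: moll_diff_commute[OF e])
    finally show "(\<integral>\<^sup>+x. ennreal (moll e (x - y)) * ennreal (norm (D y) powr p) * indicator (cball z (r + e)) y \<partial>lborel)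
       = ennreal (norm (D y) powr p) * indicator (cball z (r + e)) y" by (simp add: mult.assoc)
  qed
  finally show ?thesis .
qed

lemma loc_int_normI: "loc_int f \<Longrightarrow> loc_int (\<lambda>x. norm (f x))"
  using loc_int_norm[of f] by (auto simp: loc_int_def)

text \<open>The case p = 1 of \<open>mollify_Lp_ball\<close>; it bounds the mollifications in L^1 on
  balls uniformly in e.\<close>

lemma mollify_L1:
  fixes h :: "real^'n \<Rightarrow> real"
  assumes e: "e > 0" and h: "loc_int h"
  shows "(LBINT x. indicator (cball 0 R) x * norm (convolve (moll e) h x))
    \<le> (LBINT x. indicator (cball 0 (R + e)) x * norm (h x))"
proof -
  have h': "loc_int (\<lambda>y. norm (h y) powr 1)" using loc_int_normI[OF h] by simp
  have eq: "(\<integral>\<^sup>+x. ennreal (norm (f x) powr 1) * indicator (cball 0 S) x \<partial>lborel)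
      = ennreal (LBINT x. indicator (cball 0 S) x * norm (f x))"
    if "loc_int f" for f :: "real^'n \<Rightarrow> real" and S
  proof -
    have "(\<integral>\<^sup>+x. ennreal (norm (f x) powr 1) * indicator (cball 0 S) x \<partial>lborel)
      = (\<integral>\<^sup>+x. ennreal (indicator (cball 0 S) x * norm (f x)) \<partial>lborel)"
      by (intro nn_integral_cong) (auto simp: indicator_def)
    also have "\<dots> = ennreal (LBINT x. indicator (cball 0 S) x * norm (f x))"
      by (rule nn_integral_eq_integral[OF loc_int_norm[OF that]]) simp
    finally show ?thesis .
  qed
  have c: "loc_int (convolve (moll e) h)" by (rule loc_int_continuous[OF mollify_continuous[OF e h]])
  have "ennreal (LBINT x. indicator (cball 0 R) x * norm (convolve (moll e) h x))
    \<le> ennreal (LBINT x. indicator (cball 0 (R + e)) x * norm (h x))"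
    using mollify_Lp_ball[OF e _ h h', of 0 R] unfolding eq[OF c] eq[OF h] by simp
  moreover have "0 \<le> (LBINT x. indicator (cball 0 (R + e)) x * norm (h x))"
    by (rule Bochner_Integration.integral_nonneg) simp
  ultimately show ?thesis by simp
qed

text \<open>Fubini and the symmetry of the mollifier. The point is to move the mollification from h,
  which is only locally integrable, to the continuous \<psi>, where it converges uniformly.\<close>

lemma mollify_adjoint:
  fixes h \<psi> :: "real^'n \<Rightarrow> real"
  assumes e: "e > 0" and h: "loc_int h" and c: "continuous_on UNIV \<psi>" "\<And>x. norm x > R \<Longrightarrow> \<psi> x = 0"
  shows "(LBINT x. \<psi> x * convolve (moll e) h x) = (LBINT y. convolve (moll e) \<psi> y * h y)"
proof -
  have [measurable]: "h \<in> borel_measurable borel" "\<psi> \<in> borel_measurable borel"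
    using h c by (auto simp: loc_int_def intro: borel_measurable_continuous_onI)
  have [measurable]: "(moll e :: real^'n \<Rightarrow> real) \<in> borel_measurable borel" by (rule moll_measurable[OF e])
  let ?f = "\<lambda>x y. \<psi> x * (moll e (x - y) * h y)"
  have "integrable (lborel \<Otimes>\<^sub>M lborel) (\<lambda>z. ?f (fst z) (snd z))"
  proof (rule lborel_pair.Fubini_integrable)
    have "(\<lambda>z. ?f (fst z) (snd z)) \<in> borel_measurable (borel \<Otimes>\<^sub>M borel)" by measurable
    then show "(\<lambda>z. ?f (fst z) (snd z)) \<in> borel_measurable (lborel \<Otimes>\<^sub>M lborel)"
      by (simp cong: measurable_cong_sets)
    have "(\<lambda>x. \<integral>y. norm (?f (fst (x, y)) (snd (x, y))) \<partial>lborel) = (\<lambda>x. \<bar>\<psi> x\<bar> * convolve (moll e) (\<lambda>y. norm (h y)) x)"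
      by (simp add: convolve_def abs_mult moll_nonneg[OF e])
    moreover have "integrable lborel (\<lambda>x. \<bar>\<psi> x\<bar> * convolve (moll e) (\<lambda>y. norm (h y)) x)"
      by (rule integrable_compact_support[where R=R])
        (use c mollify_continuous[OF e loc_int_normI[OF h]] in \<open>auto intro!: continuous_intros\<close>)
    ultimately show "integrable lborel (\<lambda>x. \<integral>y. norm (?f (fst (x, y)) (snd (x, y))) \<partial>lborel)" by simp
    show "AE x in lborel. integrable lborel (\<lambda>y. ?f (fst (x, y)) (snd (x, y)))"
      using mollify_integrable[OF e h] by (intro AE_I2) simp
  qed
  then have "(LBINT y. (LBINT x. ?f x y)) = (LBINT x. (LBINT y. ?f x y))"
    by (intro lborel_pair.Fubini_integral) (simp add: case_prod_unfold)
  moreover have "(LBINT y. ?f x y) = \<psi> x * convolve (moll e) h x" for x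
    by (simp add: convolve_def)
  moreover have "(LBINT x. ?f x y) = convolve (moll e) \<psi> y * h y" for y
  proof -
    have "(LBINT x. ?f x y) = (LBINT x. (moll e (y - x) * \<psi> x) * h y)"
      by (rule Bochner_Integration.integral_cong) (auto simp: moll_diff_commute[OF e, of y])
    then show ?thesis by (simp add: convolve_def)
  qed
  ultimately show ?thesis by (simp only:)
qed

lemma eventually_at_right_0_less: "d > 0 \<Longrightarrow> \<forall>\<^sub>F e in at_right (0::real). 0 < e \<and> e < d"
  by (auto simp: eventually_at_right_field intro: exI[of _ d])

text \<open>After \<open>mollify_adjoint\<close> the error is at most the uniform distance of \<psi>
  from its mollification times the L^1 norm of h on the ball of radius R + 1, which contains both
  supports for e < 1.\<close>

lemma mollify_weak_limit:
  fixes h \<psi> :: "real^'n \<Rightarrow> real"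
  assumes h: "loc_int h" and c: "continuous_on UNIV \<psi>" "\<And>x. norm x > R \<Longrightarrow> \<psi> x = 0"
  shows "((\<lambda>e. \<integral>x. \<psi> x * convolve (moll e) h x \<partial>lborel) \<longlongrightarrow> (LBINT x. \<psi> x * h x)) (at_right 0)"
proof (rule tendstoI)
  fix \<epsilon> :: real assume "\<epsilon> > 0"
  have [measurable]: "h \<in> borel_measurable borel" "\<psi> \<in> borel_measurable borel"
    using h c by (auto simp: loc_int_def intro: borel_measurable_continuous_onI)
  define H where "H = (LBINT x. indicator (cball 0 (R+1)) x * norm (h x))"
  have H: "H \<ge> 0" unfolding H_def by (rule Bochner_Integration.integral_nonneg) simp
  define d where "d = \<epsilon> / (H + 1)"
  have d: "d > 0" using H \<open>\<epsilon> > 0\<close> by (simp add: d_def)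
  have ev: "\<forall>\<^sub>F e in at_right 0. \<forall>x. norm x \<le> R + 1 \<longrightarrow> \<bar>convolve (moll e) \<psi> x - \<psi> x\<bar> \<le> d"
    by (rule mollify_uniform[OF c(1) d])
  have ev2: "\<forall>\<^sub>F e in at_right (0::real). 0 < e \<and> e < 1" by (rule eventually_at_right_0_less) simp
  show "\<forall>\<^sub>F e in at_right 0. dist (LBINT x. \<psi> x * convolve (moll e) h x) (LBINT x. \<psi> x * h x) < \<epsilon>"
    using ev ev2
  proof eventually_elim
    case (elim e)
    have e: "e > 0" using elim by simp
    have cc: "continuous_on UNIV (convolve (moll e) \<psi>)" by (rule mollify_continuous[OF e loc_int_continuous[OF c(1)]])
    have [measurable]: "convolve (moll e) \<psi> \<in> borel_measurable borel" by (rule borel_measurable_continuous_onI[OF cc])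
    have z: "convolve (moll e) \<psi> x = 0 \<and> \<psi> x = 0" if "\<not> norm x \<le> R + 1" for x
      using mollify_support[of e R \<psi> x] c(2) that elim by auto
    have i1: "integrable lborel (\<lambda>x. convolve (moll e) \<psi> x * h x)"
    proof -
      obtain B where B: "B > 0" "\<And>x. norm (convolve (moll e) \<psi> x) \<le> B"
        using compact_support_bounded[of "convolve (moll e) \<psi>" "R+1", OF cc] z by (metis not_le)
      show ?thesis
      proof (rule loc_int_bound[OF h, where B=B and R="R+1"])
        fix x show "norm (convolve (moll e) \<psi> x * h x) \<le> B * (indicator (cball 0 (R + 1)) x * norm (h x))"
          using z[of x] mult_right_mono[OF B(2)[of x], of "norm (h x)"]
          by (cases "norm x \<le> R + 1") (auto simp: abs_mult)
      qed measurable
    qed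
    have i2: "integrable lborel (\<lambda>x. \<psi> x * h x)"
    proof -
      obtain B where B: "B > 0" "\<And>x. norm (\<psi> x) \<le> B"
        using compact_support_bounded[of \<psi> R, OF c] by metis
      show ?thesis
      proof (rule loc_int_bound[OF h, where B=B and R="R+1"])
        fix x show "norm (\<psi> x * h x) \<le> B * (indicator (cball 0 (R + 1)) x * norm (h x))"
          using z[of x] mult_right_mono[OF B(2)[of x], of "norm (h x)"]
          by (cases "norm x \<le> R + 1") (auto simp: abs_mult)
      qed measurable
    qed
    have "(LBINT x. \<psi> x * convolve (moll e) h x) - (LBINT x. \<psi> x * h x)
      = (LBINT x. convolve (moll e) \<psi> x * h x - \<psi> x * h x)"
      using Bochner_Integration.integral_diff[OF i1 i2] mollify_adjoint[of e h \<psi> R] e h c by simp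
    also have "norm \<dots> \<le> d * H"
      unfolding H_def
    proof (rule loc_int_bound[OF h])
      fix x
      have eq: "norm (convolve (moll e) \<psi> x * h x - \<psi> x * h x) = \<bar>convolve (moll e) \<psi> x - \<psi> x\<bar> * norm (h x)"
        by (simp add: left_diff_distrib[symmetric] abs_mult)
      show "norm (convolve (moll e) \<psi> x * h x - \<psi> x * h x) \<le> d * (indicator (cball 0 (R + 1)) x * norm (h x))"
      proof (cases "norm x \<le> R + 1")
        case True
        then have "\<bar>convolve (moll e) \<psi> x - \<psi> x\<bar> \<le> d" using elim by simp
        from mult_right_mono[OF this, of "norm (h x)"] show ?thesis unfolding eq using True by simp
      qed (use z in auto)
    qed measurable
    also have "d * H < \<epsilon>" using H \<open>\<epsilon> > 0\<close> by (simp add: d_def field_simps)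
    finally show ?case by (simp add: dist_norm)
  qed
qed

lemma mollify_uniform_comp:
  fixes u :: "real^'n \<Rightarrow> real" and F :: "real \<Rightarrow> real"
  assumes u: "continuous_on UNIV u" and F: "continuous_on UNIV F" and "\<epsilon> > 0"
  shows "\<forall>\<^sub>F e in at_right 0. \<forall>x. norm x \<le> R \<longrightarrow> \<bar>F (convolve (moll e) u x) - F (u x)\<bar> \<le> \<epsilon>"
proof -
  have "compact (u ` cball 0 R)" by (intro compact_continuous_image continuous_on_subset[OF u]) auto
  then obtain M where M: "\<And>x. norm x \<le> R \<Longrightarrow> \<bar>u x\<bar> \<le> M"
    using compact_imp_bounded bounded_iff by (metis imageI mem_cball_0 real_norm_def)
  have "uniformly_continuous_on (cball 0 (M+1)) F"
    by (intro compact_uniformly_continuous continuous_on_subset[OF F]) auto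
  then obtain d where d: "d > 0" "\<And>s t. s \<in> cball 0 (M+1) \<Longrightarrow> t \<in> cball 0 (M+1) \<Longrightarrow> dist t s < d \<Longrightarrow> dist (F t) (F s) < \<epsilon>"
    using \<open>\<epsilon> > 0\<close> unfolding uniformly_continuous_on_def by metis
  have "min (d/2) 1 > 0" using d by simp
  from mollify_uniform[OF u this, of R] show ?thesis
  proof eventually_elim
    case (elim e)
    show ?case
    proof (intro allI impI)
      fix x :: "real^'n" assume x: "norm x \<le> R"
      have "\<bar>convolve (moll e) u x - u x\<bar> \<le> min (d/2) 1" using elim x by blast
      then have "dist (F (convolve (moll e) u x)) (F (u x)) < \<epsilon>"
        using M[OF x] d by (intro d(2)) (auto simp: dist_norm)
      then show "\<bar>F (convolve (moll e) u x) - F (u x)\<bar> \<le> \<epsilon>" by (simp add: dist_norm)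
    qed
  qed
qed

text \<open>Two factors depend on e. Replacing F of the mollified u by F (u x) costs a uniformly
  small factor times an L^1 norm that \<open>mollify_L1\<close> controls; the remaining limit is
  \<open>mollify_weak_limit\<close>.\<close>

lemma mollify_product_limit:
  fixes u h k :: "real^'n \<Rightarrow> real" and F :: "real \<Rightarrow> real"
  assumes u: "continuous_on UNIV u" and F: "continuous_on UNIV F" and h: "loc_int h"
    and k: "continuous_on UNIV k" "\<And>x. norm x > R \<Longrightarrow> k x = 0"
  shows "((\<lambda>e. \<integral>x. k x * F (convolve (moll e) u x) * convolve (moll e) h x \<partial>lborel)
    \<longlongrightarrow> (LBINT x. k x * F (u x) * h x)) (at_right 0)"
proof -
  obtain B where B: "B > 0" "\<And>x. norm (k x) \<le> B" using compact_support_bounded[of k R, OF k] by metis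
  define H where "H = (LBINT x. indicator (cball 0 (R+1)) x * norm (h x))"
  have H: "H \<ge> 0" unfolding H_def by (rule Bochner_Integration.integral_nonneg) simp
  have kF: "continuous_on UNIV (\<lambda>x. k x * F (u x))"
    by (intro continuous_intros k continuous_on_compose2[OF F u]) auto
  have 1: "((\<lambda>e. \<integral>x. (k x * F (u x)) * convolve (moll e) h x \<partial>lborel) \<longlongrightarrow> (LBINT x. (k x * F (u x)) * h x)) (at_right 0)"
    by (rule mollify_weak_limit[OF h kF, of R]) (simp add: k)
  have 2: "((\<lambda>e. (LBINT x. k x * F (convolve (moll e) u x) * convolve (moll e) h x)
      - (LBINT x. (k x * F (u x)) * convolve (moll e) h x)) \<longlongrightarrow> 0) (at_right 0)"
  proof (rule tendstoI)
    fix \<epsilon> :: real assume "\<epsilon> > 0"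
    define d where "d = \<epsilon> / (B * (H + 1))"
    have d: "d > 0" using H B \<open>\<epsilon> > 0\<close> by (simp add: d_def)
    have ev2: "\<forall>\<^sub>F e in at_right (0::real). 0 < e \<and> e < 1" by (rule eventually_at_right_0_less) simp
    from mollify_uniform_comp[OF u F d, of R] ev2
    show "\<forall>\<^sub>F e in at_right 0. dist ((LBINT x. k x * F (convolve (moll e) u x) * convolve (moll e) h x)
      - (LBINT x. (k x * F (u x)) * convolve (moll e) h x)) 0 < \<epsilon>"
    proof eventually_elim
      case (elim e)
      have e: "e > 0" using elim by simp
      have cu: "continuous_on UNIV (convolve (moll e) u)" by (rule mollify_continuous[OF e loc_int_continuous[OF u]])
      have ch: "continuous_on UNIV (convolve (moll e) h)" by (rule mollify_continuous[OF e h])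
      have lh: "loc_int (convolve (moll e) h)" by (rule loc_int_continuous[OF ch])
      have kF': "continuous_on UNIV (\<lambda>x. k x * F (convolve (moll e) u x))"
        by (intro continuous_intros k continuous_on_compose2[OF F cu]) auto
      have i1: "integrable lborel (\<lambda>x. k x * F (convolve (moll e) u x) * convolve (moll e) h x)"
        by (rule integrable_compact_support[where R=R]) (auto intro!: continuous_on_mult kF' ch simp: k)
      have i2: "integrable lborel (\<lambda>x. (k x * F (u x)) * convolve (moll e) h x)"
        by (rule integrable_compact_support[where R=R]) (auto intro!: continuous_on_mult kF ch simp: k)
      have "(LBINT x. k x * F (convolve (moll e) u x) * convolve (moll e) h x)
        - (LBINT x. (k x * F (u x)) * convolve (moll e) h x)
        = (LBINT x. k x * F (convolve (moll e) u x) * convolve (moll e) h x - (k x * F (u x)) * convolve (moll e) h x)"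
        by (rule Bochner_Integration.integral_diff[OF i1 i2, symmetric])
      also have "norm \<dots> \<le> (B * d) * (LBINT x. indicator (cball 0 R) x * norm (convolve (moll e) h x))"
      proof (rule loc_int_bound[OF lh])
        show "(\<lambda>x. k x * F (convolve (moll e) u x) * convolve (moll e) h x - (k x * F (u x)) * convolve (moll e) h x) \<in> borel_measurable borel"
          by (intro borel_measurable_continuous_onI continuous_on_diff continuous_on_mult[OF kF' ch] continuous_on_mult[OF kF ch])
        fix x
        have eq: "norm (k x * F (convolve (moll e) u x) * convolve (moll e) h x - (k x * F (u x)) * convolve (moll e) h x)
          = (\<bar>k x\<bar> * \<bar>F (convolve (moll e) u x) - F (u x)\<bar>) * norm (convolve (moll e) h x)"
          unfolding real_norm_def abs_mult[symmetric] by (simp add: algebra_simps)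
        show "norm (k x * F (convolve (moll e) u x) * convolve (moll e) h x - (k x * F (u x)) * convolve (moll e) h x)
          \<le> (B * d) * (indicator (cball 0 R) x * norm (convolve (moll e) h x))"
        proof (cases "norm x \<le> R")
          case True
          then have "\<bar>F (convolve (moll e) u x) - F (u x)\<bar> \<le> d" using elim by blast
          then have "\<bar>k x\<bar> * \<bar>F (convolve (moll e) u x) - F (u x)\<bar> \<le> B * d"
            using B(2)[of x] B(1) by (intro mult_mono) auto
          from mult_right_mono[OF this, of "norm (convolve (moll e) h x)"] show ?thesis unfolding eq using True by simp
        qed (simp add: k)
      qed
      also have "\<dots> \<le> (B * d) * H"
      proof (rule mult_left_mono)
        have "(LBINT x. indicator (cball 0 R) x * norm (convolve (moll e) h x))
          \<le> (LBINT x. indicator (cball 0 (R + e)) x * norm (h x))" by (rule mollify_L1[OF e h])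
        also have "\<dots> \<le> H"
          unfolding H_def using elim
          by (intro Bochner_Integration.integral_mono loc_int_norm[OF h] mult_right_mono) (auto simp: indicator_def)
        finally show "(LBINT x. indicator (cball 0 R) x * norm (convolve (moll e) h x)) \<le> H" .
      qed (use B d in auto)
      also have "\<dots> = \<epsilon> * (H / (H + 1))" using B by (simp add: d_def)
      also have "\<dots> < \<epsilon>" using H \<open>\<epsilon> > 0\<close> by (simp add: field_simps)
      finally show ?case by (simp add: dist_norm)
    qed
  qed
  from tendsto_add[OF 2 1] show ?thesis by simp
qed

section \<open>Product and chain rule for weak gradients\<close>

lemma mollify_const: "e > 0 \<Longrightarrow> convolve (moll e) (\<lambda>_. 1::real) x = 1"
  by (simp add: convolve_def moll_integral(1))

lemma loc_int_component: "loc_int D \<Longrightarrow> loc_int (\<lambda>x. D x $ i)"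
  unfolding loc_int_def
  using integrable_bounded_linear[OF bounded_linear_vec_nth, of lborel "\<lambda>x. indicator (cball 0 R) x *\<^sub>R D x" for R]
  by (auto simp: bounded_linear_vec_nth[THEN bounded_linear.continuous_on]
    intro!: borel_measurable_continuous_on[of "\<lambda>v. v $ i"] continuous_intros)

lemma convolve_component:
  assumes "e > 0" "loc_int D"
  shows "convolve (moll e) D x $ i = convolve (moll e) (\<lambda>y. D y $ i) x"
  using integral_bounded_linear[OF bounded_linear_vec_nth mollify_integrable[OF assms], of x i]
  by (simp add: convolve_def)

text \<open>For mollified u the field \<open>G\<close> is the classical gradient of \<phi> \<zeta>
  F(u), which has compact support, so it integrates to 0; letting e tend to 0 gives the weak
  identity. One lemma serves two ends: \<zeta> = 1 is the chain rule, a cutoff \<zeta> localizes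
  competitors.\<close>

lemma wgrad_prod_comp:
  fixes u :: "real^'n \<Rightarrow> real"
  assumes u: "wgrad u D" and Z: "C1_grad \<zeta> Z"
    and F: "\<And>s. (F has_real_derivative F' s) (at s)" "continuous_on UNIV F'"
  shows "wgrad (\<lambda>x. \<zeta> x * F (u x)) (\<lambda>x. F (u x) *\<^sub>R Z x + (\<zeta> x * F' (u x)) *\<^sub>R D x)"
proof -
  have Fc: "continuous_on UNIV F" using F(1) by (meson DERIV_isCont continuous_at_imp_continuous_on)
  note uc = wgradD(1)[OF u, where S=UNIV] and Dl = wgradD(2)[OF u]
  note Zc = C1_gradD(2)[OF Z, where S=UNIV] and zc = C1_gradD(3)[OF Z, where S=UNIV]
  note [continuous_intros] = continuous_on_compose2[OF Fc uc] continuous_on_compose2[OF F(2) uc]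
  have c1: "continuous_on UNIV (\<lambda>x. F (u x) *\<^sub>R Z x)" by (intro continuous_intros Zc) auto
  have c2: "continuous_on UNIV (\<lambda>x. \<zeta> x * F' (u x))" by (intro continuous_intros zc) auto
  have [measurable]: "D \<in> borel_measurable borel" "(\<lambda>x. \<zeta> x * F' (u x)) \<in> borel_measurable borel"
    using Dl c2 by (auto simp: loc_int_def intro: borel_measurable_continuous_onI)
  have m: "(\<lambda>x. (\<zeta> x * F' (u x)) *\<^sub>R D x) \<in> borel_measurable borel"
    by (rule borel_measurable_scaleR) fact+
  have "loc_int (\<lambda>x. (\<zeta> x * F' (u x)) *\<^sub>R D x)"
    unfolding loc_int_def
  proof (intro conjI allI)
    fix R
    have "compact ((\<lambda>x. \<zeta> x * F' (u x)) ` cball 0 R)"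
      by (intro compact_continuous_image continuous_on_subset[OF c2]) auto
    then have "bounded ((\<lambda>x. \<zeta> x * F' (u x)) ` cball 0 R)" by (rule compact_imp_bounded)
    then obtain M where "\<forall>y\<in>(\<lambda>x. \<zeta> x * F' (u x)) ` cball 0 R. norm y \<le> M" unfolding bounded_iff by metis
    then have M: "\<bar>\<zeta> x * F' (u x)\<bar> \<le> M" if "norm x \<le> R" for x using that by force
    show "integrable lborel (\<lambda>x. indicator (cball 0 R) x *\<^sub>R (\<zeta> x * F' (u x)) *\<^sub>R D x)"
    proof (rule loc_int_bound[OF Dl, where B=M and R=R])
      fix x show "norm (indicator (cball 0 R) x *\<^sub>R (\<zeta> x * F' (u x)) *\<^sub>R D x) \<le> M * (indicator (cball 0 R) x * norm (D x))"
        using mult_right_mono[OF M, of x "norm (D x)"] by (cases "norm x \<le> R") auto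
    qed (intro borel_measurable_scaleR borel_measurable_indicator m; simp)
  qed (rule m)
  then have l: "loc_int (\<lambda>x. F (u x) *\<^sub>R Z x + (\<zeta> x * F' (u x)) *\<^sub>R D x)"
    using loc_int_continuous[OF c1] by (auto simp: loc_int_def scaleR_add_right)
  have w: "(LBINT x. \<zeta> x * F (u x) * partial i \<phi> x)
     = - (LBINT x. (F (u x) *\<^sub>R Z x + (\<zeta> x * F' (u x)) *\<^sub>R D x) $ i * \<phi> x)" if \<phi>: "test_fun \<phi>" for \<phi> i
  proof -
    define P where "P x = (\<chi> i. partial i \<phi> x)" for x
    have P: "C1_grad \<phi> P" using test_fun_C1[OF \<phi>] by (simp add: P_def[abs_def])
    obtain R where R: "R > 0" "\<And>x. norm x > R \<Longrightarrow> \<phi> x = 0" using test_fun_support[OF \<phi>] by metis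
    have PR: "P x = 0" if "norm x > R" for x using C1_grad_eq_0[OF P R(2)] that by simp
    note Pc = C1_gradD(2)[OF P, where S=UNIV] and pc = C1_gradD(3)[OF P, where S=UNIV]
    let ?k1 = "\<lambda>x. \<zeta> x * P x $ i + \<phi> x * Z x $ i" and ?k2 = "\<lambda>x. \<phi> x * \<zeta> x"
    have k1: "continuous_on UNIV ?k1" "\<And>x. norm x > R \<Longrightarrow> ?k1 x = 0"
      using R PR by (auto intro!: continuous_intros Pc pc zc Zc)
    have k2: "continuous_on UNIV ?k2" "\<And>x. norm x > R \<Longrightarrow> ?k2 x = 0"
      using R PR by (auto intro!: continuous_intros Pc pc zc Zc)
    have Di: "loc_int (\<lambda>x. D x $ i)" by (rule loc_int_component[OF Dl])
    \<comment> \<open>The constant 1, which mollification fixes, fills the slot of h, so the same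
      limit lemma covers the term without D.\<close>
    have l1: "((\<lambda>e. \<integral>x. ?k1 x * F (convolve (moll e) u x) * convolve (moll e) (\<lambda>_. 1::real) x \<partial>lborel)
      \<longlongrightarrow> (LBINT x. ?k1 x * F (u x) * 1)) (at_right 0)"
      by (rule mollify_product_limit[OF uc Fc _ k1]) (auto intro: loc_int_continuous)
    have l2: "((\<lambda>e. \<integral>x. ?k2 x * F' (convolve (moll e) u x) * convolve (moll e) (\<lambda>x. D x $ i) x \<partial>lborel)
      \<longlongrightarrow> (LBINT x. ?k2 x * F' (u x) * D x $ i)) (at_right 0)"
      by (rule mollify_product_limit[OF uc F(2) Di k2])
    have ev: "\<forall>\<^sub>F e in at_right (0::real). (LBINT x. ?k1 x * F (convolve (moll e) u x) * convolve (moll e) (\<lambda>_. 1::real) x)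
       + (LBINT x. ?k2 x * F' (convolve (moll e) u x) * convolve (moll e) (\<lambda>x. D x $ i) x) = 0"
      using eventually_at_right_0_less[of 1, OF zero_less_one]
    proof eventually_elim
      case (elim e)
      then have e: "e > 0" by simp
      let ?u = "convolve (moll e) u" and ?D = "convolve (moll e) D"
      have ue: "C1_grad ?u ?D" by (rule mollify_C1[OF u e])
      note uec = C1_gradD(3)[OF ue, where S=UNIV] and Dec = C1_gradD(2)[OF ue, where S=UNIV]
      note [continuous_intros] = continuous_on_compose2[OF Fc uec] continuous_on_compose2[OF F(2) uec]
      define G where "G x = (\<phi> x * \<zeta> x * F' (?u x)) *\<^sub>R ?D x + F (?u x) *\<^sub>R (\<phi> x *\<^sub>R Z x + \<zeta> x *\<^sub>R P x)" for x
      have "C1_grad (\<lambda>x. \<phi> x * \<zeta> x * F (?u x)) G"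
        unfolding C1_grad_def
      proof (intro conjI allI)
        fix x
        have Fu: "((\<lambda>x. F (?u x)) has_derivative (\<lambda>h. (?D x \<bullet> h) * F' (?u x))) (at x)"
          using has_derivative_compose[OF C1_gradD(1)[OF ue] F(1)[unfolded has_field_derivative_def]]
          by (simp add: mult.commute)
        show "((\<lambda>x. \<phi> x * \<zeta> x * F (?u x)) has_derivative (\<lambda>h. G x \<bullet> h)) (at x)"
          using has_derivative_mult[OF has_derivative_mult[OF C1_gradD(1)[OF P] C1_gradD(1)[OF Z]] Fu]
          by (rule has_derivative_eq_rhs) (auto simp: G_def inner_add_left algebra_simps)
        show "continuous_on UNIV G" unfolding G_def
          by (intro continuous_intros Pc pc zc Zc uec Dec) auto
      qed
      then have "(LBINT x. G x $ i) = 0"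
        by (rule integral_gradient_0[where R=R]) (simp add: R)
      moreover have "(LBINT x. G x $ i) = (LBINT x. ?k1 x * F (?u x) + ?k2 x * F' (?u x) * ?D x $ i)"
        by (rule Bochner_Integration.integral_cong) (auto simp: G_def algebra_simps)
      moreover have "\<dots> = (LBINT x. ?k1 x * F (?u x)) + (LBINT x. ?k2 x * F' (?u x) * ?D x $ i)"
      proof (rule Bochner_Integration.integral_add)
        show "integrable lborel (\<lambda>x. ?k1 x * F (?u x))"
          by (rule integrable_compact_support[where R=R]) (use k1 uec in \<open>auto intro!: continuous_intros\<close>)
        show "integrable lborel (\<lambda>x. ?k2 x * F' (?u x) * ?D x $ i)"
          by (rule integrable_compact_support[where R=R]) (use k2 uec Dec in \<open>auto intro!: continuous_intros\<close>)
      qed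
      ultimately show ?case
        by (simp add: mollify_const[OF e] convolve_component[OF e Dl])
    qed
    have "(LBINT x. ?k1 x * F (u x) * 1) + (LBINT x. ?k2 x * F' (u x) * D x $ i) = 0"
      by (rule tendsto_unique[OF _ tendsto_add[OF l1 l2] tendsto_eventually[OF ev]]) simp
    moreover have i1: "integrable lborel (\<lambda>x. F (u x) * Z x $ i * \<phi> x)"
      by (rule integrable_compact_support[where R=R]) (use R in \<open>auto intro!: continuous_intros pc Zc\<close>)
    moreover have i2: "integrable lborel (\<lambda>x. \<zeta> x * F (u x) * P x $ i)"
      by (rule integrable_compact_support[where R=R]) (use PR in \<open>auto intro!: continuous_intros Pc zc\<close>)
    moreover have i3: "integrable lborel (\<lambda>x. \<zeta> x * F' (u x) * D x $ i * \<phi> x)"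
    proof -
      have c: "continuous_on UNIV (\<lambda>x. ?k2 x * F' (u x))" by (intro continuous_intros k2) auto
      obtain B where B: "B > 0" "\<And>x. norm (?k2 x * F' (u x)) \<le> B"
        by (rule compact_support_bounded[OF c, of R]) (use k2 in auto)
      have [measurable]: "(\<lambda>x. ?k2 x * F' (u x)) \<in> borel_measurable borel" by (rule borel_measurable_continuous_onI[OF c])
      have [measurable]: "(\<lambda>x. D x $ i) \<in> borel_measurable borel" using Di by (simp add: loc_int_def)
      have "integrable lborel (\<lambda>x. (?k2 x * F' (u x)) * D x $ i)"
      proof (rule loc_int_bound[OF Di, where B=B and R=R])
        fix x show "norm ((?k2 x * F' (u x)) * D x $ i) \<le> B * (indicator (cball 0 R) x * norm (D x $ i))"
          using mult_right_mono[OF B(2)[of x], of "norm (D x $ i)"] R(2)[of x]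
          by (cases "norm x \<le> R") (auto simp: abs_mult)
      qed measurable
      then show ?thesis by (simp add: mult_ac)
    qed
    ultimately show ?thesis
    proof -
      assume z: "(LBINT x. ?k1 x * F (u x) * 1) + (LBINT x. ?k2 x * F' (u x) * D x $ i) = 0"
      have "(LBINT x. ?k1 x * F (u x) * 1) = (LBINT x. \<zeta> x * F (u x) * P x $ i + F (u x) * Z x $ i * \<phi> x)"
        by (rule Bochner_Integration.integral_cong) (auto simp: algebra_simps)
      also have "\<dots> = (LBINT x. \<zeta> x * F (u x) * P x $ i) + (LBINT x. F (u x) * Z x $ i * \<phi> x)"
        by (rule Bochner_Integration.integral_add[OF i2 i1])
      finally have a: "(LBINT x. ?k1 x * F (u x) * 1) = \<dots>" .
      have b: "(LBINT x. ?k2 x * F' (u x) * D x $ i) = (LBINT x. \<zeta> x * F' (u x) * D x $ i * \<phi> x)"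
        by (rule Bochner_Integration.integral_cong) (auto simp: mult_ac)
      have "(LBINT x. (F (u x) *\<^sub>R Z x + (\<zeta> x * F' (u x)) *\<^sub>R D x) $ i * \<phi> x)
        = (LBINT x. F (u x) * Z x $ i * \<phi> x + \<zeta> x * F' (u x) * D x $ i * \<phi> x)"
        by (rule Bochner_Integration.integral_cong) (auto simp: algebra_simps)
      also have "\<dots> = (LBINT x. F (u x) * Z x $ i * \<phi> x) + (LBINT x. \<zeta> x * F' (u x) * D x $ i * \<phi> x)"
        by (rule Bochner_Integration.integral_add[OF i1 i3])
      finally have c: "(LBINT x. (F (u x) *\<^sub>R Z x + (\<zeta> x * F' (u x)) *\<^sub>R D x) $ i * \<phi> x) = \<dots>" .
      from z a b c show ?thesis by (simp add: P_def)
    qed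
  qed
  show ?thesis unfolding wgrad_def using l w
    by (auto intro!: continuous_intros zc)
qed

section \<open>Morrey's inequality\<close>

lemma nn_integral_lborel_affine:
  fixes G :: "'a::euclidean_space \<Rightarrow> ennreal"
  assumes "G \<in> borel_measurable borel" "c > 0"
  shows "(\<integral>\<^sup>+w. G (a + c *\<^sub>R w) \<partial>lborel) = ennreal (c powr (- real DIM('a))) * (\<integral>\<^sup>+y. G y \<partial>lborel)"
proof -
  note [measurable] = assms(1)
  have "(\<integral>\<^sup>+y. G y \<partial>lborel) = (\<integral>\<^sup>+y. G y \<partial>(density (distr lborel borel (\<lambda>x. a + c *\<^sub>R x)) (\<lambda>_. \<bar>c\<bar>^DIM('a))))"
    using lborel_affine[of c a] assms(2) by simp
  also have "\<dots> = ennreal (c ^ DIM('a)) * (\<integral>\<^sup>+w. G (a + c *\<^sub>R w) \<partial>lborel)"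
    using assms(2) by (simp add: nn_integral_density nn_integral_distr nn_integral_cmult)
  finally have "(\<integral>\<^sup>+y. G y \<partial>lborel) = ennreal (c ^ DIM('a)) * (\<integral>\<^sup>+w. G (a + c *\<^sub>R w) \<partial>lborel)" .
  moreover have "ennreal (c powr (- real DIM('a))) * (ennreal (c ^ DIM('a)) * X) = X" for X
    using assms(2) by (simp add: powr_minus powr_realpow mult.assoc[symmetric] ennreal_mult[symmetric])
  ultimately show ?thesis by simp
qed

text \<open>The tangent inequality at s, solved for N. The free parameter s plays the role of the
  weight in Young's inequality and is optimized in the next lemma.\<close>

lemma powr_split_bound:
  assumes "p > 1" "s > 0" "N \<ge> (0::real)"
  shows "N \<le> (s powr (1 - p) * N powr p + (p - 1) * s) / p"
proof -
  have "s powr p + p * s powr (p - 1) * (N - s) \<le> N powr p"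
    by (rule powr_tangent) (use assms in auto)
  then have "s powr (1 - p) * (s powr p + p * s powr (p - 1) * (N - s)) \<le> s powr (1 - p) * N powr p"
    by (intro mult_left_mono) auto
  moreover have "s powr (1 - p) * s powr p = s" "s powr (1 - p) * s powr (p - 1) = 1"
    using assms by (simp_all flip: powr_add)
  moreover have "a * (b + p * c * (N - s)) = a * b + p * (a * c) * (N - s)" for a b c :: real
    by (simp add: algebra_simps)
  ultimately have "s + p * (N - s) \<le> s powr (1 - p) * N powr p" by (metis mult.right_neutral)
  then show ?thesis using assms by (simp add: field_simps)
qed

text \<open>Hoelder's inequality against the constant 1. The choice of s as the L^p mean (J /
  V)^(1/p) makes the integrated split bound collapse to s V. The upper bound J, rather than the
  integral itself, keeps s positive.\<close>

lemma nn_integral_Holder_const: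
  fixes h :: "'a \<Rightarrow> real"
  assumes h: "h \<in> borel_measurable M" "\<And>x. h x \<ge> 0" and A: "A \<in> sets M" "emeasure M A = ennreal V" "V > 0"
    and p: "p > 1" and J: "J > 0" "(\<integral>\<^sup>+x. ennreal (h x powr p) * indicator A x \<partial>M) \<le> ennreal J"
  shows "(\<integral>\<^sup>+x. ennreal (h x) * indicator A x \<partial>M) \<le> ennreal (V powr (1 - 1 / p) * J powr (1 / p))"
proof -
  note [measurable] = h(1) A(1)
  define s where "s = (J / V) powr (1 / p)"
  have s: "s > 0" using A J by (simp add: s_def)
  have sp: "s powr p = J / V" using A J p by (simp add: s_def powr_powr)
  have s1: "s powr (1 - p) * J = s * V"
    using s sp A by (simp add: powr_diff field_simps)
  have "(\<integral>\<^sup>+x. ennreal (h x) * indicator A x \<partial>M)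
    \<le> (\<integral>\<^sup>+x. ennreal (s powr (1 - p) / p) * (ennreal (h x powr p) * indicator A x) + ennreal ((p - 1) * s / p) * indicator A x \<partial>M)"
  proof (rule nn_integral_mono)
    fix x
    have "ennreal (h x) \<le> ennreal (s powr (1 - p) / p * h x powr p + (p - 1) * s / p)"
      using powr_split_bound[OF p s h(2), of x] by (intro ennreal_leI) (simp add: add_divide_distrib)
    also have "\<dots> = ennreal (s powr (1 - p) / p) * ennreal (h x powr p) + ennreal ((p - 1) * s / p)"
      using p s by (simp add: ennreal_mult[symmetric] ennreal_plus[symmetric] del: ennreal_plus)
    finally show "ennreal (h x) * indicator A x \<le>
      ennreal (s powr (1 - p) / p) * (ennreal (h x powr p) * indicator A x) + ennreal ((p - 1) * s / p) * indicator A x"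
      by (cases "x \<in> A") auto
  qed
  also have "\<dots> = ennreal (s powr (1 - p) / p) * (\<integral>\<^sup>+x. ennreal (h x powr p) * indicator A x \<partial>M) + ennreal ((p - 1) * s / p) * ennreal V"
    by (subst nn_integral_add) (auto simp: nn_integral_cmult A)
  also have "\<dots> \<le> ennreal (s powr (1 - p) / p) * ennreal J + ennreal ((p - 1) * s / p) * ennreal V"
    by (intro add_right_mono mult_left_mono J) auto
  also have "\<dots> = ennreal (s powr (1 - p) / p * J + (p - 1) * s / p * V)"
    using p s A J by (simp add: ennreal_mult[symmetric] ennreal_plus[symmetric] del: ennreal_plus)
  also have "s powr (1 - p) / p * J + (p - 1) * s / p * V = s * V"
    using s1 p by (simp add: field_simps)
  also have "s * V = V powr (1 - 1 / p) * J powr (1 / p)"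
    using A J by (simp add: s_def powr_divide powr_diff)
  finally show ?thesis .
qed

lemma dim_less_imp_gt_1: "p > real CARD('n::finite) \<Longrightarrow> p > 1"
proof -
  assume p: "p > real CARD('n)"
  have "real CARD('n) \<ge> 1" by (metis One_nat_def Suc_leI of_nat_1 of_nat_mono zero_less_card_finite)
  with p show "p > 1" by linarith
qed

text \<open>The factor 4 is 2 (two comparisons with an averaged value) times 2 (diameter 2 r), 1 /
  (1 - n / p) is the integral of t^(- n / p) over the unit interval, and the volume power is what
  remains of V^(1 - 1/p) / V. The constant is merely admissible, not optimal.\<close>

definition morrey_K :: "'n::finite itself \<Rightarrow> real \<Rightarrow> real" where
  "morrey_K _ p = 4 / (1 - real CARD('n) / p) * unit_ball_vol (real CARD('n)) powr (- (1 / p))"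

lemma morrey_K_pos:
  assumes "p > real CARD('n::finite)"
  shows "morrey_K TYPE('n) p > 0"
proof -
  have "unit_ball_vol (real CARD('n)) \<noteq> 0"
    by (metis unit_ball_vol_pos of_nat_0_le_iff less_irrefl)
  moreover have "real CARD('n) / p < 1" using assms by simp
  ultimately show ?thesis by (simp add: morrey_K_def)
qed

text \<open>\<open>f w - f x\<close> is the integral of the derivative along the segment from \<open>x\<close> to \<open>w\<close>.  For fixed \<open>t\<close>,
  Hoelder's inequality and the substitution \<open>w \<mapsto> x + t (w - x)\<close> bound the average over \<open>w\<close> by a
  multiple of \<open>t powr (- n / p)\<close>, which is integrable over \<open>t\<close> as \<open>p > n\<close>.\<close>

lemma morrey_C1:
  fixes f :: "real^'n \<Rightarrow> real"
  assumes f: "C1_grad f g" and p: "p > real CARD('n)" and r: "r > 0"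
    and x: "x \<in> cball z r" and y: "y \<in> cball z r"
    and J: "J > 0" "(\<integral>\<^sup>+x. ennreal (norm (g x) powr p) * indicator (cball z r) x \<partial>lborel) \<le> ennreal J"
  shows "\<bar>f x - f y\<bar> \<le> morrey_K TYPE('n) p * r powr (1 - real CARD('n) / p) * J powr (1 / p)"
proof -
  let ?n = "real CARD('n)" and ?B = "cball z r"
  have p1: "p > 1" "p > 0" using dim_less_imp_gt_1[OF p] by simp_all
  have p2: "?n / p < 1" using p p1 by simp
  note fc = C1_gradD(3)[OF f, where S=UNIV] and gc = C1_gradD(2)[OF f, where S=UNIV]
  have [measurable]: "f \<in> borel_measurable borel" "g \<in> borel_measurable borel"
    using fc gc by (auto intro: borel_measurable_continuous_onI)
  have [measurable]: "Measurable.pred borel (\<lambda>w. w \<in> ?B)" by (simp add: pred_def)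
  define V where "V = unit_ball_vol ?n * r ^ CARD('n)"
  have V: "V > 0" "emeasure lborel ?B = ennreal V"
    using r emeasure_cball[of r z] by (simp_all add: V_def)
  define C where "C = V powr (1 - 1 / p) * J powr (1 / p)"
  have C: "C > 0" using V J by (simp add: C_def)
  define M where "M = 2 * r * C / (1 - ?n / p)"
  have M: "M > 0" using C r p2 by (simp add: M_def)
  have main: "(\<integral>\<^sup>+w. ennreal \<bar>f w - f x\<bar> * indicator ?B w \<partial>lborel) \<le> ennreal M" if x: "x \<in> ?B" for x
  proof -
    let ?G = "\<lambda>t w. ennreal (2 * r * norm (g (x + t *\<^sub>R (w - x)))) * indicator {0..1} t * indicator ?B w"
    have "(\<integral>\<^sup>+w. ennreal \<bar>f w - f x\<bar> * indicator ?B w \<partial>lborel)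
      \<le> (\<integral>\<^sup>+w. (\<integral>\<^sup>+t. ?G t w \<partial>lborel) \<partial>lborel)"
    proof (rule nn_integral_mono)
      fix w
      show "ennreal \<bar>f w - f x\<bar> * indicator ?B w \<le> (\<integral>\<^sup>+t. ?G t w \<partial>lborel)"
      proof (cases "w \<in> ?B")
        case True
        define \<phi> where "\<phi> t = g (x + t *\<^sub>R (w - x)) \<bullet> (w - x)" for t
        have cline: "continuous_on UNIV (\<lambda>t. g (x + t *\<^sub>R (w - x)))"
          by (intro continuous_on_compose2[OF gc] continuous_intros) auto
        have c\<phi>: "continuous_on UNIV \<phi>"
          unfolding \<phi>_def by (intro continuous_intros cline)
        have "((\<lambda>t. f (x + t *\<^sub>R (w - x))) has_real_derivative \<phi> t) (at t)" for t
        proof -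
          have "((\<lambda>t. x + t *\<^sub>R (w - x)) has_derivative (\<lambda>s. s *\<^sub>R (w - x))) (at t)"
            by (auto intro!: derivative_eq_intros)
          from has_derivative_compose[OF this C1_gradD(1)[OF f]]
          show ?thesis unfolding has_field_derivative_def \<phi>_def
            by (rule has_derivative_eq_rhs) (auto simp: mult.commute)
        qed
        then have hb: "has_bochner_integral lborel (\<lambda>t. \<phi> t * indicator {0..1} t) (f (x + 1 *\<^sub>R (w - x)) - f (x + 0 *\<^sub>R (w - x)))"
          using c\<phi> by (intro has_bochner_integral_FTC_Icc_real) (auto simp: continuous_on_eq_continuous_at)
        have "ennreal \<bar>f w - f x\<bar> = ennreal (norm (LBINT t. \<phi> t * indicator {0..1} t))"
          using has_bochner_integral_integral_eq[OF hb] by simp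
        also have "\<dots> \<le> (\<integral>\<^sup>+t. ennreal (norm (\<phi> t * indicator {0..1} t)) \<partial>lborel)"
          using hb by (intro integral_norm_bound_ennreal) (auto simp: has_bochner_integral_iff)
        also have "\<dots> \<le> (\<integral>\<^sup>+t. ?G t w \<partial>lborel)"
        proof (rule nn_integral_mono)
          fix t
          have "norm (w - x) \<le> 2 * r"
          proof -
            have "dist w x \<le> dist w z + dist z x" by (rule dist_triangle)
            then show ?thesis using x True by (simp add: dist_norm norm_minus_commute)
          qed
          then have "\<bar>\<phi> t\<bar> \<le> norm (g (x + t *\<^sub>R (w - x))) * (2 * r)"
            unfolding \<phi>_def by (intro order_trans[OF Cauchy_Schwarz_ineq2] mult_left_mono) auto
          then show "ennreal (norm (\<phi> t * indicator {0..1} t)) \<le> ?G t w"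
            using True by (auto simp: indicator_def mult.commute intro!: ennreal_leI)
        qed
        finally show ?thesis using True by simp
      qed simp
    qed
    also have "\<dots> = (\<integral>\<^sup>+t. (\<integral>\<^sup>+w. ?G t w \<partial>lborel) \<partial>lborel)"
    proof -
      have [measurable]: "Measurable.pred borel (\<lambda>w. w \<in> ?B)" "Measurable.pred borel (\<lambda>t. t \<in> {0..1::real})"
        by (simp_all add: pred_def)
      have "(\<lambda>x'. ennreal (2 * r * norm (g (x + fst x' *\<^sub>R (snd x' - x)))) * indicator {0..1} (fst x') * indicator ?B (snd x'))
        \<in> borel_measurable (borel \<Otimes>\<^sub>M borel)" by measurable
      then have "(\<lambda>(t, w). ?G t w) \<in> borel_measurable (lborel \<Otimes>\<^sub>M lborel)"
        by (simp add: case_prod_beta cong: measurable_cong_sets)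
      then show ?thesis by (rule lborel_pair.Fubini')
    qed
    also have "\<dots> \<le> (\<integral>\<^sup>+t. ennreal (2 * r * C) * ennreal (indicator {0..1} t * t powr (- (?n / p))) \<partial>lborel)"
    proof (rule nn_integral_mono_AE)
      \<comment> \<open>The single point t = 0 has to be discarded: there
        \<open>0 powr _ = 0\<close> would make the right side vanish.\<close>
      have "AE t in lborel. t \<noteq> (0::real)" by (rule AE_lborel_singleton)
      then show "AE t in lborel. (\<integral>\<^sup>+w. ?G t w \<partial>lborel) \<le> ennreal (2 * r * C) * ennreal (indicator {0..1} t * t powr (- (?n / p)))"
      proof eventually_elim
        case (elim t)
        show ?case
        proof (cases "t \<in> {0..1}")
          case True
          then have t: "0 < t" "t \<le> 1" using elim by auto
          let ?L = "\<lambda>w. x + t *\<^sub>R (w - x)"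
          have "(\<integral>\<^sup>+w. ennreal (norm (g (?L w)) powr p) * indicator ?B w \<partial>lborel)
            \<le> (\<integral>\<^sup>+w. ennreal (norm (g ((1 - t) *\<^sub>R x + t *\<^sub>R w)) powr p) * indicator ?B ((1 - t) *\<^sub>R x + t *\<^sub>R w) \<partial>lborel)"
          proof (rule nn_integral_mono)
            fix w
            \<comment> \<open>Convexity of the ball lets the indicator be moved to the image point,
              so that the substitution applies to the whole integrand.\<close>
            have "(1 - t) *\<^sub>R x + t *\<^sub>R w \<in> ?B" if "w \<in> ?B"
              using convexD_alt[OF convex_cball x that, of t] t by simp
            moreover have "?L w = (1 - t) *\<^sub>R x + t *\<^sub>R w" by (simp add: algebra_simps)
            ultimately show "ennreal (norm (g (?L w)) powr p) * indicator ?B w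
              \<le> ennreal (norm (g ((1 - t) *\<^sub>R x + t *\<^sub>R w)) powr p) * indicator ?B ((1 - t) *\<^sub>R x + t *\<^sub>R w)"
              by (auto simp: indicator_def)
          qed
          also have "\<dots> = ennreal (t powr (- ?n)) * (\<integral>\<^sup>+y. ennreal (norm (g y) powr p) * indicator ?B y \<partial>lborel)"
            by (subst nn_integral_lborel_affine[where G="\<lambda>y. ennreal (norm (g y) powr p) * indicator ?B y"], measurable) (use t in auto)
          also have "\<dots> \<le> ennreal (t powr (- ?n)) * ennreal J" by (intro mult_left_mono J) auto
          also have "\<dots> = ennreal (t powr (- ?n) * J)" using J by (simp add: ennreal_mult)
          finally have *: "(\<integral>\<^sup>+w. ennreal (norm (g (?L w)) powr p) * indicator ?B w \<partial>lborel) \<le> ennreal (t powr (- ?n) * J)" .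
          have "(\<integral>\<^sup>+w. ennreal (norm (g (?L w))) * indicator ?B w \<partial>lborel)
            \<le> ennreal (V powr (1 - 1 / p) * (t powr (- ?n) * J) powr (1 / p))"
            by (rule nn_integral_Holder_const[OF _ _ _ V(2) V(1) p1(1) _ *]) (use t J in auto)
          also have "V powr (1 - 1 / p) * (t powr (- ?n) * J) powr (1 / p) = C * t powr (- (?n / p))"
            using t J by (simp add: C_def powr_mult powr_powr)
          finally have **: "(\<integral>\<^sup>+w. ennreal (norm (g (?L w))) * indicator ?B w \<partial>lborel) \<le> ennreal (C * t powr (- (?n / p)))" .
          have "(\<integral>\<^sup>+w. ?G t w \<partial>lborel) = (\<integral>\<^sup>+w. ennreal (2 * r) * (ennreal (norm (g (?L w))) * indicator ?B w) \<partial>lborel)"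
            using True r by (intro nn_integral_cong) (auto simp: indicator_def ennreal_mult)
          also have "\<dots> = ennreal (2 * r) * (\<integral>\<^sup>+w. (ennreal (norm (g (?L w))) * indicator ?B w) \<partial>lborel)"
            by (rule nn_integral_cmult) measurable
          also have "\<dots> \<le> ennreal (2 * r) * ennreal (C * t powr (- (?n / p)))" by (intro mult_left_mono **) auto
          also have "\<dots> = ennreal (2 * r * C) * ennreal (indicator {0..1} t * t powr (- (?n / p)))"
            using True r C by (simp add: ennreal_mult[symmetric] mult.assoc)
          finally show ?thesis .
        qed simp
      qed
    qed
    also have "\<dots> = ennreal (2 * r * C) * (\<integral>\<^sup>+t. ennreal (indicator {0..1} t * t powr (- (?n / p))) \<partial>lborel)"
      by (rule nn_integral_cmult) measurable
    also have "(\<integral>\<^sup>+t. ennreal (indicator {0..1} t * t powr (- (?n / p))) \<partial>lborel) = ennreal (1 / (1 - ?n / p))"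
    proof (rule nn_integral_has_integral_lebesgue)
      show "((\<lambda>t. t powr (- (?n / p))) has_integral 1 / (1 - ?n / p)) {0..1}"
        using has_integral_powr_from_0[of "- (?n / p)" 1] p2 by simp
    qed auto
    also have "ennreal (2 * r * C) * ennreal (1 / (1 - ?n / p)) = ennreal M"
      using p2 r C by (simp add: ennreal_mult[symmetric] M_def)
    finally show ?thesis .
  qed
  \<comment> \<open>Both f x and f y are compared with f w, and w is averaged over the ball.\<close>
  have "ennreal \<bar>f x - f y\<bar> * ennreal V = (\<integral>\<^sup>+w. ennreal \<bar>f x - f y\<bar> * indicator ?B w \<partial>lborel)"
    using V(2) by (simp add: nn_integral_cmult)
  also have "\<dots> \<le> (\<integral>\<^sup>+w. ennreal \<bar>f w - f x\<bar> * indicator ?B w + ennreal \<bar>f w - f y\<bar> * indicator ?B w \<partial>lborel)"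
    by (intro nn_integral_mono) (auto simp: indicator_def ennreal_plus[symmetric] simp del: ennreal_plus intro!: ennreal_leI)
  also have "\<dots> \<le> ennreal M + ennreal M"
    by (subst nn_integral_add) (auto intro: add_mono main x y)
  also have "\<dots> = ennreal (2 * M)" using M by (simp add: ennreal_plus[symmetric] del: ennreal_plus)
  finally have "\<bar>f x - f y\<bar> * V \<le> 2 * M" using V M by (simp add: ennreal_mult[symmetric])
  then have "\<bar>f x - f y\<bar> \<le> 2 * M / V" using V by (simp add: field_simps)
  also have "2 * M / V = 4 / (1 - ?n / p) * (r * (V powr (1 - 1/p) / V)) * J powr (1 / p)"
    by (simp add: M_def C_def)
  also have "V powr (1 - 1/p) / V = V powr (- (1 / p))" using V by (simp add: powr_diff powr_minus field_simps)
  also have "V powr (- (1 / p)) = unit_ball_vol ?n powr (- (1 / p)) * r powr (- (?n / p))"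
    using r by (simp add: V_def powr_mult powr_powr flip: powr_realpow)
  also have "r * (unit_ball_vol ?n powr (- (1 / p)) * r powr (- (?n / p))) = unit_ball_vol ?n powr (- (1 / p)) * r powr (1 - ?n / p)"
    using r by (simp add: powr_diff powr_minus field_simps)
  finally show ?thesis by (simp add: morrey_K_def mult.assoc)
qed

text \<open>The C^1 estimate for the mollifications passes to the limit. Mollification sees the
  gradient on a ball enlarged by e, hence the strictly larger radius r' in the energy bound.\<close>

lemma morrey_wgrad:
  fixes u :: "real^'n \<Rightarrow> real"
  assumes u: "wgrad u D" "loc_int (\<lambda>x. norm (D x) powr p)" and p: "p > real CARD('n)" and r: "r > 0" "r < r'"
    and x: "x \<in> cball z r" and y: "y \<in> cball z r"
    and J: "J > 0" "(\<integral>\<^sup>+x. ennreal (norm (D x) powr p) * indicator (cball z r') x \<partial>lborel) \<le> ennreal J"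
  shows "\<bar>u x - u y\<bar> \<le> morrey_K TYPE('n) p * r powr (1 - real CARD('n) / p) * J powr (1 / p)" (is "_ \<le> ?b")
proof (rule field_le_epsilon)
  fix \<epsilon> :: real assume "\<epsilon> > 0"
  have ev1: "\<forall>\<^sub>F e in at_right 0. \<forall>w. norm w \<le> norm z + r \<longrightarrow> \<bar>convolve (moll e) u w - u w\<bar> \<le> \<epsilon> / 2"
    by (rule mollify_uniform) (use wgradD(1)[OF u(1)] \<open>\<epsilon> > 0\<close> in auto)
  have ev2: "\<forall>\<^sub>F e in at_right (0::real). 0 < e \<and> e < r' - r"
    by (rule eventually_at_right_0_less) (use r in simp)
  have "eventually (\<lambda>e::real. \<bar>u x - u y\<bar> \<le> ?b + \<epsilon>) (at_right 0)"
    using ev1 ev2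
  proof eventually_elim
    case (elim e)
    have e: "e > 0" using elim by simp
    have "(\<integral>\<^sup>+x. ennreal (norm (convolve (moll e) D x) powr p) * indicator (cball z r) x \<partial>lborel)
      \<le> (\<integral>\<^sup>+x. ennreal (norm (D x) powr p) * indicator (cball z (r + e)) x \<partial>lborel)"
      by (rule mollify_Lp_ball[OF e _ wgradD(2)[OF u(1)] u(2)]) (use dim_less_imp_gt_1[OF p] in simp)
    also have "\<dots> \<le> (\<integral>\<^sup>+x. ennreal (norm (D x) powr p) * indicator (cball z r') x \<partial>lborel)"
      using elim by (intro nn_integral_mono mult_left_mono) (auto simp: indicator_def)
    also note J(2)
    finally have *: "(\<integral>\<^sup>+x. ennreal (norm (convolve (moll e) D x) powr p) * indicator (cball z r) x \<partial>lborel) \<le> ennreal J" .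
    have "\<bar>convolve (moll e) u x - convolve (moll e) u y\<bar> \<le> ?b"
      by (rule morrey_C1[OF mollify_C1[OF u(1) e] p r(1) x y J(1) *])
    moreover have "norm x \<le> norm z + r" "norm y \<le> norm z + r"
      using x y norm_triangle_sub[of x z] norm_triangle_sub[of y z] by (auto simp: dist_norm norm_minus_commute)
    then have "\<bar>convolve (moll e) u x - u x\<bar> \<le> \<epsilon> / 2" "\<bar>convolve (moll e) u y - u y\<bar> \<le> \<epsilon> / 2"
      using elim by blast+
    ultimately show ?case by linarith
  qed
  then show "\<bar>u x - u y\<bar> \<le> ?b + \<epsilon>" by simp
qed

section \<open>Extremals minimize the energy\<close>

text \<open>Weighted sum of the tangent inequalities at the mean, where the linear terms
  cancel.\<close>

lemma powr_convex_nonneg: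
  fixes a b :: real
  assumes "p \<ge> 1" "a \<ge> 0" "b \<ge> 0" "0 \<le> t" "t \<le> 1"
  shows "((1 - t) * a + t * b) powr p \<le> (1 - t) * a powr p + t * b powr p"
proof -
  define m where "m = (1 - t) * a + t * b"
  have m: "m \<ge> 0" using assms by (simp add: m_def)
  define q where "q = p * m powr (p - 1)"
  have 1: "(1 - t) * (m powr p + q * (a - m)) \<le> (1 - t) * a powr p"
    using powr_tangent[OF assms(1) m assms(2)] assms unfolding q_def by (intro mult_left_mono) auto
  have 2: "t * (m powr p + q * (b - m)) \<le> t * b powr p"
    using powr_tangent[OF assms(1) m assms(3)] assms unfolding q_def by (intro mult_left_mono) auto
  have "(1 - t) * (m powr p + q * (a - m)) + t * (m powr p + q * (b - m)) = m powr p + q * ((1 - t) * a + t * b - m)"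
    by (simp add: algebra_simps)
  also have "\<dots> = m powr p" by (simp add: m_def)
  finally show ?thesis using 1 2 by (simp add: m_def)
qed

lemma norm_powr_convex:
  fixes a b :: "'a::real_normed_vector"
  assumes "p \<ge> 1" "0 \<le> t" "t \<le> 1"
  shows "norm ((1 - t) *\<^sub>R a + t *\<^sub>R b) powr p \<le> (1 - t) * norm a powr p + t * norm b powr p"
proof -
  have "norm ((1 - t) *\<^sub>R a + t *\<^sub>R b) \<le> (1 - t) * norm a + t * norm b"
    using norm_triangle_ineq[of "(1 - t) *\<^sub>R a" "t *\<^sub>R b"] assms by simp
  then have "norm ((1 - t) *\<^sub>R a + t *\<^sub>R b) powr p \<le> ((1 - t) * norm a + t * norm b) powr p"
    using assms by (intro powr_mono2) auto
  also have "\<dots> \<le> (1 - t) * norm a powr p + t * norm b powr p"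
    using assms by (intro powr_convex_nonneg) auto
  finally show ?thesis .
qed

text \<open>For \<open>p \<ge> 2\<close> strict convexity of \<open>norm a powr p\<close> reduces to the parallelogram law by writing
  it as \<open>(norm a)\<^sup>2 powr (p / 2)\<close>.\<close>

lemma norm_midpoint_powr_less:
  fixes a b :: "'a::real_inner"
  assumes "p \<ge> 2" "a \<noteq> b"
  shows "norm ((1 / 2) *\<^sub>R (a + b)) powr p < (norm a powr p + norm b powr p) / 2"
proof -
  have sq: "norm x powr p = ((norm x)\<^sup>2) powr (p / 2)" for x :: 'a
    by (cases "x = 0") (simp_all add: powr_powr flip: powr_numeral)
  have "(norm ((1 / 2) *\<^sub>R (a + b)))\<^sup>2 = ((norm a)\<^sup>2 + (norm b)\<^sup>2) / 2 - (norm (a - b))\<^sup>2 / 4"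
    by (simp add: power2_norm_eq_inner inner_simps inner_commute field_simps)
  also have "\<dots> < ((norm a)\<^sup>2 + (norm b)\<^sup>2) / 2"
  proof -
    have "(norm (a - b))\<^sup>2 > 0" using assms by simp
    then show ?thesis by linarith
  qed
  finally have "norm ((1 / 2) *\<^sub>R (a + b)) powr p < (((norm a)\<^sup>2 + (norm b)\<^sup>2) / 2) powr (p / 2)"
    unfolding sq using assms by (intro powr_less_mono2) auto
  also have "\<dots> = ((1 - 1 / 2) * (norm a)\<^sup>2 + 1 / 2 * (norm b)\<^sup>2) powr (p / 2)" by (simp add: field_simps)
  also have "\<dots> \<le> (1 - 1 / 2) * ((norm a)\<^sup>2) powr (p / 2) + 1 / 2 * ((norm b)\<^sup>2) powr (p / 2)"
    using assms by (intro powr_convex_nonneg) auto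
  finally show ?thesis by (simp add: sq)
qed

text \<open>Borel counterpart of \<open>weak_grad_Lp\<close>, with continuity of u built in through
  \<open>wgrad\<close>; all variational arguments use it, and the original notion returns only in
  the translation lemmas.\<close>

definition wgradp :: "real \<Rightarrow> (real^'n \<Rightarrow> real) \<Rightarrow> (real^'n \<Rightarrow> real^'n) \<Rightarrow> bool" where
  "wgradp p u D \<longleftrightarrow> wgrad u D \<and> integrable lborel (\<lambda>x. norm (D x) powr p)"

definition energy :: "real \<Rightarrow> (real^'n \<Rightarrow> real^'n) \<Rightarrow> real" where
  "energy p D = (LBINT x. norm (D x) powr p)"

lemma energy_nonneg: "energy p D \<ge> 0"
  unfolding energy_def by (rule Bochner_Integration.integral_nonneg) simp

lemma le_one_add_powr: "p \<ge> 1 \<Longrightarrow> x \<ge> 0 \<Longrightarrow> x \<le> 1 + x powr p" for x :: real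
  using powr_mono[of 1 p x] by (cases "x \<le> 1") (auto simp: add_nonneg_nonneg intro: order_trans)

lemma loc_int_of_powr:
  fixes D :: "real^'n \<Rightarrow> real^'n"
  assumes D: "D \<in> borel_measurable borel" "integrable lborel (\<lambda>x. norm (D x) powr p)" and p: "p \<ge> 1"
  shows "loc_int D" "loc_int (\<lambda>x. norm (D x) powr p)"
proof -
  note [measurable] = D(1)
  show "loc_int D"
    unfolding loc_int_def
  proof (intro conjI allI)
    fix R
    have [measurable]: "Measurable.pred borel (\<lambda>x. x \<in> cball (0::real^'n) R)" by (simp add: pred_def)
    show "integrable lborel (\<lambda>x. indicator (cball 0 R) x *\<^sub>R D x)"
    proof (rule Bochner_Integration.integrable_bound)
      show "integrable lborel (\<lambda>x. indicator (cball 0 R) x + norm (D x) powr p)"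
        by (intro Bochner_Integration.integrable_add D integrable_indicator_cball)
      show "AE x in lborel. norm (indicator (cball 0 R) x *\<^sub>R D x) \<le> norm (indicator (cball 0 R) x + norm (D x) powr p)"
        using le_one_add_powr[OF p] by (intro AE_I2) (auto simp: indicator_def)
    qed measurable
  qed (rule D)
  have [measurable]: "Measurable.pred borel (\<lambda>x. x \<in> cball (0::real^'n) R)" for R by (simp add: pred_def)
  show "loc_int (\<lambda>x. norm (D x) powr p)"
    unfolding loc_int_def
    by (auto intro!: Bochner_Integration.integrable_bound[OF D(2)] simp: indicator_def)
qed

lemma wgradpD:
  assumes "wgradp p u D"
  shows "wgrad u D" "integrable lborel (\<lambda>x. norm (D x) powr p)" "continuous_on S u" "D \<in> borel_measurable borel"
  using assms wgradD[of u D] by (auto simp: wgradp_def)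

lemma wgradpI:
  assumes "continuous_on UNIV u" "D \<in> borel_measurable borel" "integrable lborel (\<lambda>x. norm (D x) powr p)" "p \<ge> 1"
    "\<And>\<phi> i. test_fun \<phi> \<Longrightarrow> (LBINT x. u x * partial i \<phi> x) = - (LBINT x. D x $ i * \<phi> x)"
  shows "wgradp p u D"
  using assms loc_int_of_powr(1)[OF assms(2-4)] by (simp add: wgradp_def wgrad_def)

text \<open>\<open>morrey_wgrad\<close> asks for a positive bound J, so J decreases to the energy
  from the right. This covers energy 0, where the conclusion says that u is constant; the uniqueness
  of minimizers rests on that case.\<close>

lemma wgradp_energy_le:
  fixes u :: "real^'n \<Rightarrow> real"
  assumes u: "wgradp p u D" and p: "p > real CARD('n)"
  shows "\<bar>u x - u y\<bar> \<le> morrey_K TYPE('n) p * norm (x - y) powr (1 - real CARD('n) / p) * energy p D powr (1 / p)"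
proof (cases "x = y")
  case False
  have p1: "p \<ge> 1" using dim_less_imp_gt_1[OF p] by simp
  define c where "c = morrey_K TYPE('n) p * norm (x - y) powr (1 - real CARD('n) / p)"
  have le: "\<bar>u x - u y\<bar> \<le> c * J powr (1 / p)" if J: "J > energy p D" for J
    unfolding c_def
  proof (rule morrey_wgrad[where z=x and r="norm (x - y)" and r'="norm (x - y) + 1"])
    show "0 < J" using J energy_nonneg[of p D] by linarith
    have "(\<integral>\<^sup>+z. ennreal (norm (D z) powr p) * indicator (cball x (norm (x - y) + 1)) z \<partial>lborel)
      \<le> (\<integral>\<^sup>+z. ennreal (norm (D z) powr p) \<partial>lborel)"
      by (intro nn_integral_mono) (auto simp: indicator_def)
    also have "\<dots> = ennreal (energy p D)"
      unfolding energy_def by (rule nn_integral_eq_integral[OF wgradpD(2)[OF u]]) simp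
    also have "\<dots> \<le> ennreal J" using J by (intro ennreal_leI) simp
    finally show "(\<integral>\<^sup>+z. ennreal (norm (D z) powr p) * indicator (cball x (norm (x - y) + 1)) z \<partial>lborel) \<le> ennreal J" .
    show "loc_int (\<lambda>x. norm (D x) powr p)" by (rule loc_int_of_powr[OF wgradpD(4,2)[OF u] p1])
  qed (use False p u in \<open>auto simp: dist_norm wgradp_def\<close>)
  have "continuous_on {0..} (\<lambda>J::real. c * J powr (1 / p))"
    by (intro continuous_intros continuous_on_powr') (use p1 in auto)
  then have "((\<lambda>J::real. c * J powr (1 / p)) \<longlongrightarrow> c * energy p D powr (1 / p)) (at (energy p D) within {0..})"
    using energy_nonneg by (auto simp: continuous_on_def)
  then have "((\<lambda>J::real. c * J powr (1 / p)) \<longlongrightarrow> c * energy p D powr (1 / p)) (at_right (energy p D))"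
    by (rule tendsto_within_subset) (use energy_nonneg[of p D] in auto)
  moreover have "\<forall>\<^sub>F J in at_right (energy p D). \<bar>u x - u y\<bar> \<le> c * J powr (1 / p)"
    using eventually_at_right_less by (rule eventually_mono) (rule le)
  ultimately have "\<bar>u x - u y\<bar> \<le> c * energy p D powr (1 / p)" by (intro tendsto_lowerbound) auto
  then show ?thesis by (simp add: c_def)
qed simp

lemma wgradp_add:
  assumes u: "wgradp p u D" and v: "wgradp p v V" and p: "p \<ge> 1"
  shows "wgradp p (\<lambda>x. a * u x + b * v x) (\<lambda>x. a *\<^sub>R D x + b *\<^sub>R V x)"
proof -
  note [measurable] = wgradpD(4)[OF u] wgradpD(4)[OF v]
  have uc: "continuous_on UNIV u" and vc: "continuous_on UNIV v" by (rule wgradpD[OF u] wgradpD[OF v])+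
  show ?thesis
  proof (rule wgradpI)
    show "continuous_on UNIV (\<lambda>x. a * u x + b * v x)" by (intro continuous_intros uc vc)
    show "integrable lborel (\<lambda>x. norm (a *\<^sub>R D x + b *\<^sub>R V x) powr p)"
    proof (rule Bochner_Integration.integrable_bound)
      show "integrable lborel (\<lambda>x. \<bar>2 * a\<bar> powr p * norm (D x) powr p + \<bar>2 * b\<bar> powr p * norm (V x) powr p)"
        by (intro Bochner_Integration.integrable_add integrable_mult_right wgradpD(2)[OF u] wgradpD(2)[OF v])
      show "AE x in lborel. norm (norm (a *\<^sub>R D x + b *\<^sub>R V x) powr p)
        \<le> norm (\<bar>2 * a\<bar> powr p * norm (D x) powr p + \<bar>2 * b\<bar> powr p * norm (V x) powr p)"
      proof (intro AE_I2)
        fix x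
        \<comment> \<open>Doubling both coefficients turns the sum into a midpoint, so convexity
          yields an integrable bound.\<close>
        have "norm (a *\<^sub>R D x + b *\<^sub>R V x) powr p = norm ((1 - 1 / 2) *\<^sub>R ((2 * a) *\<^sub>R D x) + (1 / 2) *\<^sub>R ((2 * b) *\<^sub>R V x)) powr p"
          by simp
        also have "\<dots> \<le> (1 - 1 / 2) * norm ((2 * a) *\<^sub>R D x) powr p + 1 / 2 * norm ((2 * b) *\<^sub>R V x) powr p"
          by (rule norm_powr_convex) (use p in auto)
        also have "\<dots> \<le> \<bar>2 * a\<bar> powr p * norm (D x) powr p + \<bar>2 * b\<bar> powr p * norm (V x) powr p"
        proof -
          have "(1 - 1 / 2) * X + 1 / 2 * Y \<le> X + Y" if "X \<ge> 0" "Y \<ge> 0" for X Y :: real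
            using that by simp
          then show ?thesis unfolding norm_scaleR powr_mult by (simp only: mult_nonneg_nonneg powr_ge_zero)
        qed
        finally show "norm (norm (a *\<^sub>R D x + b *\<^sub>R V x) powr p)
          \<le> norm (\<bar>2 * a\<bar> powr p * norm (D x) powr p + \<bar>2 * b\<bar> powr p * norm (V x) powr p)" by simp
      qed
    qed measurable
    fix \<phi> :: "real^'a \<Rightarrow> real" and i assume \<phi>: "test_fun \<phi>"
    obtain R where R: "R > 0" "\<And>x. norm x > R \<Longrightarrow> \<phi> x = 0" using test_fun_support[OF \<phi>] by metis
    note P = test_fun_C1[OF \<phi>]
    have pc: "continuous_on UNIV \<phi>" and Pc: "continuous_on UNIV (partial i \<phi>)"
      by (rule test_fun_continuous[OF \<phi>])+
    have P0: "partial i \<phi> x = 0" if "norm x > R" for x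
      using C1_grad_eq_0[of \<phi> _ R x, OF P R(2) that] by (metis vec_lambda_beta zero_index)
    have iu: "integrable lborel (\<lambda>x. w x * partial i \<phi> x)" if "continuous_on UNIV w" for w :: "real^'a \<Rightarrow> real"
      by (rule integrable_compact_support[where R=R]) (use P0 in \<open>auto intro!: continuous_on_mult that Pc\<close>)
    obtain B where B: "B > 0" "\<And>x. norm (\<phi> x) \<le> B" using compact_support_bounded[of \<phi> R, OF pc R(2)] by metis
    have [measurable]: "\<phi> \<in> borel_measurable borel" by (rule borel_measurable_continuous_onI[OF pc])
    have iD: "integrable lborel (\<lambda>x. W x $ i * \<phi> x)" if "loc_int W" for W :: "real^'a \<Rightarrow> real^'a"
    proof (rule loc_int_bound[OF loc_int_component[OF that, of i], where B=B and R=R])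
      have "(\<lambda>x. W x $ i) \<in> borel_measurable borel" using loc_int_component[OF that, of i] by (simp add: loc_int_def)
      then show "(\<lambda>x. W x $ i * \<phi> x) \<in> borel_measurable borel" by measurable
      fix x show "norm (W x $ i * \<phi> x) \<le> B * (indicator (cball 0 R) x * norm (W x $ i))"
        using mult_right_mono[OF B(2)[of x], of "norm (W x $ i)"] R(2)[of x]
        by (cases "norm x \<le> R") (auto simp: abs_mult mult.commute)
    qed
    note l = wgradD(2)[OF wgradpD(1)[OF u]] wgradD(2)[OF wgradpD(1)[OF v]]
    have "(LBINT x. (a * u x + b * v x) * partial i \<phi> x)
      = (LBINT x. a * (u x * partial i \<phi> x) + b * (v x * partial i \<phi> x))"
      by (rule Bochner_Integration.integral_cong) (auto simp: algebra_simps)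
    also have "\<dots> = a * (LBINT x. u x * partial i \<phi> x) + b * (LBINT x. v x * partial i \<phi> x)"
      using iu[OF uc] iu[OF vc] by simp
    also have "\<dots> = - (a * (LBINT x. D x $ i * \<phi> x) + b * (LBINT x. V x $ i * \<phi> x))"
      using wgradD(6)[OF wgradpD(1)[OF u] \<phi>, of i] wgradD(6)[OF wgradpD(1)[OF v] \<phi>, of i] by simp
    also have "\<dots> = - (LBINT x. a * (D x $ i * \<phi> x) + b * (V x $ i * \<phi> x))"
      using iD[OF l(1)] iD[OF l(2)] by simp
    also have "(LBINT x. a * (D x $ i * \<phi> x) + b * (V x $ i * \<phi> x)) = (LBINT x. (a *\<^sub>R D x + b *\<^sub>R V x) $ i * \<phi> x)"
      by (rule Bochner_Integration.integral_cong) (auto simp: algebra_simps)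
    finally show "(LBINT x. (a * u x + b * v x) * partial i \<phi> x) = - (LBINT x. (a *\<^sub>R D x + b *\<^sub>R V x) $ i * \<phi> x)" .
  qed (measurable, rule p)
qed

lemma C1_grad_const: "C1_grad (\<lambda>_. c) (\<lambda>_. 0)"
  by (simp add: C1_grad_def)

lemma wgradp_comp:
  assumes u: "wgradp p u D" and p: "p \<ge> 1"
    and F: "\<And>s. (F has_real_derivative F' s) (at s)" "continuous_on UNIV F'" "\<And>s. \<bar>F' s\<bar> \<le> B"
  shows "wgradp p (\<lambda>x. F (u x)) (\<lambda>x. F' (u x) *\<^sub>R D x)"
proof -
  note [measurable] = wgradpD(4)[OF u]
  have w: "wgrad (\<lambda>x. F (u x)) (\<lambda>x. F' (u x) *\<^sub>R D x)"
    using wgrad_prod_comp[OF wgradpD(1)[OF u] C1_grad_const[of 1] F(1,2)] by simp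
  moreover have "integrable lborel (\<lambda>x. norm (F' (u x) *\<^sub>R D x) powr p)"
  proof (rule Bochner_Integration.integrable_bound)
    show "integrable lborel (\<lambda>x. B powr p * norm (D x) powr p)" using wgradpD(2)[OF u] by simp
    show "(\<lambda>x. norm (F' (u x) *\<^sub>R D x) powr p) \<in> borel_measurable lborel"
      using wgradD(4)[OF w] by measurable
    have "norm (F' (u x) *\<^sub>R D x) powr p \<le> B powr p * norm (D x) powr p" for x
    proof -
      have "0 \<le> B" using F(3)[of 0] by linarith
      moreover have "norm (F' (u x) *\<^sub>R D x) \<le> B * norm (D x)" using F(3) by (auto intro: mult_right_mono)
      ultimately show ?thesis using p by (auto simp: powr_mult[symmetric] intro!: powr_mono2)
    qed
    then show "AE x in lborel. norm (norm (F' (u x) *\<^sub>R D x) powr p) \<le> norm (B powr p * norm (D x) powr p)"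
      by (intro AE_I2) simp
  qed
  ultimately show ?thesis by (simp add: wgradp_def)
qed

lemma test_fun_reflect:
  assumes "test_fun \<phi>"
  shows "test_fun (\<lambda>y. \<phi> (c - y))" "partial i (\<lambda>y. \<phi> (c - y)) y = - partial i \<phi> (c - y)"
proof -
  have P: "partial i (\<lambda>y. f (c - y)) y = - partial i f (c - y)"
    and d: "(\<lambda>y. f (c - y)) differentiable (at y)"
    if "f differentiable (at (c - y))" for f :: "real^'a \<Rightarrow> real" and i y
  proof -
    have "((\<lambda>y. c - y) has_derivative (\<lambda>h. - h)) (at y)" by (auto intro!: derivative_eq_intros)
    from has_derivative_compose[OF this has_derivative_partials[OF that]]
    have *: "((\<lambda>y. f (c - y)) has_derivative (\<lambda>h. (- (\<chi> i. partial i f (c - y))) \<bullet> h)) (at y)" by simp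
    from partial_eqI[OF *] show "partial i (\<lambda>y. f (c - y)) y = - partial i f (c - y)" by simp
    from * show "(\<lambda>y. f (c - y)) differentiable (at y)" unfolding differentiable_def by blast
  qed
  have cd: "continuously_differentiable k f \<Longrightarrow> continuously_differentiable k (\<lambda>y. f (c - y))" for k and f :: "real^'a \<Rightarrow> real"
  proof (induction k arbitrary: f)
    case 0
    then have f: "continuous_on UNIV f" by simp
    show ?case by (simp, intro continuous_on_compose2[OF f] continuous_intros) auto
  next
    case (Suc k)
    then have df: "f differentiable (at x)" for x by (auto simp: differentiable_on_def)
    have "partial i (\<lambda>y. f (c - y)) = (\<lambda>y. (-1) * partial i f (c - y))" for i
      using P[OF df] by auto
    moreover have "continuously_differentiable k (\<lambda>y. (-1) * partial i f (c - y))" for i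
      using Suc by (intro continuously_differentiable_mult continuously_differentiable_const) auto
    ultimately show ?case using d[OF df] by (auto simp: differentiable_on_def)
  qed
  have "continuously_differentiable (Suc 0) \<phi>" using assms by (auto simp: test_fun_def)
  then have "\<phi> differentiable (at x)" for x by (auto simp: differentiable_on_def)
  then show "partial i (\<lambda>y. \<phi> (c - y)) y = - partial i \<phi> (c - y)" by (rule P)
  obtain R where R: "R > 0" "\<And>x. norm x > R \<Longrightarrow> \<phi> x = 0" using test_fun_support[OF assms] by metis
  have "{x. \<phi> (c - x) \<noteq> 0} \<subseteq> cball c R"
    using R(2) by (auto simp: dist_norm) (meson not_le)
  then have "closure {x. \<phi> (c - x) \<noteq> 0} \<subseteq> cball c R" by (rule closure_minimal) simp
  then have "compact (closure {x. \<phi> (c - x) \<noteq> 0})"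
    by (metis bounded_cball bounded_subset compact_eq_bounded_closed closed_closure)
  then show "test_fun (\<lambda>y. \<phi> (c - y))" using assms cd by (simp add: test_fun_def)
qed

lemma wgradp_reflect:
  assumes u: "wgradp p u D" and p: "p \<ge> 1"
  shows "wgradp p (\<lambda>x. u (c - x)) (\<lambda>x. - D (c - x))" "energy p (\<lambda>x. - D (c - x)) = energy p D"
proof -
  note [measurable] = wgradpD(4)[OF u]
  have m: "(\<lambda>x. norm (D x) powr p) \<in> borel_measurable borel" by measurable
  have uc: "continuous_on UNIV u" by (rule wgradpD[OF u])
  show "wgradp p (\<lambda>x. u (c - x)) (\<lambda>x. - D (c - x))"
  proof (rule wgradpI)
    show "continuous_on UNIV (\<lambda>x. u (c - x))" by (intro continuous_on_compose2[OF uc] continuous_intros) auto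
    show "integrable lborel (\<lambda>x. norm (- D (c - x)) powr p)"
      using integral_lborel_reflect(2)[OF m, of c] wgradpD(2)[OF u] by simp
    fix \<phi> :: "real^'a \<Rightarrow> real" and i assume \<phi>: "test_fun \<phi>"
    have pc: "continuous_on UNIV \<phi>" and Pc: "continuous_on UNIV (partial i \<phi>)"
      by (rule test_fun_continuous[OF \<phi>])+
    have [measurable]: "\<phi> \<in> borel_measurable borel" "partial i \<phi> \<in> borel_measurable borel" "u \<in> borel_measurable borel"
      by (rule borel_measurable_continuous_onI, fact)+
    have Di: "(\<lambda>x. D x $ i) \<in> borel_measurable borel"
      using loc_int_component[OF wgradD(2)[OF wgradpD(1)[OF u]], of i] by (simp add: loc_int_def)
    have m1: "(\<lambda>x. u x * partial i \<phi> (c - x)) \<in> borel_measurable borel" by measurable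
    have m2: "(\<lambda>x. D x $ i * \<phi> (c - x)) \<in> borel_measurable borel" using Di by measurable
    have "(LBINT x. u (c - x) * partial i \<phi> x) = (LBINT x. u x * partial i \<phi> (c - x))"
      using integral_lborel_reflect(1)[OF m1, of c] by simp
    also have "\<dots> = - (LBINT x. u x * partial i (\<lambda>y. \<phi> (c - y)) x)"
      by (simp add: test_fun_reflect(2)[OF \<phi>])
    also have "\<dots> = (LBINT x. D x $ i * \<phi> (c - x))"
      using wgradD(6)[OF wgradpD(1)[OF u] test_fun_reflect(1)[OF \<phi>], of i c] by simp
    also have "\<dots> = (LBINT x. D (c - x) $ i * \<phi> x)"
      using integral_lborel_reflect(1)[OF m2, of c] by simp
    finally show "(LBINT x. u (c - x) * partial i \<phi> x) = - (LBINT x. (- D (c - x)) $ i * \<phi> x)" by simp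
  qed (measurable, rule p)
  show "energy p (\<lambda>x. - D (c - x)) = energy p D"
    using integral_lborel_reflect(1)[OF m, of c] by (simp add: energy_def)
qed

text \<open>The midpoint of u and v is a competitor. \<open>f\<close> is the convexity defect of the
  p-th power of the norm, nonnegative and zero only where D = V; minimality forces its integral to
  be at most 0. Hence u - v has energy 0, is constant by Morrey's inequality, and vanishes at
  x0.\<close>

lemma minimizer_unique:
  fixes u :: "real^'n \<Rightarrow> real"
  assumes u: "wgradp p u D" and v: "wgradp p v V" and p: "p > real CARD('n)" "p \<ge> 2"
    and min: "\<And>w W. wgradp p w W \<Longrightarrow> w x0 = u x0 \<Longrightarrow> w y0 = u y0 \<Longrightarrow> energy p D \<le> energy p W"
    and v0: "v x0 = u x0" "v y0 = u y0" and le: "energy p V \<le> energy p D"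
  shows "v = u"
proof -
  have p1: "p \<ge> 1" using p by simp
  let ?W = "\<lambda>x. (1 / 2) *\<^sub>R D x + (1 / 2) *\<^sub>R V x"
  have W: "wgradp p (\<lambda>x. (1 / 2) * u x + (1 / 2) * v x) ?W" by (rule wgradp_add[OF u v p1])
  have "energy p D \<le> energy p ?W" by (rule min[OF W]) (use v0 in auto)
  moreover define f where "f x = (norm (D x) powr p + norm (V x) powr p) / 2 - norm (?W x) powr p" for x
  have fi: "integrable lborel f" unfolding f_def[abs_def]
    using wgradpD(2)[OF u] wgradpD(2)[OF v] wgradpD(2)[OF W] by simp
  have "(LBINT x. f x) = (energy p D + energy p V) / 2 - energy p ?W"
    unfolding f_def energy_def using wgradpD(2)[OF u] wgradpD(2)[OF v] wgradpD(2)[OF W] by simp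
  ultimately have "(LBINT x. f x) \<le> 0" using le by simp
  moreover have f: "0 \<le> f x" "f x = 0 \<Longrightarrow> D x = V x" for x
  proof -
    have "D x \<noteq> V x \<Longrightarrow> 0 < f x"
      using norm_midpoint_powr_less[OF p(2), of "D x" "V x"] by (simp add: f_def scaleR_add_right)
    moreover have "D x = V x \<Longrightarrow> f x = 0"
      by (simp add: f_def flip: scaleR_add_left)
    ultimately show "0 \<le> f x" "f x = 0 \<Longrightarrow> D x = V x" by (cases "D x = V x"; auto)+
  qed
  ultimately have "(LBINT x. f x) = 0"
    by (intro antisym Bochner_Integration.integral_nonneg) auto
  then have "AE x in lborel. f x = 0" using integral_nonneg_eq_0_iff_AE[OF fi] f by simp
  then have AE: "AE x in lborel. D x = V x" by eventually_elim (rule f)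
  have d: "wgradp p (\<lambda>x. 1 * u x + (- 1) * v x) (\<lambda>x. 1 *\<^sub>R D x + (- 1) *\<^sub>R V x)" by (rule wgradp_add[OF u v p1])
  have "energy p (\<lambda>x. 1 *\<^sub>R D x + (- 1) *\<^sub>R V x) = 0"
    unfolding energy_def
    by (rule integral_eq_zero_AE) (use AE in \<open>eventually_elim, use p1 in simp\<close>)
  then have "\<bar>(u x - v x) - (u x0 - v x0)\<bar> \<le> 0" for x
    using wgradp_energy_le[OF d p(1), of x x0] p1 by simp
  then show ?thesis using v0 by (intro ext) (simp add: field_simps)
qed

section \<open>Translation between Lebesgue and Borel weak gradients\<close>

lemma borel_measurable_vec_components:
  fixes f :: "'a \<Rightarrow> real^'n"
  shows "(\<And>i. (\<lambda>x. f x $ i) \<in> borel_measurable M) \<Longrightarrow> f \<in> borel_measurable M"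
  by (auto simp: borel_measurable_euclidean_space[of f] Basis_vec_def inner_axis)

lemma borel_measurable_component:
  fixes f :: "'a \<Rightarrow> real^'n"
  shows "f \<in> borel_measurable M \<Longrightarrow> (\<lambda>x. f x $ i) \<in> borel_measurable M"
  by (rule borel_measurable_continuous_on[of "\<lambda>v. v $ i"]) (auto intro: continuous_intros)

lemma norm_powr_le_sum:
  fixes v :: "real^'n"
  assumes "p \<ge> 0"
  shows "norm v powr p \<le> (\<Sum>i\<in>UNIV. (real CARD('n) * \<bar>v $ i\<bar>) powr p)"
proof -
  have fin: "finite (range (\<lambda>i. \<bar>v $ i\<bar>))" by simp
  then have "Max (range (\<lambda>i. \<bar>v $ i\<bar>)) \<in> range (\<lambda>i. \<bar>v $ i\<bar>)" by (intro Max_in) auto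
  then obtain j where "Max (range (\<lambda>i. \<bar>v $ i\<bar>)) = \<bar>v $ j\<bar>" by (metis (no_types, lifting) imageE)
  then have j: "\<bar>v $ i\<bar> \<le> \<bar>v $ j\<bar>" for i using Max_ge[OF fin, of "\<bar>v $ i\<bar>"] by simp
  have "norm v \<le> (\<Sum>i\<in>UNIV. \<bar>v $ i\<bar>)" by (rule norm_le_l1_cart)
  also have "\<dots> \<le> (\<Sum>i\<in>(UNIV::'n set). \<bar>v $ j\<bar>)" by (intro sum_mono j)
  finally have "norm v \<le> real CARD('n) * \<bar>v $ j\<bar>" by simp
  then have "norm v powr p \<le> (real CARD('n) * \<bar>v $ j\<bar>) powr p" using assms by (intro powr_mono2) auto
  also have "\<dots> \<le> (\<Sum>i\<in>UNIV. (real CARD('n) * \<bar>v $ i\<bar>) powr p)"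
    by (rule member_le_sum) auto
  finally show ?thesis .
qed

lemma locally_integrable_loc_int:
  fixes f :: "real^'n \<Rightarrow> real"
  assumes "loc_int f" shows "locally_integrable f"
  unfolding locally_integrable_def set_integrable_def
proof (intro allI impI)
  fix K :: "(real^'n) set" assume K: "compact K"
  have fm: "f \<in> borel_measurable borel" using assms by (simp add: loc_int_def)
  then have m: "(\<lambda>x. indicator K x *\<^sub>R f x) \<in> borel_measurable borel"
    using K by (intro borel_measurable_scaleR borel_measurable_indicator) (auto intro: borel_compact)
  obtain R where R: "\<And>x. x \<in> K \<Longrightarrow> norm x \<le> R" using compact_imp_bounded[OF K] by (auto simp: bounded_iff)
  have "integrable lborel (\<lambda>x. indicator K x *\<^sub>R f x)"
    by (rule loc_int_bound[OF assms, where B=1 and R=R])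
      (use m R in \<open>auto simp: indicator_def\<close>)
  then show "integrable lebesgue (\<lambda>x. indicator K x *\<^sub>R f x)"
    using m by (subst integrable_completion) auto
qed

lemma wgradp_imp_weak_grad_Lp:
  fixes u :: "real^'n \<Rightarrow> real"
  assumes u: "wgradp p u D" and p: "p \<ge> 1"
  shows "weak_grad_Lp p u D" "u \<in> D1p p" "Lp_norm p D = energy p D powr (1 / p)"
proof -
  note Dm[measurable] = wgradpD(4)[OF u]
  note w = wgradpD(1)[OF u]
  have [measurable]: "(\<lambda>x. D x $ i) \<in> borel_measurable borel" for i by (rule borel_measurable_component[OF Dm])
  show 1: "weak_grad_Lp p u D"
    unfolding weak_grad_Lp_def weak_partial_def in_Lp_def
  proof (intro allI conjI impI)
    fix i
    show "locally_integrable u" by (rule locally_integrable_loc_int[OF wgradD(5)[OF w]])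
    show "locally_integrable (\<lambda>x. D x $ i)"
      by (rule locally_integrable_loc_int[OF loc_int_component[OF wgradD(2)[OF w]]])
    show "(\<lambda>x. D x $ i) \<in> borel_measurable lebesgue" by (rule measurable_completion) measurable
    have "integrable lborel (\<lambda>x. \<bar>D x $ i\<bar> powr p)"
    proof (rule Bochner_Integration.integrable_bound[OF wgradpD(2)[OF u]])
      show "AE x in lborel. norm (\<bar>D x $ i\<bar> powr p) \<le> norm (norm (D x) powr p)"
        using p by (intro AE_I2) (auto intro!: powr_mono2 component_le_norm_cart)
    qed measurable
    then show "integrable lebesgue (\<lambda>x. \<bar>D x $ i\<bar> powr p)" by (subst integrable_completion) auto
    fix \<phi> :: "real^'n \<Rightarrow> real" assume \<phi>: "test_fun \<phi>"
    have pc: "continuous_on UNIV \<phi>" and Pc: "continuous_on UNIV (partial i \<phi>)"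
      by (rule test_fun_continuous[OF \<phi>])+
    have [measurable]: "\<phi> \<in> borel_measurable borel" "partial i \<phi> \<in> borel_measurable borel"
      by (rule borel_measurable_continuous_onI, fact)+
    note [measurable] = wgradD(3)[OF w]
    show "(LINT x|lebesgue. u x * partial i \<phi> x) = - (LINT x|lebesgue. D x $ i * \<phi> x)"
      using wgradD(6)[OF w \<phi>, of i] by (simp add: integral_completion)
  qed
  show "u \<in> D1p p" using 1 locally_integrable_loc_int[OF wgradD(5)[OF w]] by (auto simp: D1p_def)
  show "Lp_norm p D = energy p D powr (1 / p)"
    unfolding Lp_norm_def energy_def by (subst integral_completion) auto
qed

text \<open>Each Lebesgue measurable component agrees almost everywhere with a Borel function, and D
  is assembled from these; the weak identity and the norm do not see the null set.\<close>

lemma weak_grad_Lp_imp_wgradp: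
  fixes u :: "real^'n \<Rightarrow> real"
  assumes uc: "continuous_on UNIV u" and u: "weak_grad_Lp p u Du" and p: "p \<ge> 1"
  obtains D where "wgradp p u D" "Lp_norm p Du = energy p D powr (1 / p)"
proof -
  have Dm[measurable]: "(\<lambda>x. Du x $ i) \<in> borel_measurable lebesgue" for i
    using u by (auto simp: weak_grad_Lp_def in_Lp_def)
  have "\<forall>i. \<exists>g. g \<in> borel_measurable lborel \<and> (AE x in lborel. Du x $ i = g x)"
    using completion_ex_borel_measurable_real[OF Dm] by blast
  then obtain g where g: "\<And>i. g i \<in> borel_measurable lborel" "\<And>i. AE x in lborel. Du x $ i = g i x"
    by metis
  define D where "D x = (\<chi> i. g i x)" for x
  have [measurable]: "D \<in> borel_measurable borel"
    by (rule borel_measurable_vec_components) (use g(1) in \<open>simp add: D_def\<close>)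
  have [measurable]: "(\<lambda>x. D x $ i) \<in> borel_measurable borel" for i using g(1)[of i] by (simp add: D_def)
  have "AE x in lborel. \<forall>i\<in>UNIV. Du x $ i = g i x" by (rule AE_finite_allI) (use g in auto)
  then have "AE x in lborel. Du x = D x" by eventually_elim (simp add: D_def vec_eq_iff)
  then have AE: "AE x in lebesgue. Du x = D x" by (rule AE_completion)
  have Dum[measurable]: "Du \<in> borel_measurable lebesgue" by (rule borel_measurable_vec_components) (rule Dm)
  have [measurable]: "D \<in> borel_measurable lebesgue" by (rule measurable_completion) measurable
  have [measurable]: "(\<lambda>x. D x $ i) \<in> borel_measurable lebesgue" for i by (rule measurable_completion) measurable
  have Di: "integrable lborel (\<lambda>x. \<bar>D x $ i\<bar> powr p)" for i
  proof -
    have "integrable lebesgue (\<lambda>x. \<bar>Du x $ i\<bar> powr p)" using u by (auto simp: weak_grad_Lp_def in_Lp_def)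
    then have "integrable lebesgue (\<lambda>x. \<bar>D x $ i\<bar> powr p)"
    proof (rule integrable_cong_AE_imp)
      show "AE x in lebesgue. \<bar>Du x $ i\<bar> powr p = \<bar>D x $ i\<bar> powr p" using AE by eventually_elim simp
    qed measurable
    then show ?thesis by (subst (asm) integrable_completion) auto
  qed
  have "wgradp p u D"
  proof (rule wgradpI[OF uc _ _ p])
    show "integrable lborel (\<lambda>x. norm (D x) powr p)"
    proof (rule Bochner_Integration.integrable_bound)
      show "integrable lborel (\<lambda>x. \<Sum>i\<in>UNIV. (real CARD('n)) powr p * \<bar>D x $ i\<bar> powr p)"
        by (intro Bochner_Integration.integrable_sum integrable_mult_right Di)
      show "AE x in lborel. norm (norm (D x) powr p) \<le> norm (\<Sum>i\<in>UNIV. (real CARD('n)) powr p * \<bar>D x $ i\<bar> powr p)"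
      proof (intro AE_I2)
        fix x
        have "norm (D x) powr p \<le> (\<Sum>i\<in>UNIV. (real CARD('n) * \<bar>D x $ i\<bar>) powr p)"
          using p by (intro norm_powr_le_sum) simp
        also have "\<dots> = (\<Sum>i\<in>UNIV. (real CARD('n)) powr p * \<bar>D x $ i\<bar> powr p)"
          by (simp add: powr_mult)
        finally show "norm (norm (D x) powr p) \<le> norm (\<Sum>i\<in>UNIV. (real CARD('n)) powr p * \<bar>D x $ i\<bar> powr p)" by simp
      qed
    qed measurable
    fix \<phi> :: "real^'n \<Rightarrow> real" and i assume \<phi>: "test_fun \<phi>"
    have pc: "continuous_on UNIV \<phi>" and Pc: "continuous_on UNIV (partial i \<phi>)"
      by (rule test_fun_continuous[OF \<phi>])+
    have [measurable]: "\<phi> \<in> borel_measurable borel" "partial i \<phi> \<in> borel_measurable borel" "u \<in> borel_measurable borel"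
      by (rule borel_measurable_continuous_onI, fact)+
    have [measurable]: "\<phi> \<in> borel_measurable lebesgue" by (rule measurable_completion) measurable
    have "(LBINT x. u x * partial i \<phi> x) = (LINT x|lebesgue. u x * partial i \<phi> x)"
      by (rule integral_completion[symmetric]) measurable
    also have "\<dots> = - (LINT x|lebesgue. Du x $ i * \<phi> x)"
      using u \<phi> by (auto simp: weak_grad_Lp_def weak_partial_def)
    also have "(LINT x|lebesgue. Du x $ i * \<phi> x) = (LINT x|lebesgue. D x $ i * \<phi> x)"
    proof (rule Bochner_Integration.integral_cong_AE)
      show "AE x in lebesgue. Du x $ i * \<phi> x = D x $ i * \<phi> x" using AE by eventually_elim simp
    qed measurable
    also have "\<dots> = (LBINT x. D x $ i * \<phi> x)" by (rule integral_completion) measurable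
    finally show "(LBINT x. u x * partial i \<phi> x) = - (LBINT x. D x $ i * \<phi> x)" .
  qed measurable
  moreover have "Lp_norm p Du = energy p D powr (1 / p)"
  proof -
    have "(LINT x|lebesgue. norm (Du x) powr p) = (LINT x|lebesgue. norm (D x) powr p)"
    proof (rule Bochner_Integration.integral_cong_AE)
      show "AE x in lebesgue. norm (Du x) powr p = norm (D x) powr p" using AE by eventually_elim simp
    qed measurable
    also have "\<dots> = energy p D" unfolding energy_def by (rule integral_completion) measurable
    finally show ?thesis by (simp add: Lp_norm_def)
  qed
  ultimately show ?thesis by (rule that)
qed

section \<open>The least Morrey constant and its extremals\<close>

lemma holder_quotient_nonneg: "holder_quotient p u x y \<ge> 0"
  by (simp add: holder_quotient_def)

lemma holder_seminorm_le_iff: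
  assumes "c \<ge> 0"
  shows "holder_seminorm p u \<le> ennreal c \<longleftrightarrow> (\<forall>x y. x \<noteq> y \<longrightarrow> holder_quotient p u x y \<le> c)"
  using assms by (auto simp: holder_seminorm_def SUP_le_iff holder_quotient_nonneg)

text \<open>Replaces the supremum in the extended reals by real pointwise inequalities. The sign of
  C matters, since \<open>ennreal\<close> sends negative numbers to 0.\<close>

lemma morrey_inequality_iff:
  assumes "p \<ge> 1" "C \<ge> 0"
  shows "morrey_inequality TYPE('n::finite) p C \<longleftrightarrow>
    (\<forall>(u :: real^'n \<Rightarrow> real) D. wgradp p u D \<longrightarrow> (\<forall>x y. x \<noteq> y \<longrightarrow> holder_quotient p u x y \<le> C * energy p D powr (1 / p)))"
    (is "?l \<longleftrightarrow> ?r")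
proof
  assume l: ?l
  show ?r
  proof (intro allI impI)
    fix u :: "real^'n \<Rightarrow> real" and D and x y :: "real^'n" assume u: "wgradp p u D" and "x \<noteq> y"
    have "holder_seminorm p u \<le> ennreal (C * Lp_norm p D)"
      using l wgradp_imp_weak_grad_Lp[OF u assms(1)] wgradpD(3)[OF u] unfolding morrey_inequality_def by blast
    then show "holder_quotient p u x y \<le> C * energy p D powr (1 / p)"
      using \<open>x \<noteq> y\<close> assms(2) unfolding wgradp_imp_weak_grad_Lp(3)[OF u assms(1)]
      by (subst (asm) holder_seminorm_le_iff) auto
  qed
next
  assume r: ?r
  show ?l
    unfolding morrey_inequality_def
  proof (intro allI impI)
    fix u :: "real^'n \<Rightarrow> real" and Du
    assume "u \<in> D1p p \<and> continuous_on UNIV u \<and> weak_grad_Lp p u Du"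
    then obtain D where D: "wgradp p u D" "Lp_norm p Du = energy p D powr (1 / p)"
      using weak_grad_Lp_imp_wgradp[of u p Du] assms(1) by metis
    then show "holder_seminorm p u \<le> ennreal (C * Lp_norm p Du)"
      using r assms(2) unfolding D(2) by (subst holder_seminorm_le_iff) auto
  qed
qed

text \<open>Makes the set of admissible constants nonempty, so that its infimum is
  meaningful.\<close>

lemma morrey_inequality_K:
  assumes p: "p > real CARD('n)"
  shows "morrey_inequality TYPE('n::finite) p (morrey_K TYPE('n) p)"
proof -
  have p1: "p \<ge> 1" using dim_less_imp_gt_1[OF p] by simp
  show ?thesis
  proof (subst morrey_inequality_iff[OF p1 less_imp_le[OF morrey_K_pos[OF p]]], intro allI impI)
    fix u :: "real^'n \<Rightarrow> real" and D and x y :: "real^'n" assume "wgradp p u D" "x \<noteq> y"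
    then show "holder_quotient p u x y \<le> morrey_K TYPE('n) p * energy p D powr (1 / p)"
      using wgradp_energy_le[of p u D x y] p by (simp add: holder_quotient_def divide_le_eq mult_ac)
  qed
qed

text \<open>A \<open>LEAST\<close> over the reals is useful only once the minimum is attained: the
  infimum I of the admissible constants is positive and again admissible, because the inequality is
  closed in C. Then q = I N for the extremal, while a competitor with the same increment has the
  same quotient q, bounded by I times its own norm.\<close>

lemma extremal_minimizes_energy:
  fixes u :: "real^'n \<Rightarrow> real"
  assumes p: "p > real CARD('n)" and ext: "morrey_extremal p u" and ne: "x0 \<noteq> y0"
    and sup: "holder_seminorm p u = ennreal (holder_quotient p u x0 y0)"
  obtains D where "wgradp p u D" "u x0 \<noteq> u y0"
    "\<And>v V. wgradp p v V \<Longrightarrow> \<bar>v x0 - v y0\<bar> = \<bar>u x0 - u y0\<bar> \<Longrightarrow> energy p D \<le> energy p V"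
proof -
  have p1: "p \<ge> 1" using dim_less_imp_gt_1[OF p] by simp
  obtain Du where Du: "weak_grad_Lp p u Du" "holder_seminorm p u = ennreal (morrey_const TYPE('n) p * Lp_norm p Du)"
    and uc: "continuous_on UNIV u" and nc: "\<not> u constant_on UNIV"
    using ext by (auto simp: morrey_extremal_def)
  obtain D where D: "wgradp p u D" "Lp_norm p Du = energy p D powr (1 / p)"
    using weak_grad_Lp_imp_wgradp[OF uc Du(1) p1] by metis
  define q where "q = holder_quotient p u x0 y0"
  define N where "N = energy p D powr (1 / p)"
  have N0: "N \<ge> 0" by (simp add: N_def)
  have q0: "q > 0"
  proof (rule ccontr)
    assume "\<not> q > 0"
    then have "q = 0" using holder_quotient_nonneg[of p u x0 y0] by (simp add: q_def)
    then have "\<forall>x y. x \<noteq> y \<longrightarrow> holder_quotient p u x y \<le> 0"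
      using holder_seminorm_le_iff[of 0 p u] sup by (simp add: q_def)
    then have "u x = u x0" for x
      by (cases "x = x0") (force simp: holder_quotient_def divide_le_0_iff)+
    then show False using nc by (auto simp: constant_on_def)
  qed
  define S where "S = {C. 0 < C \<and> morrey_inequality TYPE('n) p C}"
  have S: "q \<le> C * N" "C > 0" if "C \<in> S" for C
    using that morrey_inequality_iff[OF p1, of C, where 'n='n] D(1) ne
    by (auto simp: S_def q_def N_def)
  have KS: "morrey_K TYPE('n) p \<in> S" using morrey_K_pos[OF p] morrey_inequality_K[OF p] by (simp add: S_def)
  have Npos: "N > 0" using S(1)[OF KS] q0 N0 by (cases "N = 0") auto
  define I where "I = Inf S"
  have bdd: "bdd_below S" using S(2) by (intro bdd_belowI[of _ 0]) (auto intro: less_imp_le)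
  \<comment> \<open>Every admissible constant is at least q / N. This keeps the infimum away from 0,
    as the strict positivity in the definition of the least constant demands.\<close>
  have "q / N \<le> I" unfolding I_def
    by (rule cInf_greatest) (use KS S(1) Npos in \<open>auto simp: field_simps\<close>)
  moreover have "q / N > 0" using q0 Npos by simp
  ultimately have I0: "I > 0" by linarith
  have Im: "morrey_inequality TYPE('n) p I"
  proof (subst morrey_inequality_iff[OF p1 less_imp_le[OF I0]], intro allI impI)
    fix v :: "real^'n \<Rightarrow> real" and V and x y :: "real^'n" assume v: "wgradp p v V" "x \<noteq> y"
    have le: "holder_quotient p v x y \<le> C * energy p V powr (1 / p)" if "C \<in> S" for C
      using that morrey_inequality_iff[OF p1, of C, where 'n='n] v by (auto simp: S_def)
    show "holder_quotient p v x y \<le> I * energy p V powr (1 / p)"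
    proof (cases "energy p V powr (1 / p) = 0")
      case True then show ?thesis using le[OF KS] by simp
    next
      case False
      then have pos: "energy p V powr (1 / p) > 0" using powr_ge_zero[of "energy p V" "1 / p"] by linarith
      have "holder_quotient p v x y / energy p V powr (1 / p) \<le> I" unfolding I_def
        by (rule cInf_greatest) (use KS le pos in \<open>auto simp: field_simps\<close>)
      then show ?thesis using pos by (simp add: field_simps)
    qed
  qed
  have const: "morrey_const TYPE('n) p = I"
    unfolding morrey_const_def
  proof (rule Least_equality)
    show "0 < I \<and> morrey_inequality TYPE('n) p I" using I0 Im by simp
    fix C assume "0 < C \<and> morrey_inequality TYPE('n) p C"
    then show "I \<le> C" unfolding I_def using bdd by (intro cInf_lower) (auto simp: S_def)
  qed
  \<comment> \<open>Both expressions for the seminorm are \<open>ennreal\<close> images of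
    nonnegative reals, so the reals coincide.\<close>
  have qI: "q = I * N"
    using sup Du(2) D(2) q0 I0 N0 by (simp add: const q_def N_def)
  show ?thesis
  proof (rule that[OF D(1)])
    show "u x0 \<noteq> u y0" using q0 by (auto simp: q_def holder_quotient_def)
    fix v V assume v: "wgradp p v V" "\<bar>v x0 - v y0\<bar> = \<bar>u x0 - u y0\<bar>"
    have "q = holder_quotient p v x0 y0" using v(2) by (simp add: q_def holder_quotient_def)
    also have "\<dots> \<le> I * energy p V powr (1 / p)"
      using Im[unfolded morrey_inequality_iff[OF p1 less_imp_le[OF I0]]] v(1) ne by blast
    finally have "N \<le> energy p V powr (1 / p)" using qI I0 by simp
    then show "energy p D \<le> energy p V"
      unfolding N_def using powr_less_mono2[of "1 / p" "energy p V" "energy p D"] energy_nonneg[of p V] p1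
      by (force simp: not_le[symmetric])
  qed
qed

section \<open>Decay of energy minimizers\<close>

text \<open>Positive parts to a power above 1 are C^1 across 0; they supply the cutoff, the
  truncation and the continuation used below.\<close>

lemma max0_powr_has_real_derivative:
  assumes q: "q > 1"
  shows "((\<lambda>t. max 0 t powr q) has_real_derivative q * max 0 t powr (q - 1)) (at t)"
proof -
  consider "t < 0" | "t = 0" | "t > 0" by linarith
  then show ?thesis
  proof cases
    case 1
    have "((\<lambda>_. 0) has_real_derivative 0) (at t)" by simp
    then have "((\<lambda>t. max 0 t powr q) has_real_derivative 0) (at t)"
      by (rule has_field_derivative_transform_within_open[where S="{..<0}"]) (use 1 in auto)
    then show ?thesis using 1 by simp
  next
    case 2
    have "(\<lambda>h. max 0 h powr q / h) \<midarrow>0\<rightarrow> 0"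
    proof (rule Lim_null_comparison)
      show "\<forall>\<^sub>F h in at 0. norm (max 0 h powr q / h) \<le> \<bar>h\<bar> powr (q - 1)"
      proof (intro always_eventually allI)
        fix h :: real
        show "norm (max 0 h powr q / h) \<le> \<bar>h\<bar> powr (q - 1)"
        proof (cases "h > 0")
          case True
          then show ?thesis by (simp add: powr_diff)
        next
          case False
          then have "max 0 h = 0" by simp
          then show ?thesis by simp
        qed
      qed
      have "((\<lambda>h::real. \<bar>h\<bar>) \<longlongrightarrow> 0) (at 0)" by (rule tendsto_rabs_zero[OF tendsto_ident_at])
      from tendsto_powr'[OF this tendsto_const[of "q - 1"]] q
      show "((\<lambda>h::real. \<bar>h\<bar> powr (q - 1)) \<longlongrightarrow> 0) (at 0)" by simp
    qed
    then show ?thesis using 2 by (simp add: DERIV_def)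
  next
    case 3
    have "((\<lambda>t. t powr q) has_real_derivative q * t powr (q - 1)) (at t)"
      using 3 by (rule has_real_derivative_powr)
    then have "((\<lambda>t. max 0 t powr q) has_real_derivative q * t powr (q - 1)) (at t)"
      by (rule has_field_derivative_transform_within_open[where S="{0<..}"]) (use 3 in auto)
    then show ?thesis using 3 by (simp add: max_def)
  qed
qed

lemma continuous_on_max0_powr:
  "q > 0 \<Longrightarrow> continuous_on S f \<Longrightarrow> continuous_on S (\<lambda>x. max 0 (f x) powr q)" for f :: "_ \<Rightarrow> real"
  by (rule continuous_on_powr') (auto intro!: continuous_intros)

text \<open>Here F' may be unbounded, unlike in \<open>wgradp_comp\<close>: the compact support of
  \<zeta> makes \<zeta> F'(u) bounded.\<close>

lemma wgradp_cutoff: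
  fixes u :: "real^'n \<Rightarrow> real"
  assumes u: "wgradp p u D" and p: "p \<ge> 1" and Z: "C1_grad \<zeta> Z" "\<And>x. norm x > R \<Longrightarrow> \<zeta> x = 0"
    and F: "\<And>s. (F has_real_derivative F' s) (at s)" "continuous_on UNIV F'"
  shows "wgradp p (\<lambda>x. \<zeta> x * F (u x)) (\<lambda>x. F (u x) *\<^sub>R Z x + (\<zeta> x * F' (u x)) *\<^sub>R D x)"
proof -
  have Fc: "continuous_on UNIV F" using F(1) by (meson DERIV_isCont continuous_at_imp_continuous_on)
  note uc = wgradpD(3)[OF u, where S=UNIV] and Zc = C1_gradD(2)[OF Z(1), where S=UNIV] and zc = C1_gradD(3)[OF Z(1), where S=UNIV]
  have Z0: "Z x = 0" if "norm x > R" for x using C1_grad_eq_0[of \<zeta> Z R x] Z that by blast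
  note [continuous_intros] = continuous_on_compose2[OF Fc uc] continuous_on_compose2[OF F(2) uc]
  have c1: "continuous_on UNIV (\<lambda>x. F (u x) *\<^sub>R Z x)" by (intro continuous_intros Zc) auto
  have c2: "continuous_on UNIV (\<lambda>x. \<zeta> x * F' (u x))" by (intro continuous_intros zc) auto
  obtain B where B: "B > 0" "\<And>x. norm (\<zeta> x * F' (u x)) \<le> B"
    by (rule compact_support_bounded[OF c2, of R]) (use Z in auto)
  have w: "wgrad (\<lambda>x. \<zeta> x * F (u x)) (\<lambda>x. F (u x) *\<^sub>R Z x + (\<zeta> x * F' (u x)) *\<^sub>R D x)"
    by (rule wgrad_prod_comp[OF wgradpD(1)[OF u] Z(1) F])
  have "integrable lborel (\<lambda>x. norm (F (u x) *\<^sub>R Z x + (\<zeta> x * F' (u x)) *\<^sub>R D x) powr p)"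
  proof (rule Bochner_Integration.integrable_bound)
    have "integrable lborel (\<lambda>x. norm (2 *\<^sub>R (F (u x) *\<^sub>R Z x)) powr p)"
    proof (rule integrable_compact_support[where R=R])
      show "continuous_on UNIV (\<lambda>x. norm (2 *\<^sub>R (F (u x) *\<^sub>R Z x)) powr p)"
        by (rule continuous_on_powr') (use p in \<open>auto intro!: continuous_intros Zc\<close>)
    qed (simp add: Z0)
    then show "integrable lborel (\<lambda>x. norm (2 *\<^sub>R (F (u x) *\<^sub>R Z x)) powr p + (2 * B) powr p * norm (D x) powr p)"
      using wgradpD(2)[OF u] by simp
    show "(\<lambda>x. norm (F (u x) *\<^sub>R Z x + (\<zeta> x * F' (u x)) *\<^sub>R D x) powr p) \<in> borel_measurable lborel"
      using wgradD(4)[OF w] by measurable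
    show "AE x in lborel. norm (norm (F (u x) *\<^sub>R Z x + (\<zeta> x * F' (u x)) *\<^sub>R D x) powr p)
      \<le> norm (norm (2 *\<^sub>R (F (u x) *\<^sub>R Z x)) powr p + (2 * B) powr p * norm (D x) powr p)"
    proof (intro AE_I2)
      fix x
      have "norm (F (u x) *\<^sub>R Z x + (\<zeta> x * F' (u x)) *\<^sub>R D x) powr p
        = norm ((1 - 1 / 2) *\<^sub>R (2 *\<^sub>R (F (u x) *\<^sub>R Z x)) + (1 / 2) *\<^sub>R (2 *\<^sub>R ((\<zeta> x * F' (u x)) *\<^sub>R D x))) powr p"
        by simp
      also have "\<dots> \<le> (1 - 1 / 2) * norm (2 *\<^sub>R (F (u x) *\<^sub>R Z x)) powr p + 1 / 2 * norm (2 *\<^sub>R ((\<zeta> x * F' (u x)) *\<^sub>R D x)) powr p"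
        by (rule norm_powr_convex) (use p in auto)
      also have "norm (2 *\<^sub>R ((\<zeta> x * F' (u x)) *\<^sub>R D x)) \<le> (2 * B) * norm (D x)"
        using mult_right_mono[OF B(2)[of x], of "norm (D x)"] by simp
      then have "norm (2 *\<^sub>R ((\<zeta> x * F' (u x)) *\<^sub>R D x)) powr p \<le> (2 * B) powr p * norm (D x) powr p"
        using B p by (subst powr_mult[symmetric]) (auto intro!: powr_mono2)
      then have "(1 - 1 / 2) * norm (2 *\<^sub>R (F (u x) *\<^sub>R Z x)) powr p + 1 / 2 * norm (2 *\<^sub>R ((\<zeta> x * F' (u x)) *\<^sub>R D x)) powr p
        \<le> norm (2 *\<^sub>R (F (u x) *\<^sub>R Z x)) powr p + (2 * B) powr p * norm (D x) powr p"
      proof -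
        have "(1 - 1 / 2) * X + 1 / 2 * Y \<le> X + Y'" if "X \<ge> 0" "Y \<ge> 0" "Y \<le> Y'" for X Y Y' :: real using that by simp
        then show ?thesis using \<open>norm (2 *\<^sub>R ((\<zeta> x * F' (u x)) *\<^sub>R D x)) powr p \<le> (2 * B) powr p * norm (D x) powr p\<close>
          by (meson powr_ge_zero)
      qed
      finally show "norm (norm (F (u x) *\<^sub>R Z x + (\<zeta> x * F' (u x)) *\<^sub>R D x) powr p)
        \<le> norm (norm (2 *\<^sub>R (F (u x) *\<^sub>R Z x)) powr p + (2 * B) powr p * norm (D x) powr p)" by simp
    qed
  qed
  then show ?thesis using w by (simp add: wgradp_def)
qed

text \<open>All that the decay argument retains of an extremal is minimality under a fixed increment
  between two points with different values.\<close>

locale energy_minimizer =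
  fixes u :: "real^'n \<Rightarrow> real" and D :: "real^'n \<Rightarrow> real^'n" and p :: real and x0 y0 :: "real^'n"
  assumes dim: "CARD('n) \<ge> 2" and p_gt: "p > real CARD('n)"
    and wu: "wgradp p u D" and u_ne: "u x0 \<noteq> u y0"
    and min: "\<And>v V. wgradp p v V \<Longrightarrow> \<bar>v x0 - v y0\<bar> = \<bar>u x0 - u y0\<bar> \<Longrightarrow> energy p D \<le> energy p V"
begin

definition m where "m = (u x0 + u y0) / 2"
definition c where "c = (1 / 2) *\<^sub>R (x0 + y0)"
definition h where "h = \<bar>u x0 - u y0\<bar> / 2"

lemma p2: "p > 2" "p \<ge> 2" "p \<ge> 1" "p > 1" "p > 0"
  using dim p_gt by auto

lemma h_pos: "h > 0"
  using u_ne by (simp add: h_def)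

lemma unique:
  assumes "wgradp p v V" "v x0 = u x0" "v y0 = u y0" "energy p V \<le> energy p D"
  shows "v = u"
proof (rule minimizer_unique[OF wu assms(1) p_gt p2(2) _ assms(2,3,4)])
  fix w W assume "wgradp p w W" "w x0 = u x0" "w y0 = u y0"
  then show "energy p D \<le> energy p W" using min[of w W] by simp
qed

text \<open>The point reflection exchanges the values at x0 and y0, and t \<mapsto> 2 m - t
  exchanges them back; neither changes the energy, so uniqueness applies.\<close>

lemma antisymmetric: "u (x0 + y0 - x) - m = - (u x - m)"
proof -
  let ?F = "\<lambda>t. 2 * m - t"
  note r = wgradp_reflect[OF wu p2(3), of "x0 + y0"]
  have "wgradp p (\<lambda>x. ?F (u (x0 + y0 - x))) (\<lambda>x. (- 1) *\<^sub>R (- D (x0 + y0 - x)))"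
    by (rule wgradp_comp[OF r(1) p2(3), where B=1]) (auto intro!: derivative_eq_intros)
  then have "(\<lambda>x. ?F (u (x0 + y0 - x))) = u"
    by (rule unique) (use r(2) in \<open>auto simp: m_def energy_def add_divide_distrib\<close>)
  then have "?F (u (x0 + y0 - x)) = u x" by metis
  then show ?thesis by simp
qed

text \<open>Composing \<open>u\<close> with a contraction that fixes exactly the interval between \<open>u x0\<close> and \<open>u y0\<close>
  does not increase the energy.\<close>

lemma bounded_by_h: "\<bar>u x - m\<bar> \<le> h"
proof -
  \<comment> \<open>\<psi>(t) = ln (1 + t^2) for t > 0 and 0 otherwise is a C^1 substitute for the
    positive part: positive exactly for t > 0, with slope in [0, 1] because 2 t \<le> 1 +
    t^2.\<close>
  define P where "P t = max 0 t powr 2" for t :: real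
  define \<psi> where "\<psi> t = ln (1 + P t)" for t
  define \<psi>' where "\<psi>' t = 2 * max 0 t / (1 + P t)" for t
  have P: "P t \<ge> 0" for t by (simp add: P_def)
  have dP: "(P has_real_derivative 2 * max 0 t) (at t)" for t
    using max0_powr_has_real_derivative[of 2 t] by (simp add: P_def[abs_def])
  have d\<psi>: "(\<psi> has_real_derivative \<psi>' t) (at t)" for t
    unfolding \<psi>_def[abs_def] \<psi>'_def using P[of t]
    by (auto intro!: derivative_eq_intros dP)
  have c\<psi>': "continuous_on UNIV \<psi>'"
  proof -
    have "continuous_on UNIV P" unfolding P_def[abs_def] by (intro continuous_on_max0_powr continuous_intros) auto
    moreover have "1 + P t \<noteq> 0" for t using P[of t] by linarith
    ultimately show ?thesis unfolding \<psi>'_def[abs_def] by (intro continuous_intros) auto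
  qed
  have b\<psi>': "0 \<le> \<psi>' t" "\<psi>' t \<le> 1" for t
  proof -
    have "P t = (max 0 t)\<^sup>2" by (simp add: P_def)
    moreover have "2 * max 0 t \<le> 1 + (max 0 t)\<^sup>2"
      using zero_le_power2[of "max 0 t - 1"] by (simp add: power2_eq_square algebra_simps)
    moreover have "1 + P t > 0" using P[of t] by linarith
    ultimately show "0 \<le> \<psi>' t" "\<psi>' t \<le> 1" by (auto simp: \<psi>'_def divide_le_eq)
  qed
  have \<psi>0: "\<psi> t = 0" if "t \<le> 0" for t using that by (simp add: \<psi>_def P_def)
  have \<psi>1: "\<psi> t > 0" if "t > 0" for t using that by (auto simp: \<psi>_def P_def intro!: ln_gt_zero)
  \<comment> \<open>One correction acts above m + h, the other below m - h. The two slopes sum to a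
    number in [0, 2], hence \<bar>T'\<bar> \<le> 1.\<close>
  define T where "T t = t - (\<psi> (t - m - h) - \<psi> (m - h - t))" for t
  define T' where "T' t = 1 - (\<psi>' (t - m - h) + \<psi>' (m - h - t))" for t
  have dT: "(T has_real_derivative T' t) (at t)" for t
    unfolding T_def[abs_def] T'_def
    by (rule derivative_eq_intros DERIV_chain2[OF d\<psi>] refl)+ simp
  have cT: "continuous_on UNIV T'"
    unfolding T'_def[abs_def] by (intro continuous_intros continuous_on_compose2[OF c\<psi>']) auto
  have bT: "\<bar>T' t\<bar> \<le> 1" for t
    using b\<psi>'[of "t - m - h"] b\<psi>'[of "m - h - t"] unfolding T'_def by linarith
  have T: "T t = t \<longleftrightarrow> \<bar>t - m\<bar> \<le> h" for t
  proof -
    consider "t - m > h" | "m - t > h" | "\<bar>t - m\<bar> \<le> h" by linarith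
    then show ?thesis
    proof cases
      case 1
      then show ?thesis using \<psi>1[of "t - m - h"] \<psi>0[of "m - h - t"] h_pos by (simp add: T_def)
    next
      case 2
      then show ?thesis using \<psi>1[of "m - h - t"] \<psi>0[of "t - m - h"] h_pos by (simp add: T_def)
    next
      case 3
      then show ?thesis using \<psi>0[of "m - h - t"] \<psi>0[of "t - m - h"] by (simp add: T_def)
    qed
  qed
  have w: "wgradp p (\<lambda>x. T (u x)) (\<lambda>x. T' (u x) *\<^sub>R D x)" by (rule wgradp_comp[OF wu p2(3) dT cT bT])
  have "(\<lambda>x. T (u x)) = u"
  proof (rule unique[OF w])
    show "T (u x0) = u x0" "T (u y0) = u y0" unfolding T by (auto simp: h_def m_def field_simps)
    show "energy p (\<lambda>x. T' (u x) *\<^sub>R D x) \<le> energy p D"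
      unfolding energy_def
    proof (rule Bochner_Integration.integral_mono[OF wgradpD(2)[OF w] wgradpD(2)[OF wu]])
      fix x
      have "norm (T' (u x) *\<^sub>R D x) \<le> norm (D x)" using bT[of "u x"] by (simp add: mult_left_le_one_le)
      then show "norm (T' (u x) *\<^sub>R D x) powr p \<le> norm (D x) powr p" using p2 by (intro powr_mono2) auto
    qed
  qed
  then have "T (u x) = u x" by metis
  then show ?thesis using T by blast
qed

text \<open>Morrey's constant times the p-th root of a scale-invariant energy bound for the
  logarithm. In it, 5/2 bounds r times the gradient of the cutoff profile on the ball of radius 5/4
  r, 29/100 = 3/2 - (11/10)^2 is the least value of the profile on the ball of radius 11/10 r, and p
  / (p - 1) comes from the competitor.\<close>

definition osc where
  "osc = morrey_K TYPE('n) p *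
    ((p / (p - 1) * (5 / 2) / (29 / 100)) powr p * (unit_ball_vol (real CARD('n)) * (5 / 4) ^ CARD('n))) powr (1 / p)"

lemma osc_nonneg: "osc \<ge> 0"
  using morrey_K_pos[OF p_gt] by (simp add: osc_def)

text \<open>Competitor \<open>u - \<tau> \<zeta> W powr (1 - p)\<close> with \<open>\<zeta> = \<eta> powr p\<close>, \<open>\<eta> = max 0 q\<close> and
  \<open>W = M + \<epsilon> - (u - m)\<close> on the support of \<open>\<eta>\<close>.  For small \<open>\<tau>\<close> its gradient is a convex
  combination of \<open>D u\<close> and a multiple of \<open>(W / \<eta>) D \<eta>\<close>, so convexity of \<open>norm a powr p\<close> turns minimality into a bound for the energy of \<open>ln W\<close>, without
  the Euler-Lagrange equation.  Beyond the value \<open>M\<close> the function \<open>W\<close> is only a positive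
  \<open>C\<^sup>1\<close> continuation.\<close>

lemma log_oscillation:
  assumes r: "r > 0" and \<epsilon>: "\<epsilon> > 0"
    and M: "\<And>x. x \<in> cball z (5 / 4 * r) \<Longrightarrow> u x - m \<le> M"
    and out: "x0 \<notin> cball z (5 / 4 * r)" "y0 \<notin> cball z (5 / 4 * r)"
    and x: "x \<in> cball z r" and y: "y \<in> cball z r"
  shows "\<bar>ln (M + \<epsilon> - (u x - m)) - ln (M + \<epsilon> - (u y - m))\<bar> \<le> osc"
proof -
  \<comment> \<open>A function on the whole line is required, since u - m may exceed M away from the
    ball. With t = s - m - M > 0 one has \<epsilon> W = (t - \<epsilon>/2)^2 + 3/4 \<epsilon>^2 > 0,
    and the bound 2 / \<epsilon> on \<bar>W'\<bar> / W lets \<open>wgradp_comp\<close> apply to ln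
    W.\<close>
  define W where "W s = \<epsilon> - (s - m - M) + (1 / \<epsilon>) * max 0 (s - m - M) powr 2" for s
  define W' where "W' s = - 1 + (2 / \<epsilon>) * max 0 (s - m - M)" for s
  have W_low: "W s = M + \<epsilon> - (s - m)" "W' s = - 1" if "s - m \<le> M" for s
    using that by (simp_all add: W_def W'_def)
  have W_both: "W s > 0 \<and> \<epsilon> * \<bar>W' s\<bar> \<le> 2 * W s" for s
  proof (cases "s - m \<le> M")
    case True
    then show ?thesis using W_low[OF True] \<epsilon> by simp
  next
    case False
    define t where "t = s - m - M"
    have t: "t > 0" using False by (simp add: t_def)
    have e: "\<epsilon> * W s = \<epsilon>\<^sup>2 - \<epsilon> * t + t\<^sup>2" "\<epsilon> * W' s = 2 * t - \<epsilon>"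
    proof -
      have "W s = \<epsilon> - t + (1 / \<epsilon>) * t\<^sup>2" "W' s = - 1 + (2 / \<epsilon>) * t"
        unfolding W_def W'_def t_def[symmetric] using t by simp_all
      then show "\<epsilon> * W s = \<epsilon>\<^sup>2 - \<epsilon> * t + t\<^sup>2" "\<epsilon> * W' s = 2 * t - \<epsilon>"
        using \<epsilon> by (simp_all add: power2_eq_square distrib_left right_diff_distrib)
    qed
    have sq: "0 \<le> (t - \<epsilon> / 2)\<^sup>2" "0 \<le> (t - \<epsilon>)\<^sup>2" "\<epsilon>\<^sup>2 > 0" "0 \<le> t\<^sup>2" using \<epsilon> by auto
    have "\<epsilon> * W s > 0" unfolding e using sq by (simp add: power2_eq_square algebra_simps)
    then have "W s > 0" using \<epsilon> by (simp add: zero_less_mult_iff)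
    moreover have "\<epsilon> * (\<epsilon> * \<bar>W' s\<bar>) \<le> \<epsilon> * (2 * W s)"
    proof -
      have "\<epsilon> * \<bar>W' s\<bar> = \<bar>2 * t - \<epsilon>\<bar>" using e(2) \<epsilon> by (metis abs_mult abs_of_pos)
      moreover have "\<epsilon> * (2 * W s) = 2 * (\<epsilon>\<^sup>2 - \<epsilon> * t + t\<^sup>2)" using e(1) by simp
      moreover have "\<epsilon> * (2 * t - \<epsilon>) \<le> 2 * (\<epsilon>\<^sup>2 - \<epsilon> * t + t\<^sup>2)" "\<epsilon> * (- (2 * t - \<epsilon>)) \<le> 2 * (\<epsilon>\<^sup>2 - \<epsilon> * t + t\<^sup>2)"
        using sq by (simp_all add: power2_eq_square algebra_simps)
      ultimately show ?thesis by (simp add: abs_if)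
    qed
    then have "\<epsilon> * \<bar>W' s\<bar> \<le> 2 * W s" using \<epsilon> by simp
    ultimately show ?thesis by simp
  qed
  have W_pos: "W s > 0" and W'_le: "\<epsilon> * \<bar>W' s\<bar> \<le> 2 * W s" for s using W_both by auto
  have dW: "(W has_real_derivative W' s) (at s)" for s
  proof -
    have P: "((\<lambda>t. max 0 t powr 2) has_real_derivative 2 * max 0 t) (at t)" for t :: real
      using max0_powr_has_real_derivative[of 2 t] by simp
    have 1: "((\<lambda>s. s - m - M) has_real_derivative 1) (at s)" by (auto intro!: derivative_eq_intros)
    have "((\<lambda>s. max 0 (s - m - M) powr 2) has_real_derivative 2 * max 0 (s - m - M)) (at s)"
      using DERIV_chain2[OF P 1] by simp
    from DERIV_add[OF DERIV_diff[OF DERIV_const[of \<epsilon>] 1] DERIV_cmult[OF this, of "1 / \<epsilon>"]]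
    show ?thesis by (simp add: W_def[abs_def] W'_def)
  qed
  have cW': "continuous_on UNIV W'" unfolding W'_def[abs_def] by (intro continuous_intros)
  have cW: "continuous_on UNIV W" using dW by (meson DERIV_isCont continuous_at_imp_continuous_on)
  have W_ne: "W s \<noteq> 0" for s using W_pos[of s] by simp

  define H where "H s = W s powr (1 - p)" for s
  define H' where "H' s = (1 - p) * W s powr (- p) * W' s" for s
  have dH: "(H has_real_derivative H' s) (at s)" for s
    using DERIV_chain2[OF has_real_derivative_powr[OF W_pos] dW, of "1 - p" s] by (simp add: H_def[abs_def] H'_def)
  have cH': "continuous_on UNIV H'"
    unfolding H'_def[abs_def] by (intro continuous_intros cW cW') (use W_ne in auto)

  \<comment> \<open>The radii are nested: q is negative outside radius 5/4 r since 25/16 > 3/2, it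
    is bounded below on radius 11/10 r, and the gap from r to 11/10 r is spent in
    \<open>morrey_wgrad\<close>.\<close>
  define q where "q w = 3 / 2 - (norm (w - z))\<^sup>2 / r\<^sup>2" for w
  define Q where "Q w = (- (2 / r\<^sup>2)) *\<^sub>R (w - z)" for w
  have q_le: "q w \<le> 3 / 2" for w by (simp add: q_def)
  have q_out: "q w < 0" if "w \<notin> cball z (5 / 4 * r)" for w
  proof -
    have "(5 / 4 * r)\<^sup>2 < (norm (w - z))\<^sup>2"
      using that r by (intro power_strict_mono) (auto simp: dist_norm norm_minus_commute)
    moreover have "(5 / 4 * r)\<^sup>2 = 25 / 16 * r\<^sup>2" by (simp add: power2_eq_square)
    moreover have r2: "r\<^sup>2 > 0" using r by simp
    ultimately have "3 / 2 * r\<^sup>2 < (norm (w - z))\<^sup>2" by linarith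
    then show ?thesis using r2 by (simp add: q_def less_divide_eq)
  qed
  have q_in: "q w \<ge> 29 / 100" if "w \<in> cball z (11 / 10 * r)" for w
  proof -
    have "(norm (w - z))\<^sup>2 \<le> (11 / 10 * r)\<^sup>2"
      using that by (intro power_mono) (auto simp: dist_norm norm_minus_commute)
    then have "(norm (w - z))\<^sup>2 / r\<^sup>2 \<le> (11 / 10)\<^sup>2" using r by (simp add: field_simps power2_eq_square)
    then show ?thesis by (simp add: q_def power2_eq_square)
  qed
  have Q_le: "norm (Q w) \<le> 5 / 2 / r" if "w \<in> cball z (5 / 4 * r)" for w
  proof -
    have "norm (w - z) \<le> 5 / 4 * r" using that by (simp add: dist_norm norm_minus_commute)
    then have "2 / r\<^sup>2 * norm (w - z) \<le> 2 / r\<^sup>2 * (5 / 4 * r)" by (rule mult_left_mono) simp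
    moreover have "norm (Q w) = 2 / r\<^sup>2 * norm (w - z)" unfolding Q_def norm_scaleR by simp
    moreover have "2 / r\<^sup>2 * (5 / 4 * r) = 5 / 2 / r" using r by (simp add: power2_eq_square)
    ultimately show ?thesis by simp
  qed
  have dq: "(q has_derivative (\<lambda>v. Q w \<bullet> v)) (at w)" for w
  proof -
    have "((\<lambda>w. 3 / 2 - ((w - z) \<bullet> (w - z)) * k) has_derivative
        (\<lambda>v. - (((w - z) \<bullet> v + v \<bullet> (w - z)) * k))) (at w)" for k
      by (auto intro!: derivative_eq_intros)
    from this[of "1 / r\<^sup>2"] have "((\<lambda>w. 3 / 2 - ((w - z) \<bullet> (w - z)) * (1 / r\<^sup>2)) has_derivative
        (\<lambda>v. - (((w - z) \<bullet> v + v \<bullet> (w - z)) * (1 / r\<^sup>2)))) (at w)" .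
    moreover have "(\<lambda>v. - (((w - z) \<bullet> v + v \<bullet> (w - z)) * (1 / r\<^sup>2))) = (\<lambda>v. Q w \<bullet> v)"
      unfolding Q_def inner_scaleR_left by (simp add: inner_commute)
    ultimately show ?thesis by (simp add: q_def[abs_def] power2_norm_eq_inner)
  qed
  have cq: "continuous_on UNIV q" unfolding q_def[abs_def] by (intro continuous_intros) (use r in auto)
  have cQ: "continuous_on UNIV Q" unfolding Q_def[abs_def] by (intro continuous_intros)
  define \<zeta> where "\<zeta> w = max 0 (q w) powr p" for w
  define Z where "Z w = (p * max 0 (q w) powr (p - 1)) *\<^sub>R Q w" for w
  have \<zeta>C1: "C1_grad \<zeta> Z"
    unfolding C1_grad_def
  proof (intro conjI allI)
    fix w
    show "(\<zeta> has_derivative (\<lambda>h. Z w \<bullet> h)) (at w)"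
      using has_derivative_compose[OF dq max0_powr_has_real_derivative[OF p2(4), unfolded has_field_derivative_def]]
      by (simp add: \<zeta>_def[abs_def] Z_def)
    show "continuous_on UNIV Z" unfolding Z_def[abs_def]
      by (intro continuous_intros continuous_on_max0_powr cq cQ) (use p2 in auto)
  qed
  have \<zeta>0: "\<zeta> w = 0" "Z w = 0" if "q w \<le> 0" for w using that p2 by (simp_all add: \<zeta>_def Z_def)
  define R where "R = norm z + 5 / 4 * r"
  have \<zeta>R: "\<zeta> w = 0" if "norm w > R" for w
  proof -
    have "w \<notin> cball z (5 / 4 * r)"
      using that norm_triangle_sub[of w z] by (auto simp: R_def dist_norm norm_minus_commute)
    then show ?thesis using q_out[of w] \<zeta>0 by simp
  qed

  \<comment> \<open>Chosen so that the weight \<open>l\<close> below is at most 1, given q \<le> 3/2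
    and W \<ge> \<epsilon> on the support of the cutoff.\<close>
  define \<tau> where "\<tau> = \<epsilon> powr p / ((p - 1) * (3 / 2) powr p)"
  have \<tau>: "\<tau> > 0" using \<epsilon> p2 by (simp add: \<tau>_def)
  have wH: "wgradp p (\<lambda>w. \<zeta> w * H (u w)) (\<lambda>w. H (u w) *\<^sub>R Z w + (\<zeta> w * H' (u w)) *\<^sub>R D w)"
    by (rule wgradp_cutoff[OF wu p2(3) \<zeta>C1 \<zeta>R dH cH'])
  define V where "V w = 1 *\<^sub>R D w + (- \<tau>) *\<^sub>R (H (u w) *\<^sub>R Z w + (\<zeta> w * H' (u w)) *\<^sub>R D w)" for w
  have wV: "wgradp p (\<lambda>w. 1 * u w + (- \<tau>) * (\<zeta> w * H (u w))) V"
    unfolding V_def[abs_def] by (rule wgradp_add[OF wu wH p2(3)])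
  \<comment> \<open>The competitor agrees with u at x0 and y0, which lie outside the support of the
    cutoff.\<close>
  have E: "energy p D \<le> energy p V"
    by (rule min[OF wV]) (use \<zeta>0 q_out[OF out(1)] q_out[OF out(2)] in auto)

  define f1 where "f1 w = \<zeta> w * W (u w) powr (- p) * norm (D w) powr p" for w
  define f2 where "f2 w = (5 / 2 / r) powr p * indicator (cball z (5 / 4 * r)) w" for w
  have pointwise: "norm (V w) powr p \<le> norm (D w) powr p - \<tau> * (p - 1) * f1 w + \<tau> * (p - 1) * (p / (p - 1)) powr p * f2 w" for w
  proof (cases "q w \<le> 0")
    case True
    then have "V w = D w" "f1 w = 0" by (simp_all add: V_def f1_def \<zeta>0)
    moreover have "0 \<le> \<tau> * (p - 1) * (p / (p - 1)) powr p * f2 w" using \<tau> p2 by (simp add: f2_def)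
    ultimately show ?thesis by simp
  next
    case False
    then have q: "q w > 0" "w \<in> cball z (5 / 4 * r)" using q_out[of w] by (auto intro: ccontr)
    have low: "u w - m \<le> M" by (rule M[OF q(2)])
    define a where "a = W (u w)"
    have a1: "a \<ge> \<epsilon>" using W_low(1)[OF low] low by (simp add: a_def)
    then have a: "a \<ge> \<epsilon>" "a > 0" using \<epsilon> by linarith+
    define l where "l = \<tau> * (p - 1) * (q w powr p * a powr (- p))"
    have l0: "l \<ge> 0" using \<tau> p2 by (simp add: l_def)
    have "q w powr p * a powr (- p) \<le> (3 / 2) powr p * \<epsilon> powr (- p)"
      using q q_le[of w] a \<epsilon> p2 by (intro mult_mono powr_mono2 powr_mono2') auto
    then have "l \<le> \<tau> * (p - 1) * ((3 / 2) powr p * \<epsilon> powr (- p))"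
      unfolding l_def using \<tau> p2 by (intro mult_left_mono) auto
    also have "\<dots> = 1" using \<epsilon> p2 by (simp add: \<tau>_def powr_minus field_simps)
    finally have l1: "l \<le> 1" .
    \<comment> \<open>Where W' = -1, the term \<tau> \<zeta> H' D of the competitor's gradient is
      exactly l D; b is defined so that the term with the gradient of \<zeta> becomes l b.\<close>
    define b where "b = (- (p / (p - 1) * (a / q w))) *\<^sub>R Q w"
    have VD: "V w = (1 - l) *\<^sub>R D w + l *\<^sub>R b"
    proof -
      have H: "H (u w) = a * a powr (- p)" "H' (u w) = (p - 1) * a powr (- p)"
        using a W_low(2)[OF low] by (simp_all add: H_def H'_def a_def powr_diff powr_minus field_simps)
      have z: "\<zeta> w = q w powr p" "Z w = (p * (q w powr p / q w)) *\<^sub>R Q w"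
        using q by (simp_all add: \<zeta>_def Z_def powr_diff)
      have "\<tau> * (\<zeta> w * H' (u w)) = l" by (simp add: H z l_def mult_ac)
      moreover have "\<tau> * (H (u w) * (p * (q w powr p / q w))) = l * (p / (p - 1) * (a / q w))"
        using p2 q by (simp add: H l_def field_simps)
      moreover have "V w = D w - (\<tau> * (H (u w) * (p * (q w powr p / q w)))) *\<^sub>R Q w - (\<tau> * (\<zeta> w * H' (u w))) *\<^sub>R D w"
        by (simp add: V_def z(2) algebra_simps)
      ultimately show ?thesis by (simp add: b_def algebra_simps)
    qed
    \<comment> \<open>The exponents 1 - p of W and p of the cutoff are made for this cancellation: l
      carries (q / W)^p, the p-th power of the norm of b carries (W / q)^p, and no trace of u
      remains.\<close>
    have nb: "l * norm b powr p = \<tau> * (p - 1) * (p / (p - 1)) powr p * norm (Q w) powr p"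
    proof -
      have "norm b = p / (p - 1) * (a / q w) * norm (Q w)" using p2 a q by (simp add: b_def abs_mult)
      then have "norm b powr p = (p / (p - 1)) powr p * (a powr p / q w powr p) * norm (Q w) powr p"
        using p2 a q by (simp add: powr_mult powr_divide)
      then show ?thesis using a q by (simp add: l_def powr_minus field_simps)
    qed
    have "norm (V w) powr p \<le> (1 - l) * norm (D w) powr p + l * norm b powr p"
      unfolding VD by (rule norm_powr_convex[OF p2(3) l0 l1])
    also have "\<dots> = norm (D w) powr p - \<tau> * (p - 1) * f1 w + \<tau> * (p - 1) * (p / (p - 1)) powr p * norm (Q w) powr p"
      unfolding nb using q by (simp add: l_def f1_def \<zeta>_def a_def algebra_simps)
    also have "\<dots> \<le> norm (D w) powr p - \<tau> * (p - 1) * f1 w + \<tau> * (p - 1) * (p / (p - 1)) powr p * f2 w"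
      using Q_le[OF q(2)] q(2) p2 \<tau> by (intro add_left_mono mult_left_mono) (auto simp: f2_def intro!: powr_mono2)
    finally show ?thesis .
  qed

  have cWp: "continuous_on UNIV (\<lambda>w. \<zeta> w * W (u w) powr (- p))"
  proof (intro continuous_intros C1_gradD(3)[OF \<zeta>C1])
    show "continuous_on UNIV (\<lambda>w. W (u w))"
      by (rule continuous_on_compose2[OF cW wgradpD(3)[OF wu]]) auto
  qed (use W_ne in auto)
  obtain B where B: "B > 0" "\<And>w. norm (\<zeta> w * W (u w) powr (- p)) \<le> B"
    by (rule compact_support_bounded[OF cWp, of R]) (use \<zeta>R in auto)
  have i1: "integrable lborel f1"
  proof (rule Bochner_Integration.integrable_bound)
    show "integrable lborel (\<lambda>w. B * norm (D w) powr p)" using wgradpD(2)[OF wu] by simp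
    have "(\<lambda>w. \<zeta> w * W (u w) powr (- p)) \<in> borel_measurable borel"
      by (rule borel_measurable_continuous_onI[OF cWp])
    then show "f1 \<in> borel_measurable lborel"
      unfolding f1_def[abs_def] using wgradpD(4)[OF wu] by measurable
    show "AE w in lborel. norm (f1 w) \<le> norm (B * norm (D w) powr p)"
    proof (intro AE_I2)
      fix w
      have "norm (f1 w) = norm (\<zeta> w * W (u w) powr (- p)) * norm (D w) powr p"
        by (simp add: f1_def abs_mult)
      also have "\<dots> \<le> B * norm (D w) powr p" by (intro mult_right_mono B) simp
      finally show "norm (f1 w) \<le> norm (B * norm (D w) powr p)" using B(1) by simp
    qed
  qed
  have i2: "integrable lborel f2"
    unfolding f2_def[abs_def] by (intro integrable_mult_right integrable_indicator_cball)
  have "energy p V \<le> (LBINT w. norm (D w) powr p - \<tau> * (p - 1) * f1 w + \<tau> * (p - 1) * (p / (p - 1)) powr p * f2 w)"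
    unfolding energy_def
    by (rule Bochner_Integration.integral_mono[OF wgradpD(2)[OF wV]])
      (use wgradpD(2)[OF wu] i1 i2 pointwise in auto)
  also have "\<dots> = energy p D - \<tau> * (p - 1) * (LBINT w. f1 w) + \<tau> * (p - 1) * (p / (p - 1)) powr p * (LBINT w. f2 w)"
    unfolding energy_def using wgradpD(2)[OF wu] i1 i2 by simp
  finally have "(\<tau> * (p - 1)) * (LBINT w. f1 w) \<le> (\<tau> * (p - 1)) * ((p / (p - 1)) powr p * (LBINT w. f2 w))"
    using E by (simp add: mult.assoc)
  \<comment> \<open>Minimality cancels the energy of u and the factor \<tau> (p - 1) drops out, so
    the bound depends on neither \<epsilon> nor M.\<close>
  then have f12: "(LBINT w. f1 w) \<le> (p / (p - 1)) powr p * (LBINT w. f2 w)"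
    using \<tau> p2 by simp
  have f2: "(LBINT w. f2 w) = (5 / 2 / r) powr p * (unit_ball_vol (real CARD('n)) * (5 / 4 * r) ^ CARD('n))"
    using r content_cball[of "5 / 4 * r" z] by (simp add: f2_def)

  define C where "C = (p / (p - 1) * (5 / 2) / (29 / 100)) powr p * (unit_ball_vol (real CARD('n)) * (5 / 4) ^ CARD('n))"
  have "unit_ball_vol (real CARD('n)) > 0" by (rule unit_ball_vol_pos) simp
  then have C: "C > 0" using p2 by (simp add: C_def)
  \<comment> \<open>The power n - p of r is n from the volume and - p from the gradient of the
    cutoff; its p-th root cancels the factor r^(1 - n/p) of Morrey's inequality.\<close>
  define J where "J = C * r powr (real CARD('n) - p)"
  have J: "J > 0" using C r by (simp add: J_def)

  define L where "L s = ln (W s)" for s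
  define L' where "L' s = W' s / W s" for s
  have dL: "(L has_real_derivative L' s) (at s)" for s
    using DERIV_chain2[OF DERIV_ln_divide[OF W_pos] dW, of s] by (simp add: L_def[abs_def] L'_def)
  have cL': "continuous_on UNIV L'" unfolding L'_def[abs_def]
    by (intro continuous_intros cW cW') (use W_ne in auto)
  have bL: "\<bar>L' s\<bar> \<le> 2 / \<epsilon>" for s
    using W'_le[of s] W_pos[of s] \<epsilon> by (simp add: L'_def field_simps)
  have wL: "wgradp p (\<lambda>w. L (u w)) (\<lambda>w. L' (u w) *\<^sub>R D w)" by (rule wgradp_comp[OF wu p2(3) dL cL' bL])
  have "(\<integral>\<^sup>+w. ennreal (norm (L' (u w) *\<^sub>R D w) powr p) * indicator (cball z (11 / 10 * r)) w \<partial>lborel)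
    \<le> (\<integral>\<^sup>+w. ennreal ((29 / 100) powr (- p) * f1 w) \<partial>lborel)"
  proof (rule nn_integral_mono)
    fix w
    show "ennreal (norm (L' (u w) *\<^sub>R D w) powr p) * indicator (cball z (11 / 10 * r)) w \<le> ennreal ((29 / 100) powr (- p) * f1 w)"
    proof (cases "w \<in> cball z (11 / 10 * r)")
      case True
      then have w: "w \<in> cball z (5 / 4 * r)" using r by auto
      have "norm (L' (u w) *\<^sub>R D w) powr p = W (u w) powr (- p) * norm (D w) powr p"
        using W_low(2)[OF M[OF w]] W_pos[of "u w"] by (simp add: L'_def powr_divide powr_minus field_simps)
      also have "\<dots> \<le> ((29 / 100) powr (- p) * \<zeta> w) * (W (u w) powr (- p) * norm (D w) powr p)"
      proof -
        have "(29 / 100) powr p \<le> \<zeta> w"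
          using q_in[OF True] p2 by (auto simp: \<zeta>_def intro!: powr_mono2)
        then have "1 \<le> (29 / 100) powr (- p) * \<zeta> w" by (simp add: powr_minus field_simps)
        from mult_right_mono[OF this, of "W (u w) powr (- p) * norm (D w) powr p"] show ?thesis by simp
      qed
      also have "\<dots> = (29 / 100) powr (- p) * f1 w" by (simp add: f1_def mult_ac)
      finally show ?thesis using True by (simp add: ennreal_leI)
    qed simp
  qed
  also have "\<dots> = ennreal (LBINT w. (29 / 100) powr (- p) * f1 w)"
  proof (rule nn_integral_eq_integral)
    show "integrable lborel (\<lambda>w. (29 / 100) powr (- p) * f1 w)" using i1 by simp
  qed (simp add: f1_def \<zeta>_def)
  also have "\<dots> \<le> ennreal J"
  proof (rule ennreal_leI)
    have "(LBINT w. (29 / 100) powr (- p) * f1 w) = (29 / 100) powr (- p) * (LBINT w. f1 w)" using i1 by simp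
    also have "\<dots> \<le> (29 / 100) powr (- p) * ((p / (p - 1)) powr p * (LBINT w. f2 w))"
      by (intro mult_left_mono f12) simp
    also have "\<dots> = J"
    proof -
      have 1: "(p / (p - 1) * (5 / 2) / (29 / 100)) powr p = (p / (p - 1)) powr p * (5 / 2) powr p / (29 / 100) powr p"
        using p2 by (simp only: powr_mult powr_divide)
      have 2: "(5 / 2 / r) powr p = (5 / 2) powr p / r powr p" by (rule powr_divide)
      have 3: "(5 / 4 * r) ^ CARD('n) = (5 / 4) ^ CARD('n) * r powr real CARD('n)"
        unfolding powr_realpow[OF r] by (rule power_mult_distrib)
      show ?thesis unfolding f2 J_def C_def 1 2 3 powr_diff powr_minus by (simp add: field_simps)
    qed
    finally show "(LBINT w. (29 / 100) powr (- p) * f1 w) \<le> J" .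
  qed
  finally have le: "(\<integral>\<^sup>+w. ennreal (norm (L' (u w) *\<^sub>R D w) powr p) * indicator (cball z (11 / 10 * r)) w \<partial>lborel) \<le> ennreal J" .
  have "\<bar>L (u x) - L (u y)\<bar> \<le> morrey_K TYPE('n) p * r powr (1 - real CARD('n) / p) * J powr (1 / p)"
    by (rule morrey_wgrad[OF wgradpD(1)[OF wL] loc_int_of_powr(2)[OF wgradpD(4,2)[OF wL] p2(3)] p_gt r _ x y J le])
      (use r in simp)
  also have "J powr (1 / p) = C powr (1 / p) * r powr (real CARD('n) / p - 1)"
    using C r p2 by (simp add: J_def powr_mult powr_powr diff_divide_distrib)
  also have "morrey_K TYPE('n) p * r powr (1 - real CARD('n) / p) * (C powr (1 / p) * r powr (real CARD('n) / p - 1))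
    = osc * (r powr (1 - real CARD('n) / p) * r powr (real CARD('n) / p - 1))"
    by (simp add: osc_def C_def mult_ac)
  also have "r powr (1 - real CARD('n) / p) * r powr (real CARD('n) / p - 1) = 1"
    using r by (simp flip: powr_add)
  finally have "\<bar>L (u x) - L (u y)\<bar> \<le> osc" by simp
  moreover have "x \<in> cball z (5 / 4 * r)" "y \<in> cball z (5 / 4 * r)" using x y r by auto
  then have "W (u x) = M + \<epsilon> - (u x - m)" "W (u y) = M + \<epsilon> - (u y - m)" using W_low(1) M by auto
  ultimately show ?thesis by (simp add: L_def)
qed

section \<open>Geometric decay and the power law\<close>

definition R0 where "R0 = 1 + norm (x0 - c)"

text \<open>The summand 1 in \<open>R0\<close> makes these inequalities strict, so a point at
  distance at least \<open>R0\<close> from c is neither x0 nor y0.\<close>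

lemma center: "norm (x0 - c) < R0" "norm (y0 - c) < R0" "R0 > 0"
proof -
  have "y0 - c = - (x0 - c)" by (simp add: c_def algebra_simps flip: scaleR_add_left)
  then have "norm (y0 - c) = norm (x0 - c)" by (metis norm_minus_cancel)
  then show "norm (x0 - c) < R0" "norm (y0 - c) < R0" "R0 > 0" by (simp_all add: R0_def add_pos_nonneg)
qed

text \<open>With \<Lambda> = \<open>exp (2 * osc + 1)\<close>, solving M + s \<le> \<Lambda> (M - s)
  for s gives this factor, equal to tanh (osc + 1/2). The added 1 keeps \<theta> positive even if
  osc = 0; positivity is needed for ln \<theta> and for division by \<theta>.\<close>

definition \<theta> where "\<theta> = (exp (2 * osc + 1) - 1) / (exp (2 * osc + 1) + 1)"

lemma \<theta>_bounds: "0 < \<theta>" "\<theta> < 1"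
proof -
  have "exp (2 * osc + 1) > 1" using osc_nonneg by simp
  moreover have "0 < (E - 1) / (E + 1)" "(E - 1) / (E + 1) < 1" if "E > 1" for E :: real
    using that by simp_all
  ultimately show "0 < \<theta>" "\<theta> < 1" unfolding \<theta>_def by blast+
qed

text \<open>The point \<open>x\<close> and its antipode with respect to \<open>c\<close> are joined by two balls that stay away from
  \<open>x0\<close> and \<open>y0\<close>; their centres are \<open>c \<plusminus> a + e\<close> with \<open>a = x - c\<close> and \<open>e\<close> orthogonal to \<open>a\<close>.\<close>

lemma decay_step_upper:
  assumes R: "R \<ge> R0" and M: "\<And>x. norm (x - c) \<ge> R \<Longrightarrow> \<bar>u x - m\<bar> \<le> M" and x: "norm (x - c) \<ge> 10 * R"
  shows "u x - m \<le> \<theta> * M"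
proof -
  define a where "a = x - c"
  define r where "r = norm a"
  have r: "r > 0" "r \<ge> 10 * R" "R > 0" using x R center(3) by (auto simp: r_def a_def)
  \<comment> \<open>Exists because the dimension is at least 2.\<close>
  obtain e0 :: "real^'n" where e0: "e0 \<noteq> 0" "orthogonal a e0"
    using orthogonal_to_vector_exists[of a] dim by auto
  define e where "e = (r / norm e0) *\<^sub>R e0"
  have e: "a \<bullet> e = 0" "norm e = r" using e0 r by (simp_all add: e_def orthogonal_def)
  have xc: "x = c + a" by (simp add: a_def)
  have x': "x0 + y0 - x = c - a" by (simp add: a_def c_def algebra_simps flip: scaleR_add_left)
  \<comment> \<open>The centres have distance sqrt 2 r \<ge> 7/5 r from c, which leaves (7/5 - 5/4)
    r = 3/20 r \<ge> 3/2 R; this is why the step moves outward by the factor 10.\<close>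
  have far: "norm (w - c) \<ge> R" if w: "w \<in> cball (c + s *\<^sub>R a + e) (5 / 4 * r)" and s: "\<bar>s\<bar> = 1" for w s
  proof -
    have "(norm (s *\<^sub>R a + e))\<^sup>2 = (s * s) * (norm a)\<^sup>2 + (norm e)\<^sup>2"
      using e(1) by (simp add: power2_norm_eq_inner inner_simps inner_commute)
    also have "s * s = 1" using s by (metis abs_mult_self_eq mult_1)
    finally have "(norm (s *\<^sub>R a + e))\<^sup>2 = 2 * r\<^sup>2" using e(2) by (simp add: r_def)
    moreover have "(7 / 5 * r)\<^sup>2 \<le> 2 * r\<^sup>2" by (simp add: power2_eq_square)
    ultimately have "7 / 5 * r \<le> norm (s *\<^sub>R a + e)" by (metis norm_ge_zero power2_le_imp_le)
    moreover have "norm (s *\<^sub>R a + e) \<le> norm (w - c) + dist (c + s *\<^sub>R a + e) w"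
      using norm_triangle_ineq[of "w - c" "c + s *\<^sub>R a + e - w"] by (simp add: dist_norm)
    ultimately show ?thesis using w r by simp
  qed
  have bound: "u w - m \<le> M" if "w \<in> cball (c + s *\<^sub>R a + e) (5 / 4 * r)" "\<bar>s\<bar> = 1" for w s
    using M[OF far[OF that]] by simp
  have out: "x0 \<notin> cball (c + s *\<^sub>R a + e) (5 / 4 * r)" "y0 \<notin> cball (c + s *\<^sub>R a + e) (5 / 4 * r)" if "\<bar>s\<bar> = 1" for s
    using far[of x0 s] far[of y0 s] that center R by auto
  \<comment> \<open>The point c + e lies in both balls, at distance r from either centre, and links
    x to its antipode c - a.\<close>
  have in1: "x \<in> cball (c + 1 *\<^sub>R a + e) r" "c + e \<in> cball (c + 1 *\<^sub>R a + e) r"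
    using e(2) by (simp_all add: xc dist_norm r_def)
  have in2: "c - a \<in> cball (c + (- 1) *\<^sub>R a + e) r" "c + e \<in> cball (c + (- 1) *\<^sub>R a + e) r"
    using e(2) by (simp_all add: dist_norm r_def)
  have anti: "u (c - a) - m = - (u x - m)" using antisymmetric[of x] unfolding x' .
  have le_M: "\<bar>u x - m\<bar> \<le> M" using x R center(3) by (intro M) linarith
  define \<Lambda> where "\<Lambda> = exp (2 * osc + 1)"
  have \<Lambda>: "\<Lambda> > 1" using osc_nonneg by (simp add: \<Lambda>_def)
  have key: "u x - m \<le> \<theta> * (M + \<epsilon>)" if \<epsilon>: "\<epsilon> > 0" for \<epsilon>
  proof -
    define s where "s = u x - m"
    let ?l = "\<lambda>w. ln (M + \<epsilon> - (u w - m))"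
    have "\<bar>?l x - ?l (c + e)\<bar> \<le> osc"
      by (rule log_oscillation[OF r(1) \<epsilon> _ _ _ in1]) (use bound[of _ 1] out[of 1] in auto)
    moreover have "\<bar>?l (c - a) - ?l (c + e)\<bar> \<le> osc"
      by (rule log_oscillation[OF r(1) \<epsilon> _ _ _ in2]) (use bound[of _ "- 1"] out[of "- 1"] in auto)
    \<comment> \<open>Two oscillations, one per ball, plus the slack 1 built into \<theta>.\<close>
    ultimately have "?l (c - a) \<le> ?l x + (2 * osc + 1)" by linarith
    moreover have "M + \<epsilon> - (u (c - a) - m) = M + \<epsilon> + s" using anti by (simp add: s_def)
    ultimately have "ln (M + \<epsilon> + s) \<le> ln (M + \<epsilon> - s) + (2 * osc + 1)" by (simp only: s_def)
    moreover have pos: "M + \<epsilon> + s > 0" "M + \<epsilon> - s > 0" using le_M \<epsilon> by (auto simp: s_def)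
    ultimately have "M + \<epsilon> + s \<le> exp (ln (M + \<epsilon> - s) + (2 * osc + 1))" by (metis exp_le_cancel_iff exp_ln)
    also have "\<dots> = (M + \<epsilon> - s) * \<Lambda>" using pos(2) by (simp only: exp_add exp_ln \<Lambda>_def)
    finally have "s * (\<Lambda> + 1) \<le> (\<Lambda> - 1) * (M + \<epsilon>)" by (simp add: algebra_simps)
    then have "s \<le> (\<Lambda> - 1) * (M + \<epsilon>) / (\<Lambda> + 1)" using \<Lambda> by (simp add: pos_le_divide_eq)
    then show ?thesis by (simp add: s_def \<theta>_def \<Lambda>_def)
  qed
  show ?thesis
  proof (rule field_le_epsilon)
    fix \<delta> :: real assume \<delta>: "\<delta> > 0"
    have "u x - m \<le> \<theta> * M + \<theta> * \<delta>" using key[OF \<delta>] by (simp add: distrib_left)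
    also have "\<theta> * \<delta> \<le> \<delta>" using \<theta>_bounds \<delta> by simp
    finally show "u x - m \<le> \<theta> * M + \<delta>" by simp
  qed
qed

text \<open>The lower bound at x is the upper bound at its antipode, by
  \<open>antisymmetric\<close>.\<close>

lemma decay_step:
  assumes R: "R \<ge> R0" and M: "\<And>x. norm (x - c) \<ge> R \<Longrightarrow> \<bar>u x - m\<bar> \<le> M" and x: "norm (x - c) \<ge> 10 * R"
  shows "\<bar>u x - m\<bar> \<le> \<theta> * M"
proof -
  have "x0 + y0 - x - c = - (x - c)" by (simp add: c_def algebra_simps flip: scaleR_add_left)
  then have "norm (x0 + y0 - x - c) \<ge> 10 * R" using x by (metis norm_minus_cancel)
  from decay_step_upper[OF R M this] decay_step_upper[OF R M x] antisymmetric[of x] show ?thesis by simp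
qed

lemma geometric_decay: "norm (x - c) \<ge> 10 ^ k * R0 \<Longrightarrow> \<bar>u x - m\<bar> \<le> \<theta> ^ k * h"
proof (induction k arbitrary: x)
  case 0
  then show ?case using bounded_by_h by simp
next
  case (Suc k)
  have "\<bar>u x - m\<bar> \<le> \<theta> * (\<theta> ^ k * h)"
  proof (rule decay_step[where R="10 ^ k * R0"])
    show "R0 \<le> 10 ^ k * R0" using center(3) by simp
  qed (use Suc in auto)
  then show ?case by simp
qed

text \<open>Solves \<open>10 powr (- decay_exponent) = \<theta>\<close>: each factor 10 in distance
  gains one factor \<theta>.\<close>

definition decay_exponent where "decay_exponent = - ln \<theta> / ln 10"

lemma decay_exponent_pos: "decay_exponent > 0"
  using \<theta>_bounds by (simp add: decay_exponent_def ln_less_zero divide_neg_pos)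

lemma power_decay:
  assumes x: "norm (x - c) \<ge> R0"
  shows "\<bar>u x - m\<bar> \<le> h / \<theta> * (norm (x - c) / R0) powr (- decay_exponent)"
proof -
  define t where "t = norm (x - c) / R0"
  have t: "t \<ge> 1" using x center(3) by (simp add: t_def)
  \<comment> \<open>Rounding the logarithm down loses at most one factor \<theta>, whence the
    constant h / \<theta>.\<close>
  define k where "k = nat \<lfloor>log 10 t\<rfloor>"
  have l0: "log 10 t \<ge> 0" using t by simp
  then have k: "real k \<le> log 10 t" "log 10 t \<le> real k + 1"
    unfolding k_def by (auto intro: less_imp_le)
  have "10 powr real k \<le> t" using k(1) t by (simp add: le_log_iff)
  then have "10 ^ k * R0 \<le> norm (x - c)" using center(3) by (simp add: powr_realpow t_def le_divide_eq)
  then have "\<bar>u x - m\<bar> \<le> \<theta> ^ k * h" by (rule geometric_decay)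
  also have "\<theta> ^ k = \<theta> powr (real k + 1) / \<theta>" using \<theta>_bounds by (simp add: powr_add powr_realpow)
  also have "\<theta> powr (real k + 1) \<le> \<theta> powr (log 10 t)"
    using k(2) \<theta>_bounds by (intro powr_mono') auto
  \<comment> \<open>Base and argument are exchanged: both sides are exp (ln \<theta> ln t / ln
    10).\<close>
  also have "\<theta> powr (log 10 t) = t powr (- decay_exponent)"
    using \<theta>_bounds t by (simp add: powr_def decay_exponent_def log_def)
  finally show ?thesis using h_pos \<theta>_bounds by (simp add: t_def divide_right_mono mult_right_mono mult_ac)
qed

end

theorem corollary4p7:
  fixes u :: "real^'n \<Rightarrow> real" and x\<^sub>0 y\<^sub>0 :: "real^'n" and p :: real
  assumes "CARD('n) \<ge> 2"
    and "p > real CARD('n)"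
    and "morrey_extremal p u"
    and "x\<^sub>0 \<noteq> y\<^sub>0"
    and "holder_seminorm p u = ennreal (holder_quotient p u x\<^sub>0 y\<^sub>0)"
  shows "\<exists>A \<alpha> s. A > 0 \<and> \<alpha> > 0 \<and> s > 0 \<and>
    (\<forall>x. norm x > s \<longrightarrow>
      \<bar>u x - 1/2 * (u x\<^sub>0 + u y\<^sub>0)\<bar> \<le> A * max \<bar>u x\<^sub>0\<bar> \<bar>u y\<^sub>0\<bar> / norm x powr \<alpha>)"
proof -
  obtain D where D: "wgradp p u D" "u x\<^sub>0 \<noteq> u y\<^sub>0"
    "\<And>v V. wgradp p v V \<Longrightarrow> \<bar>v x\<^sub>0 - v y\<^sub>0\<bar> = \<bar>u x\<^sub>0 - u y\<^sub>0\<bar> \<Longrightarrow> energy p D \<le> energy p V"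
    using extremal_minimizes_energy[OF assms(2-5)] by metis
  interpret energy_minimizer u D p x\<^sub>0 y\<^sub>0
    by unfold_locales (use assms D in auto)
  define \<mu> where "\<mu> = max \<bar>u x\<^sub>0\<bar> \<bar>u y\<^sub>0\<bar>"
  have \<mu>: "\<mu> > 0" using D(2) by (auto simp: \<mu>_def)
  define B where "B = h / \<theta> * (2 * R0) powr decay_exponent"
  have B: "B > 0" using h_pos \<theta>_bounds center(3) by (simp add: B_def)
  \<comment> \<open>Beyond s the distance to c is at least \<open>R0\<close> and at least half the
    distance to the origin, so the decay about c becomes decay about 0.\<close>
  define s where "s = 2 * (norm c + R0)"
  have s: "s > 0" using center(3) by (simp add: s_def add_nonneg_pos)
  \<comment> \<open>The witness for A is B / \<mu>, which may depend on u; \<mu> > 0 because u takes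
    different values at the two points.\<close>
  have main: "\<bar>u x - 1/2 * (u x\<^sub>0 + u y\<^sub>0)\<bar> \<le> B / \<mu> * \<mu> / norm x powr decay_exponent" if x: "norm x > s" for x
  proof -
    have "norm x \<le> norm (x - c) + norm c" by (metis norm_triangle_sub add.commute)
    moreover have "norm x > 2 * norm c + 2 * R0" using x by (simp add: s_def)
    moreover note center(3) norm_ge_zero[of c]
    ultimately have far: "norm (x - c) \<ge> norm x / 2" "norm (x - c) \<ge> R0" and x0: "norm x > 0"
      by (linarith, linarith, linarith)
    have "\<bar>u x - m\<bar> \<le> h / \<theta> * (norm (x - c) / R0) powr (- decay_exponent)" by (rule power_decay[OF far(2)])
    also have "\<dots> \<le> h / \<theta> * (norm x / (2 * R0)) powr (- decay_exponent)"
    proof (intro mult_left_mono powr_mono2')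
      show "norm x / (2 * R0) \<le> norm (x - c) / R0" using far(1) center(3) by (simp add: field_simps)
    qed (use x0 center(3) decay_exponent_pos h_pos \<theta>_bounds in auto)
    also have "\<dots> = B / norm x powr decay_exponent"
      by (simp add: B_def powr_minus powr_divide)
    finally show ?thesis using \<mu> by (simp add: m_def)
  qed
  show ?thesis
    using B \<mu> decay_exponent_pos s main unfolding \<mu>_def
    by (intro exI[of _ "B / max \<bar>u x\<^sub>0\<bar> \<bar>u y\<^sub>0\<bar>"] exI[of _ decay_exponent] exI[of _ s]) simp
qed

end
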